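(* Let $u$ be a weak solution of the Camassa-Holm equation. Fix $t_0\ge0$. Let $\alpha(\cdot),\beta(\cdot)$ be any characteristics of $u$ satisfying $\alpha(t_0)<\beta(t_0)$. Then $$\lim_{t\to t_0^+}\int_{[\alpha(t),\beta(t)]}(u_x^-(t,x))^2dx=\int_{[\alpha(t_0),\beta(t_0)]}(u_x^-(t_0,x))^2dx,$$ $$\lim_{t\to t_0^-}\int_{[\alpha(t),\beta(t)]}(u_x^+(t,x))^2dx=\int_{[\alpha(t_0),\beta(t_0)]}(u_x^+(t_0,x))^2dx.$$ Moreover, the functions $$t\mapsto\int_{[\alpha(t),\beta(t)]}(u_x^+(t,x))^2dx\quad\text{and}\quad t\mapsto\int_{[\alpha(t),\beta(t)]}(u_x^-(t,x))^2dx$$ have locally bounded variation. In particular, there exist nonnegative numbers $\Lambda_+^{\alpha(\cdot),\beta(\cdot)}$, $\Lambda_-^{\alpha(\cdot),\beta(\cdot)}$ such that $$\lim_{t\to t_0^+}\int_{[\alpha(t),\beta(t)]}(u_x^+(t,x))^2dx=\Lambda_+^{\alpha(\cdot),\beta(\cdot)},\qquad \lim_{t\to t_0^-}\int_{[\alpha(t),\beta(t)]}(u_x^-(t,x))^2dx=\Lambda_-^{\alpha(\cdot),\beta(\cdot)}.$$ (The limits $t\to t_0^-$ are considered only if $t_0>0$.)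
   Context: The Camassa-Holm equation is taken in the form $$u_t+uu_x=\int_{\mathbb{R}}\tfrac12\,\mathrm{sgn}(x-y)e^{-|x-y|}\left(u^2(t,y)+\tfrac12u_x^2(t,y)\right)dy,\qquad u(0,x)=u_0(x),$$ for $t\ge 0$, $x\in\mathbb{R}$. A function $u:[0,\infty)\times\mathbb{R}\to\mathbb{R}$ is a weak solution if $u\in C([0,\infty)\times\mathbb{R})$, the function $t\mapsto\int_{\mathbb{R}}(u^2(t,x)+\frac12u_x^2(t,x))dx$ belongs to $L^\infty([0,\infty))$, $u(0,x)=u_0(x)$ for $x\in\mathbb{R}$, and the equation holds in the sense of distributions. A characteristic of $u$ is a function $\zeta:[0,\infty)\to\mathbb{R}$ with $\frac{d}{dt}\zeta(t)=u(t,\zeta(t))$ and $\frac{d}{dt}u(t,\zeta(t))=\int_{\mathbb{R}}\frac12\mathrm{sgn}(\zeta(t)-y)e^{-|\zeta(t)-y|}(u^2(t,y)+\frac12u_x^2(t,y))dy$ (the last identity for a.e. $t$, with $t\mapsto u(t,\zeta(t))$ Lipschitz). Characteristics through a given point are in general not unique. Notation: $f^+=\max(f,0)$, $f^-=\max(-f,0)$, and $u_x^\pm=(u_x)^\pm$. *)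

theory Defs
  imports "HOL-Analysis.Analysis"
begin

text \<open>Test functions. A function is \<open>C\<^sup>k\<^sup>+\<^sup>1\<close> iff it is differentiable and all its
  directional derivatives are \<open>C\<^sup>k\<close>.\<close>

primrec C_diff :: "nat \<Rightarrow> ('a::euclidean_space \<Rightarrow> real) \<Rightarrow> bool" where
  "C_diff 0 f \<longleftrightarrow> continuous_on UNIV f"
| "C_diff (Suc k) f \<longleftrightarrow>
     (\<forall>x. f differentiable (at x)) \<and> (\<forall>v. C_diff k (\<lambda>x. frechet_derivative f (at x) v))"

definition test_fun :: "'a::euclidean_space set \<Rightarrow> ('a \<Rightarrow> real) \<Rightarrow> bool" where
  "test_fun U \<phi> \<longleftrightarrow>
     (\<forall>k. C_diff k \<phi>) \<and> (\<exists>K. compact K \<and> K \<subseteq> U \<and> (\<forall>x. x \<notin> K \<longrightarrow> \<phi> x = 0))"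

definition locally_integrable :: "(real \<Rightarrow> real) \<Rightarrow> bool" where
  "locally_integrable f \<longleftrightarrow> (\<forall>a b. set_integrable lborel {a..b} f)"

definition has_weak_deriv :: "(real \<Rightarrow> real) \<Rightarrow> (real \<Rightarrow> real) \<Rightarrow> bool" where
  "has_weak_deriv f g \<longleftrightarrow> locally_integrable f \<and> locally_integrable g \<and>
     (\<forall>\<phi>. test_fun UNIV \<phi> \<longrightarrow>
        (LINT x|lborel. f x * deriv \<phi> x) = - (LINT x|lborel. g x * \<phi> x))"

text \<open>\<open>u\<^sub>x(t,\<cdot>)\<close> is a representative of the weak spatial derivative, which is
  unique up to null sets. It is arbitrary where \<open>u(t,\<cdot>)\<close> is not weakly differentiable; for a
  weak solution this does not happen, at any time.\<close>

definition dx :: "(real \<Rightarrow> real \<Rightarrow> real) \<Rightarrow> real \<Rightarrow> real \<Rightarrow> real" where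
  "dx u t = (SOME g. has_weak_deriv (u t) g)"

definition energy_density :: "(real \<Rightarrow> real \<Rightarrow> real) \<Rightarrow> real \<Rightarrow> real \<Rightarrow> real" where
  "energy_density u t x = (u t x)\<^sup>2 + 1/2 * (dx u t x)\<^sup>2"

definition CH_source :: "(real \<Rightarrow> real \<Rightarrow> real) \<Rightarrow> real \<Rightarrow> real \<Rightarrow> real" where
  "CH_source u t x =
     (LINT y|lborel. 1/2 * sgn (x - y) * exp (- \<bar>x - y\<bar>) * energy_density u t y)"

text \<open>The second condition gives a meaning to \<open>u\<^sub>x(t,\<cdot>)\<close> and finiteness to the energy for
  almost every time: the Bochner integral of a non-integrable function is 0, so integrability
  is required explicitly. Together with the next two it says that the energy is in
  \<open>L\<^sup>\<infinity>([0,\<infinity>))\<close>. In the last one the space-time integral is iterated, so that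
  the choice of representatives in \<^const>\<open>dx\<close> does not matter.\<close>

definition weak_solution :: "(real \<Rightarrow> real) \<Rightarrow> (real \<Rightarrow> real \<Rightarrow> real) \<Rightarrow> bool" where
  "weak_solution u0 u \<longleftrightarrow>
     continuous_on ({0..} \<times> UNIV) (\<lambda>(t, x). u t x) \<and>
     (AE t in lborel. 0 \<le> t \<longrightarrow>
        (\<exists>g. has_weak_deriv (u t) g) \<and> integrable lborel (energy_density u t)) \<and>
     (\<lambda>t. LINT x|lborel. energy_density u t x) \<in> borel_measurable (lebesgue_on {0..}) \<and>
     (\<exists>M. AE t in lborel. 0 \<le> t \<longrightarrow> (LINT x|lborel. energy_density u t x) \<le> M) \<and>
     (\<forall>x. u 0 x = u0 x) \<and>
     (\<forall>\<phi>. test_fun ({0<..} \<times> UNIV) \<phi> \<longrightarrow>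
        (LINT t:{0<..}|lborel. LINT x|lborel.
           - u t x * deriv (\<lambda>s. \<phi> (s, x)) t + u t x * dx u t x * \<phi> (t, x))
        = (LINT t:{0<..}|lborel. LINT x|lborel. CH_source u t x * \<phi> (t, x)))"

definition characteristic :: "(real \<Rightarrow> real \<Rightarrow> real) \<Rightarrow> (real \<Rightarrow> real) \<Rightarrow> bool" where
  "characteristic u \<zeta> \<longleftrightarrow>
     (\<forall>t\<ge>0. (\<zeta> has_real_derivative u t (\<zeta> t)) (at t within {0..})) \<and>
     (\<exists>L. L-lipschitz_on {0..} (\<lambda>t. u t (\<zeta> t))) \<and>
     (AE t in lborel. 0 \<le> t \<longrightarrow>
        ((\<lambda>s. u s (\<zeta> s)) has_real_derivative CH_source u t (\<zeta> t)) (at t within {0..}))"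

definition bounded_variation_on :: "real set \<Rightarrow> (real \<Rightarrow> real) \<Rightarrow> bool" where
  "bounded_variation_on S f \<longleftrightarrow>
     (\<exists>M. \<forall>n (p::nat \<Rightarrow> real). mono_on {..n} p \<and> p ` {..n} \<subseteq> S \<longrightarrow>
        (\<Sum>i<n. \<bar>f (p (Suc i)) - f (p i)\<bar>) \<le> M)"

definition locally_bounded_variation_on :: "real set \<Rightarrow> (real \<Rightarrow> real) \<Rightarrow> bool" where
  "locally_bounded_variation_on S f \<longleftrightarrow>
     (\<forall>a b. {a..b} \<subseteq> S \<longrightarrow> bounded_variation_on {a..b} f)"

text \<open>The integrals of \<open>(u\<^sub>x\<^sup>+)\<^sup>2\<close> and \<open>(u\<^sub>x\<^sup>-)\<^sup>2\<close> over \<open>[a,b]\<close>, which is empty if \<open>b < a\<close>.\<close>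

definition pos_energy :: "(real \<Rightarrow> real \<Rightarrow> real) \<Rightarrow> real \<Rightarrow> real \<Rightarrow> real \<Rightarrow> real" where
  "pos_energy u t a b = (LINT x:{a..b}|lborel. (max (dx u t x) 0)\<^sup>2)"

definition neg_energy :: "(real \<Rightarrow> real \<Rightarrow> real) \<Rightarrow> real \<Rightarrow> real \<Rightarrow> real \<Rightarrow> real" where
  "neg_energy u t a b = (LINT x:{a..b}|lborel. (max (- dx u t x) 0)\<^sup>2)"

end

theory Submission
  imports Defs "HOL-Complex_Analysis.Great_Picard"
begin

text \<open>
  Let \<open>\<alpha> \<le> \<beta>\<close> be two characteristics, \<open>h = \<beta> - \<alpha>\<close> their distance and \<open>q = u(\<beta>) - u(\<alpha>)\<close> the velocity gap,
  so that \<open>h' = q\<close>. The source of the equation is \<open>-P\<^sub>x\<close>, where \<open>P\<close> is the convolution of the energy density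
  with \<open>1/2 e\<^sup>-\<^sup>|\<^sup>x\<^sup>|\<close>, and \<open>P\<^sub>x\<^sub>x = P - u\<^sup>2 - 1/2 u\<^sub>x\<^sup>2\<close>. The increment of the source over \<open>[\<alpha>, \<beta>]\<close> is
  therefore at least
  \<open>1/2 \<integral> u\<^sub>x\<^sup>2 - C h\<close>, where \<open>C\<close> depends on the energy only, and by Cauchy-Schwarz
  \<open>q' \<ge> q\<^sup>2 / (2h) - C h\<close>. This one-sided Riccati inequality is all that the proof uses of the dynamics.
  Where \<open>q < 0\<close>, the cubic terms in the derivative of \<open>q\<^sup>2 / h\<close> cancel and
  \<open>((q\<^sup>-)\<^sup>2 / h)' \<le> 2 C q\<^sup>-\<close> remains (\<open>compression_energy\<close>).

  The integral \<open>N(t)\<close> of \<open>(u\<^sub>x\<^sup>-)\<^sup>2\<close> over \<open>[\<alpha>(t), \<beta>(t)]\<close> is the supremum of the sums of \<open>(q\<^sup>-)\<^sup>2 / h\<close> over the partitions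
  of that interval, and dyadic partitions suffice. Trace the points of a partition at time \<open>t\<close> backward along
  characteristics to an earlier time \<open>s\<close>. Characteristics are not unique, but the maximum of two of them is a
  characteristic again, so they may be taken in order. Summing the differential inequality gives
  \<open>N(t) \<le> N(s) + K (t - s)\<close> with a constant \<open>K\<close> that is uniform on bounded time intervals (\<open>compression_growth\<close>). Hence
  \<open>N(t) - K t\<close> is nonincreasing, which yields bounded variation, one-sided limits, and
  \<open>limsup N(t) \<le> N(t\<^sub>0)\<close> as \<open>t\<close> decreases to \<open>t\<^sub>0\<close>. In the other direction, each partition sum is continuous in time if the partition points move
  continuously, so that \<open>N\<close> is lower semicontinuous (\<open>compression_lower_semicontinuous\<close>). The equation
  is invariant under the time reversal that sends \<open>u(t, x)\<close> to \<open>-u(T - t, x)\<close>. This exchanges \<open>u\<^sub>x\<^sup>+\<close> and \<open>u\<^sub>x\<^sup>-\<close>, and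
  so the statements on \<open>u\<^sub>x\<^sup>+\<close> follow from those on \<open>u\<^sub>x\<^sup>-\<close> (\<open>CH_flow_reversed\<close>).

  The rest of the work is to justify the inequality for \<open>q\<close> when \<open>u\<close> is only a weak solution. Product test
  functions that approximate indicators of rectangles turn the weak form into a balance law for the integral of \<open>u\<close> over a
  fixed interval (\<open>interval_increment\<close>). A pair of windows \<open>[\<zeta>, \<zeta> + \<epsilon>]\<close> that moves with two curves then obeys a
  balance law in which the flux through the ends is quadratic in the increment of \<open>u\<close> over the window
  (\<open>moving_windows\<close>); divided by \<open>\<epsilon>\<close>, it vanishes with \<open>\<epsilon>\<close>, because \<open>u\<^sub>x\<close> is square integrable. This works along
  every solution of \<open>\<zeta>' = u(t, \<zeta>)\<close>, and such solutions exist by Peano's theorem. Finally, the bound on the energy,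
  given for almost every time, extends to all times because it is a bound on difference quotients, and a
  continuous function with bounded difference quotient energy has a square-integrable derivative
  (\<open>riesz_dyadic\<close>).
\<close>

section \<open>Right Dini derivatives, additive increments and the theorem of Peano\<close>

text \<open>Differential inequalities are used below for functions that are not known to be differentiable. The
  comparison function \<open>\<Psi>\<close> may depend on \<open>t\<close>: at each time it is the right-hand side of an integral inequality,
  whose one-sided derivative at \<open>t\<close> is easy to compute.\<close>

lemma right_dini_nonincreasing:
  fixes f :: "real \<Rightarrow> real"
  assumes ab: "a \<le> b" and cont: "continuous_on {a..b} f"
    and dini: "\<And>t. \<lbrakk>a \<le> t; t < b\<rbrakk> \<Longrightarrow> \<exists>\<Psi>. (\<Psi> has_real_derivative 0) (at_right t) \<and>
                  (\<forall>\<^sub>F s in at_right t. f s - f t \<le> \<Psi> s - \<Psi> t)"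
  shows "f b \<le> f a"
proof -
  have key: "f b - f a \<le> \<epsilon> * (b - a)" if \<epsilon>: "\<epsilon> > 0" for \<epsilon>
  proof (rule ccontr)
    define g where "g t = f t - f a - \<epsilon> * (t - a)" for t
    assume "\<not> f b - f a \<le> \<epsilon> * (b - a)"
    then have gb: "g b > 0" by (simp add: g_def)
    have contg: "continuous_on {a..b} g"
      unfolding g_def by (intro continuous_intros cont)
    define S where "S = {a..b} \<inter> g -` {..0}"
    have "closed S" unfolding S_def
      by (rule continuous_closed_preimage[OF contg]) auto
    moreover have "a \<in> S" using ab by (simp add: S_def g_def)
    moreover have bdd: "bdd_above S" unfolding S_def by (rule bdd_aboveI[of _ b]) auto
    ultimately have cS: "Sup S \<in> S" using closed_contains_Sup by blast
    define c where "c = Sup S"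
    have c: "a \<le> c" "c \<le> b" "g c \<le> 0" using cS by (auto simp: c_def S_def)
    with gb have cb: "c < b" by (cases "c = b") auto
    obtain \<Psi> where \<Psi>: "(\<Psi> has_real_derivative 0) (at_right c)"
      and ev: "\<forall>\<^sub>F s in at_right c. f s - f c \<le> \<Psi> s - \<Psi> c"
      using dini[OF c(1) cb] by blast
    have "((\<lambda>s. (\<Psi> s - \<Psi> c) / (s - c)) \<longlongrightarrow> 0) (at_right c)"
      using \<Psi> by (simp add: has_field_derivative_iff)
    then have "\<forall>\<^sub>F s in at_right c. (\<Psi> s - \<Psi> c) / (s - c) < \<epsilon>"
      using \<epsilon> by (rule order_tendstoD)
    moreover have "\<forall>\<^sub>F s in at_right c. s \<in> {c<..<b}"
      using cb by (rule eventually_at_right_real)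
    ultimately have "\<forall>\<^sub>F s in at_right c. s \<in> {c<..<b} \<and> g s \<le> 0"
      using ev
    proof eventually_elim
      case (elim s)
      then have "\<Psi> s - \<Psi> c < \<epsilon> * (s - c)" by (simp add: divide_simps mult.commute split: if_splits)
      with elim c(3) show ?case by (auto simp: g_def algebra_simps)
    qed
    then obtain s where "s \<in> {c<..<b}" "g s \<le> 0"
      using eventually_happens trivial_limit_at_right_real by blast
    then have "s \<in> S" using c by (auto simp: S_def)
    then have "s \<le> c" unfolding c_def using bdd by (rule cSup_upper)
    with \<open>s \<in> {c<..<b}\<close> show False by auto
  qed
  then have "f b - f a \<le> 0 + e" if "e > 0" for e
    using ab that
  proof (cases "a = b")
    case False
    then have "f b - f a \<le> e / (b - a) * (b - a)"
      using ab that by (intro key) simp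
    with False ab show ?thesis by simp
  qed auto
  then show ?thesis using field_le_epsilon[of "f b - f a" 0] by auto
qed

text \<open>An increment that is negligible on short intervals against the increment of a fixed \<open>V\<close> vanishes, since the
  bounds add up over a fine partition. It replaces the derivative test when only an integral is available.\<close>

lemma increment_le_if_locally_le:
  fixes f V :: "real \<Rightarrow> real"
  assumes "a \<le> b"
    and loc: "\<And>e. e > 0 \<Longrightarrow> \<exists>d>0. \<forall>x y. a \<le> x \<and> x \<le> y \<and> y \<le> b \<and> y - x < d \<longrightarrow> \<bar>f y - f x\<bar> \<le> e * (V y - V x)"
  shows "f b = f a"
proof -
  have *: "\<bar>f b - f a\<bar> \<le> e * (V b - V a)" if e: "e > 0" for e
  proof -
    obtain d where d: "d > 0" and H: "\<And>x y. a \<le> x \<Longrightarrow> x \<le> y \<Longrightarrow> y \<le> b \<Longrightarrow> y - x < d \<Longrightarrow> \<bar>f y - f x\<bar> \<le> e * (V y - V x)"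
      using loc[OF e] by blast
    have "a \<le> a \<and> b \<le> b \<longrightarrow> \<bar>f b - f a\<bar> \<le> e * (V b - V a)"
      using \<open>a \<le> b\<close>
    proof (induct rule: Bolzano[where P = "\<lambda>x y. a \<le> x \<and> y \<le> b \<longrightarrow> \<bar>f y - f x\<bar> \<le> e * (V y - V x)"])
      case (trans x y z)
      then show ?case by (auto simp: algebra_simps)
    next
      case (local x)
      then show ?case using d H by (intro exI[of _ d]) auto
    qed
    then show ?thesis by simp
  qed
  have "V b - V a \<ge> 0" using *[of 1] by simp
  have "\<bar>f b - f a\<bar> \<le> 0 + e" if "e > 0" for e
  proof (cases "V b - V a = 0")
    case True then show ?thesis using *[of 1] that by simp
  next
    case False
    then show ?thesis using *[of "e / (V b - V a)"] that \<open>V b - V a \<ge> 0\<close> by simp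
  qed
  then have "\<bar>f b - f a\<bar> \<le> 0" by (rule field_le_epsilon)
  then show ?thesis by simp
qed

text \<open>Tonelli's scheme: in the equation with delay \<open>h\<close> the right-hand side only needs values of the solution that are
  already known, so Picard iteration is stationary after finitely many steps. The delayed solutions are Lipschitz with
  a common constant, and the theorem of Arzela and Ascoli yields a limit as \<open>h\<close> tends to \<open>0\<close>.\<close>

lemma peano_forward:
  fixes f :: "real \<Rightarrow> real \<Rightarrow> real"
  assumes ab: "a \<le> b" and cont: "continuous_on UNIV (\<lambda>(t, x). f t x)"
    and bd: "\<And>t x. \<bar>f t x\<bar> \<le> K"
  shows "\<exists>\<zeta>. \<zeta> a = x0 \<and> (\<forall>t\<in>{a..b}. (\<zeta> has_real_derivative f t (\<zeta> t)) (at t within {a..b}))"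
proof -
  have K0: "0 \<le> K" using bd[of 0 0] by simp
  have fc: "continuous_on S (\<lambda>s. f s (z s))" if "continuous_on S z" for S z
    using continuous_on_compose2[OF cont, of S "\<lambda>s. (s, z s)"] that
    by (simp add: continuous_on_Pair continuous_on_id)
  define step where "step h z t = x0 + integral {a..t} (\<lambda>s. f s (z (max a (s - h))))" for h :: real and z t
  define z where "z h k = (step h ^^ k) (\<lambda>_. x0)" for h k
  have z0: "z h 0 = (\<lambda>_. x0)" and zS: "z h (Suc k) = step h (z h k)" for h k
    by (simp_all add: z_def)
  have intg: "(\<lambda>s. f s (y (max a (s - h)))) integrable_on {c..d}"
    if "continuous_on {a..} y" for h y c d
    by (rule integrable_continuous_real, rule fc,
        rule continuous_on_compose2[OF that], auto intro!: continuous_intros)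
  have lip_step: "\<bar>step h y t' - step h y t\<bar> \<le> K * \<bar>t' - t\<bar>"
    if y: "continuous_on {a..} y" and tt: "a \<le> t" "a \<le> t'" for h y t t'
  proof -
    have main: "\<bar>step h y t' - step h y t\<bar> \<le> K * \<bar>t' - t\<bar>" if tt: "a \<le> t" "t \<le> t'" for t t'
    proof -
      have "step h y t' - step h y t = integral {t..t'} (\<lambda>s. f s (y (max a (s - h))))"
        using Henstock_Kurzweil_Integration.integral_combine[OF tt intg[OF y], of h] unfolding step_def by linarith
      also have "norm \<dots> \<le> K * (t' - t)"
      proof (rule integral_bound[OF tt(2)])
        show "continuous_on {t..t'} (\<lambda>s. f s (y (max a (s - h))))"
          by (rule fc, rule continuous_on_compose2[OF y]) (auto intro!: continuous_intros)
      qed (use bd in simp)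
      finally show ?thesis using tt by simp
    qed
    show ?thesis using main[of t t'] main[of t' t] tt by (cases "t \<le> t'") (auto simp: abs_minus_commute)
  qed
  have contstep: "continuous_on {a..} (step h y)" if "continuous_on {a..} y" for h y
  proof (rule continuous_on_subset[OF lipschitz_on_continuous_on[of K]])
    show "K-lipschitz_on {a..} (step h y)"
      using lip_step[OF that] K0 by (auto simp: lipschitz_on_def dist_real_def)
  qed auto
  have contz: "continuous_on {a..} (z h k)" for h k
    by (induction k) (auto simp: z0 zS contstep)
  have lipz: "\<bar>z h k t' - z h k t\<bar> \<le> K * \<bar>t' - t\<bar>" if "a \<le> t" "a \<le> t'" for h k t t'
    using that by (cases k) (auto simp: z0 zS K0 intro!: lip_step contz)
  \<comment> \<open>With delay \<open>h\<close>, the \<open>k\<close>-th iterate is final up to time \<open>a + k h\<close>.\<close>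
  have stable: "z h (Suc k) t = z h k t" if "h > 0" "a \<le> t" "t \<le> a + real k * h" for h k t
    using that
  proof (induction k arbitrary: t)
    case 0
    then have "t = a" by simp
    then show ?case by (simp add: z0 zS step_def)
  next
    case (Suc k)
    have "z h (Suc k) (max a (s - h)) = z h k (max a (s - h))" if "s \<in> {a..t}" for s
      using that Suc.prems by (intro Suc.IH) (auto simp: algebra_simps max_def)
    then have "integral {a..t} (\<lambda>s. f s (z h (Suc k) (max a (s - h)))) = integral {a..t} (\<lambda>s. f s (z h k (max a (s - h))))"
      by (intro Henstock_Kurzweil_Integration.integral_cong) auto
    then show ?case by (simp only: zS step_def)
  qed
  define hh where "hh n = 1 / real (Suc n)" for n
  \<comment> \<open>So many steps of length \<open>hh n\<close> cover \<open>{a..b}\<close>.\<close>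
  define N where "N n = nat \<lceil>(b - a) * real (Suc n)\<rceil>" for n
  define \<xi> where "\<xi> n = z (hh n) (N n)" for n
  have hh: "hh n > 0" for n by (simp add: hh_def)
  have eq: "\<xi> n t = x0 + integral {a..t} (\<lambda>s. f s (\<xi> n (max a (s - hh n))))" if "a \<le> t" "t \<le> b" for n t
  proof -
    have "(b - a) * real (Suc n) \<le> real (N n)" unfolding N_def by linarith
    then have "b - a \<le> real (N n) * hh n" unfolding hh_def by (simp add: field_simps)
    then have "\<xi> n t = step (hh n) (\<xi> n) t"
      using stable[OF hh[of n] that(1), of "N n"] that by (simp add: \<xi>_def zS)
    then show ?thesis by (simp add: step_def)
  qed
  have lip\<xi>: "\<bar>\<xi> n t' - \<xi> n t\<bar> \<le> K * \<bar>t' - t\<bar>" if "a \<le> t" "a \<le> t'" for n t t'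
    unfolding \<xi>_def by (rule lipz[OF that])
  have cont\<xi>: "continuous_on {a..} (\<xi> n)" for n unfolding \<xi>_def by (rule contz)
  obtain g and k :: "nat \<Rightarrow> nat" where gc: "continuous_on {a..b} g" and k: "strict_mono k"
    and conv: "\<And>e. 0 < e \<Longrightarrow> \<exists>N. \<forall>n x. n \<ge> N \<and> x \<in> {a..b} \<longrightarrow> norm (\<xi> (k n) x - g x) < e"
  proof (rule Arzela_Ascoli[of "{a..b}" \<xi> "\<bar>x0\<bar> + K * (b - a)"])
    show "norm (\<xi> n x) \<le> \<bar>x0\<bar> + K * (b - a)" if "x \<in> {a..b}" for n x
    proof -
      have "\<xi> n a = x0" using eq[of a n] ab by simp
      then have "\<bar>\<xi> n x - x0\<bar> \<le> K * \<bar>x - a\<bar>" using lip\<xi>[of a x n] that by simp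
      also have "\<dots> \<le> K * (b - a)" using that K0 by (intro mult_left_mono) auto
      finally show ?thesis by auto
    qed
    show "\<exists>d>0. \<forall>n y. y \<in> {a..b} \<and> norm (x - y) < d \<longrightarrow> norm (\<xi> n x - \<xi> n y) < e"
      if "x \<in> {a..b}" "0 < e" for x e
    proof (intro exI[of _ "e / (K + 1)"] conjI allI impI)
      show "0 < e / (K + 1)" using that K0 by simp
      fix n y assume y: "y \<in> {a..b} \<and> norm (x - y) < e / (K + 1)"
      have "norm (\<xi> n x - \<xi> n y) \<le> K * \<bar>x - y\<bar>" using lip\<xi>[of y x n] y that by simp
      also have "\<dots> \<le> (K + 1) * \<bar>x - y\<bar>" by (simp add: mult_right_mono)
      also have "\<dots> < e" using y K0 by (simp add: field_simps)
      finally show "norm (\<xi> n x - \<xi> n y) < e" .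
    qed
  qed auto
  have ptw: "(\<lambda>n. \<xi> (k n) t) \<longlonglongrightarrow> g t" if "t \<in> {a..b}" for t
    unfolding LIMSEQ_iff using conv that by meson
  have hk: "(\<lambda>n. hh (k n)) \<longlonglongrightarrow> 0"
    using LIMSEQ_subseq_LIMSEQ[OF LIMSEQ_Suc[OF lim_1_over_n] k] by (simp add: hh_def o_def)
  have geq: "g t = x0 + integral {a..t} (\<lambda>s. f s (g s))" if t: "t \<in> {a..b}" for t
  proof -
    have "(\<lambda>n. integral {a..t} (\<lambda>s. f s (\<xi> (k n) (max a (s - hh (k n)))))) \<longlonglongrightarrow> integral {a..t} (\<lambda>s. f s (g s))"
    proof (rule dominated_convergence(2)[where h = "\<lambda>_. K"])
      show "(\<lambda>s. f s (\<xi> (k n) (max a (s - hh (k n))))) integrable_on {a..t}" for n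
        by (rule intg[OF cont\<xi>])
      show "(\<lambda>_. K) integrable_on {a..t}" by (rule integrable_const_ivl)
      show "norm (f s (\<xi> (k n) (max a (s - hh (k n))))) \<le> K" for n s using bd by simp
      fix s assume s: "s \<in> {a..t}"
      have "(\<lambda>n. \<xi> (k n) (max a (s - hh (k n))) - \<xi> (k n) s) \<longlonglongrightarrow> 0"
      proof (rule tendsto_rabs_zero_cancel, rule tendsto_sandwich[OF _ _ tendsto_const])
        show "(\<lambda>n. K * hh (k n)) \<longlonglongrightarrow> 0" using tendsto_mult_right_zero[OF hk] by simp
        have "\<bar>\<xi> (k n) (max a (s - hh (k n))) - \<xi> (k n) s\<bar> \<le> K * hh (k n)" for n
        proof -
          have "\<bar>\<xi> (k n) (max a (s - hh (k n))) - \<xi> (k n) s\<bar> \<le> K * \<bar>max a (s - hh (k n)) - s\<bar>"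
            using s by (intro lip\<xi>) auto
          also have "\<dots> \<le> K * hh (k n)" using s hh[of "k n"] K0 by (intro mult_left_mono) auto
          finally show ?thesis .
        qed
        then show "\<forall>\<^sub>F n in sequentially. \<bar>\<xi> (k n) (max a (s - hh (k n))) - \<xi> (k n) s\<bar> \<le> K * hh (k n)"
          by simp
      qed auto
      from tendsto_add[OF this ptw[of s]] s t
      have "(\<lambda>n. \<xi> (k n) (max a (s - hh (k n)))) \<longlonglongrightarrow> g s" by auto
      then have "(\<lambda>n. (s, \<xi> (k n) (max a (s - hh (k n))))) \<longlonglongrightarrow> (s, g s)"
        by (intro tendsto_intros)
      moreover have "isCont (\<lambda>(t, x). f t x) (s, g s)"
        using cont by (simp add: continuous_on_eq_continuous_at)
      ultimately show "(\<lambda>n. f s (\<xi> (k n) (max a (s - hh (k n))))) \<longlonglongrightarrow> f s (g s)"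
        using isCont_tendsto_compose by fastforce
    qed
    then have "(\<lambda>n. x0 + integral {a..t} (\<lambda>s. f s (\<xi> (k n) (max a (s - hh (k n)))))) \<longlonglongrightarrow> x0 + integral {a..t} (\<lambda>s. f s (g s))"
      by (intro tendsto_intros)
    moreover have "(\<lambda>n. x0 + integral {a..t} (\<lambda>s. f s (\<xi> (k n) (max a (s - hh (k n)))))) = (\<lambda>n. \<xi> (k n) t)"
      using eq t by fastforce
    ultimately show ?thesis using ptw[OF t] LIMSEQ_unique by metis
  qed
  have der: "(g has_real_derivative f t (g t)) (at t within {a..b})" if t: "t \<in> {a..b}" for t
  proof -
    have "((\<lambda>t. x0 + integral {a..t} (\<lambda>s. f s (g s))) has_real_derivative 0 + f t (g t)) (at t within {a..b})"
      by (intro derivative_intros integral_has_real_derivative fc gc t)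
    then show ?thesis
      by (subst has_field_derivative_cong_eventually[where g = "\<lambda>t. x0 + integral {a..t} (\<lambda>s. f s (g s))"])
        (use t in \<open>auto simp: eventually_at_filter geq intro!: always_eventually\<close>)
  qed
  have "g a = x0" using geq[of a] ab by simp
  with der show ?thesis by blast
qed

lemma peano_backward:
  fixes f :: "real \<Rightarrow> real \<Rightarrow> real"
  assumes ab: "a \<le> b" and cont: "continuous_on UNIV (\<lambda>(t, x). f t x)"
    and bd: "\<And>t x. \<bar>f t x\<bar> \<le> K"
  shows "\<exists>\<zeta>. \<zeta> b = x0 \<and> (\<forall>t\<in>{a..b}. (\<zeta> has_real_derivative f t (\<zeta> t)) (at t within {a..b}))"
proof -
  have "continuous_on UNIV (\<lambda>p. (\<lambda>(t, x). f t x) (- fst p, snd p) :: real)"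
    by (rule continuous_on_compose2[OF cont]) (auto intro!: continuous_intros)
  then have c: "continuous_on UNIV (\<lambda>(t, x). - f (- t) x)"
    by (auto simp: case_prod_beta intro!: continuous_intros)
  obtain \<xi> where \<xi>: "\<xi> (- b) = x0"
    "\<And>t. t \<in> {- b..- a} \<Longrightarrow> (\<xi> has_real_derivative - f (- t) (\<xi> t)) (at t within {- b..- a})"
    using peano_forward[OF _ c, of "- b" "- a" K x0] ab bd by auto
  have "((\<lambda>t. \<xi> (- t)) has_real_derivative f t (\<xi> (- t))) (at t within {a..b})" if "t \<in> {a..b}" for t
  proof -
    have "((\<xi> \<circ> uminus) has_real_derivative - f (- (- t)) (\<xi> (- t)) * (- 1)) (at t within {a..b})"
    proof (rule DERIV_image_chain)
      show "(\<xi> has_real_derivative - f (- (- t)) (\<xi> (- t))) (at (- t) within uminus ` {a..b})"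
        using \<xi>(2)[of "- t"] that by simp
      show "(uminus has_real_derivative - 1) (at t within {a..b})"
        by (auto intro!: derivative_eq_intros)
    qed
    then show ?thesis by (simp add: o_def)
  qed
  with \<xi>(1) show ?thesis by (intro exI[of _ "\<lambda>t. \<xi> (- t)"]) auto
qed

section \<open>Test functions and cutoffs\<close>

lemma continuous_bounded_on_Icc:
  fixes f :: "real \<Rightarrow> real"
  assumes "continuous_on {a..b} f"
  shows "\<exists>K\<ge>0. \<forall>s\<in>{a..b}. \<bar>f s\<bar> \<le> K"
proof -
  have "bounded (f ` {a..b})"
    by (intro compact_imp_bounded compact_continuous_image assms compact_Icc)
  then obtain K where "\<forall>x\<in>f ` {a..b}. norm x \<le> K" by (auto simp: bounded_iff)
  then show ?thesis by (intro exI[of _ "max K 0"]) (auto simp: le_max_iff_disj)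
qed

lemma C_diff_mono: "C_diff (Suc k) f \<Longrightarrow> C_diff k f"
proof (induction k arbitrary: f)
  case 0
  then show ?case
    by (auto intro: differentiable_imp_continuous_on simp: differentiable_on_def differentiable_at_withinI)
qed auto

lemma C_diff_const: "C_diff k (\<lambda>_. c)"
  by (induction k arbitrary: c) auto

lemma frechet_derivative_add_real:
  fixes f g :: "'a::euclidean_space \<Rightarrow> real"
  assumes "f differentiable (at x)" "g differentiable (at x)"
  shows "frechet_derivative (\<lambda>x. f x + g x) (at x) v =
         frechet_derivative f (at x) v + frechet_derivative g (at x) v"
proof -
  have "((\<lambda>x. f x + g x) has_derivative
        (\<lambda>v. frechet_derivative f (at x) v + frechet_derivative g (at x) v)) (at x)"
    using assms by (intro has_derivative_add) (simp_all add: frechet_derivative_works)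
  from frechet_derivative_at[OF this] show ?thesis by metis
qed

lemma C_diff_add: "C_diff k f \<Longrightarrow> C_diff k g \<Longrightarrow> C_diff k (\<lambda>x. f x + g x)"
proof (induction k arbitrary: f g)
  case (Suc k)
  then show ?case by (auto simp: frechet_derivative_add_real)
qed (auto intro: continuous_intros)

lemma frechet_derivative_mult_real:
  fixes f g :: "'a::euclidean_space \<Rightarrow> real"
  assumes "f differentiable (at x)" "g differentiable (at x)"
  shows "frechet_derivative (\<lambda>x. f x * g x) (at x) v =
         f x * frechet_derivative g (at x) v + frechet_derivative f (at x) v * g x"
proof -
  have "((\<lambda>x. f x * g x) has_derivative
        (\<lambda>v. f x * frechet_derivative g (at x) v + frechet_derivative f (at x) v * g x)) (at x)"
    using assms by (intro has_derivative_mult) (simp_all add: frechet_derivative_works)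
  from frechet_derivative_at[OF this] show ?thesis by metis
qed

lemma C_diff_mult: "C_diff k f \<Longrightarrow> C_diff k g \<Longrightarrow> C_diff k (\<lambda>x. f x * g x)"
proof (induction k arbitrary: f g)
  case (Suc k)
  have "C_diff k f" "C_diff k g" using Suc.prems by (auto intro: C_diff_mono simp del: C_diff.simps)
  with Suc show ?case by (auto simp: frechet_derivative_mult_real intro!: C_diff_add)
qed (auto intro: continuous_intros)

lemma C_diff_compose_affine:
  fixes f :: "real \<Rightarrow> real" and L :: "'a::euclidean_space \<Rightarrow> real"
  assumes "bounded_linear L"
  shows "C_diff k f \<Longrightarrow> C_diff k (\<lambda>x. f (L x + c))"
proof (induction k arbitrary: f)
  case 0
  have "continuous_on UNIV (\<lambda>x. L x + c)"
    by (intro continuous_on_add continuous_on_const linear_continuous_on assms)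
  then show ?case using 0 continuous_on_compose2[of UNIV f UNIV "\<lambda>x. L x + c"] by simp
next
  case (Suc k)
  have der: "((\<lambda>x. f (L x + c)) has_derivative (\<lambda>v. frechet_derivative f (at (L x + c)) (L v))) (at x)" for x
  proof (rule has_derivative_compose[of "\<lambda>x. L x + c" L x UNIV f])
    show "((\<lambda>x. L x + c) has_derivative L) (at x)"
      using has_derivative_add[OF bounded_linear_imp_has_derivative[OF assms] has_derivative_const] by simp
    show "(f has_derivative frechet_derivative f (at (L x + c))) (at (L x + c))"
      using Suc.prems by (simp add: frechet_derivative_works[symmetric])
  qed
  have "frechet_derivative (\<lambda>x. f (L x + c)) (at x) v = frechet_derivative f (at (L x + c)) (L v)" for x v
    using frechet_derivative_at[OF der[of x]] by metis
  moreover have "C_diff k (\<lambda>x. frechet_derivative f (at (L x + c)) (L v))" for v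
    using Suc.prems by (intro Suc.IH[where f = "\<lambda>s. frechet_derivative f (at s) (L v)"]) auto
  moreover have "(\<lambda>x. f (L x + c)) differentiable (at x)" for x
    unfolding differentiable_def using der by blast
  ultimately show ?case by simp
qed

lemma C_diff_Suc_real:
  fixes f :: "real \<Rightarrow> real"
  assumes "\<And>x. (f has_real_derivative f' x) (at x)" "C_diff k f'"
  shows "C_diff (Suc k) f"
proof -
  have "frechet_derivative f (at x) = (\<lambda>v. f' x * v)" for x
    using frechet_derivative_at[of f "(*) (f' x)" x] assms(1)[of x]
    by (simp add: has_field_derivative_def)
  moreover have "f differentiable at x" for x
    using assms(1) by (auto simp: differentiable_def has_field_derivative_def)
  ultimately show ?thesis using assms(2) by (auto intro!: C_diff_mult C_diff_const)
qed

lemma C_diff_deriv_real: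
  fixes f :: "real \<Rightarrow> real"
  assumes "C_diff (Suc k) f"
  shows "(f has_real_derivative deriv f x) (at x)" "C_diff k (deriv f)"
proof -
  have d: "(f has_real_derivative deriv f x) (at x)" for x
    using assms by (simp add: DERIV_deriv_iff_real_differentiable)
  have "frechet_derivative f (at x) = (\<lambda>v. deriv f x * v)" for x
    using frechet_derivative_at[of f "(*) (deriv f x)" x] d[of x]
    by (simp add: has_field_derivative_def)
  then have "deriv f = (\<lambda>x. frechet_derivative f (at x) 1)" by auto
  then show "C_diff k (deriv f)" using assms by simp
  show "(f has_real_derivative deriv f x) (at x)" by (rule d)
qed

lemma test_fun_deriv_real:
  fixes \<phi> :: "real \<Rightarrow> real"
  assumes "test_fun U \<phi>"
  shows "(\<phi> has_real_derivative deriv \<phi> x) (at x)" "continuous_on UNIV (deriv \<phi>)" "continuous_on UNIV \<phi>"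
proof -
  have C: "C_diff k \<phi>" for k using assms by (simp add: test_fun_def)
  show "(\<phi> has_real_derivative deriv \<phi> x) (at x)" using C_diff_deriv_real(1)[OF C] .
  show "continuous_on UNIV (deriv \<phi>)" using C_diff_deriv_real(2)[OF C[of "Suc 0"]] by simp
  show "continuous_on UNIV \<phi>" using C[of 0] by simp
qed

text \<open>The weak form of the equation is tested with products of a function of time and a function of space.\<close>

lemma test_fun_product:
  fixes \<theta> \<psi> :: "real \<Rightarrow> real"
  assumes "test_fun U \<theta>" "test_fun V \<psi>"
  shows "test_fun (U \<times> V) (\<lambda>p. \<theta> (fst p) * \<psi> (snd p))"
proof -
  obtain K L where K: "compact K" "K \<subseteq> U" "\<And>x. x \<notin> K \<Longrightarrow> \<theta> x = 0"
    and L: "compact L" "L \<subseteq> V" "\<And>x. x \<notin> L \<Longrightarrow> \<psi> x = 0"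
    using assms by (auto simp: test_fun_def)
  have "C_diff k (\<lambda>p. \<theta> (fst p) * \<psi> (snd p))" for k
  proof -
    have "C_diff k (\<lambda>p. \<theta> (fst p + 0) * \<psi> (snd p + 0))"
      using assms by (intro C_diff_mult C_diff_compose_affine bounded_linear_fst bounded_linear_snd)
        (auto simp: test_fun_def)
    then show ?thesis by simp
  qed
  moreover have "compact (K \<times> L)" "K \<times> L \<subseteq> U \<times> V" using K L by (auto intro: compact_Times)
  moreover have "\<forall>p. p \<notin> K \<times> L \<longrightarrow> \<theta> (fst p) * \<psi> (snd p) = 0" using K(3) L(3) by (auto simp: mem_Times_iff)
  ultimately show ?thesis unfolding test_fun_def by blast
qed

lemma poly_exp_at_right_0:
  "((\<lambda>x::real. poly p (1 / x) * exp (- 1 / x)) \<longlongrightarrow> 0) (at_right 0)"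
proof -
  have 1: "((\<lambda>y::real. poly p y * exp (- y)) \<longlongrightarrow> 0) at_top"
  proof -
    have "((\<lambda>y::real. \<Sum>i\<le>degree p. coeff p i * (y ^ i / exp y)) \<longlongrightarrow> (\<Sum>i\<le>degree p. coeff p i * 0)) at_top"
      by (intro tendsto_intros tendsto_power_div_exp_0)
    then show ?thesis
      by (simp add: poly_altdef sum_distrib_right exp_minus divide_inverse mult.assoc)
  qed
  have "((\<lambda>x::real. poly p (inverse x) * exp (- inverse x)) \<longlongrightarrow> 0) (at_right 0)"
    by (rule filterlim_compose[OF 1 filterlim_inverse_at_top_right])
  then show ?thesis by (simp add: inverse_eq_divide)
qed

text \<open>The family of functions \<open>p(1/x) e\<^sup>-\<^sup>1\<^sup>/\<^sup>x\<close>, extended by \<open>0\<close>, contains the usual flat function (\<open>p = 1\<close>) and is closed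
  under differentiation; hence all its members are smooth.\<close>

definition flat_exp :: "real poly \<Rightarrow> real \<Rightarrow> real" where
  "flat_exp p x = (if x > 0 then poly p (1 / x) * exp (- 1 / x) else 0)"

lemma flat_exp_deriv:
  "(flat_exp p has_real_derivative flat_exp (monom 1 2 * (p - pderiv p)) x) (at x)"
proof (cases x "0::real" rule: linorder_cases)
  case less
  have "((\<lambda>_. 0) has_real_derivative 0) (at x)" by simp
  moreover have "\<forall>\<^sub>F y in nhds x. flat_exp p y = 0"
    using eventually_nhds_in_open[of "{..<0}" x] less
    by (auto simp: flat_exp_def elim!: eventually_mono)
  ultimately show ?thesis using less
    by (subst DERIV_cong_ev[OF refl, of _ "\<lambda>_. 0"]) (auto simp: flat_exp_def)
next
  case greater
  have "((\<lambda>x. poly p (1 / x) * exp (- 1 / x)) has_real_derivative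
        poly (monom 1 2 * (p - pderiv p)) (1 / x) * exp (- 1 / x)) (at x)"
    using greater
    by (auto intro!: derivative_eq_intros DERIV_chain2[OF poly_DERIV] simp: poly_monom field_simps power2_eq_square)
  moreover have "\<forall>\<^sub>F y in nhds x. flat_exp p y = poly p (1 / y) * exp (- 1 / y)"
    using eventually_nhds_in_open[of "{0<..}" x] greater
    by (auto simp: flat_exp_def elim!: eventually_mono)
  ultimately show ?thesis using greater
    by (subst DERIV_cong_ev[OF refl, of _ "\<lambda>x. poly p (1 / x) * exp (- 1 / x)"]) (auto simp: flat_exp_def)
next
  case equal
  have "((\<lambda>y. (flat_exp p y - flat_exp p 0) / (y - 0)) \<longlongrightarrow> 0) (at_right 0)"
  proof (rule Lim_transform_eventually[OF poly_exp_at_right_0[of "monom 1 1 * p"]])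
    show "\<forall>\<^sub>F y in at_right 0. poly (monom 1 1 * p) (1 / y) * exp (- 1 / y) = (flat_exp p y - flat_exp p 0) / (y - 0)"
      using eventually_at_right_less[of "0::real"]
      by eventually_elim (auto simp: flat_exp_def poly_monom)
  qed
  moreover have "((\<lambda>y. (flat_exp p y - flat_exp p 0) / (y - 0)) \<longlongrightarrow> 0) (at_left 0)"
  proof (rule Lim_transform_eventually[OF tendsto_const])
    show "\<forall>\<^sub>F y in at_left 0. 0 = (flat_exp p y - flat_exp p 0) / (y - 0)"
      using eventually_at_left_real[of "-1" "0::real"]
      by (auto simp: flat_exp_def elim!: eventually_mono)
  qed
  ultimately have "((\<lambda>y. (flat_exp p y - flat_exp p 0) / (y - 0)) \<longlongrightarrow> 0) (at 0)"
    by (simp add: filterlim_at_split)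
  then show ?thesis using equal by (simp add: has_field_derivative_iff flat_exp_def)
qed

lemma C_diff_flat_exp: "C_diff k (flat_exp p)"
proof (induction k arbitrary: p)
  case 0
  have "isCont (flat_exp p) x" for x using flat_exp_deriv by (rule DERIV_isCont)
  then show ?case by (simp add: continuous_on_eq_continuous_at)
next
  case (Suc k)
  show ?case by (rule C_diff_Suc_real[OF flat_exp_deriv Suc])
qed

lemma exists_unit_bump:
  "\<exists>\<rho>::real \<Rightarrow> real. (\<forall>k. C_diff k \<rho>) \<and> (\<forall>s. \<rho> s \<ge> 0) \<and> (\<forall>s. s \<notin> {0<..<1} \<longrightarrow> \<rho> s = 0) \<and>
     (LINT s|lborel. \<rho> s) = 1"
proof -
  define b where "b s = flat_exp 1 s * flat_exp 1 (1 - s)" for s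
  have Cb: "C_diff k b" for k
  proof -
    have "C_diff k (\<lambda>s. flat_exp 1 s * flat_exp 1 (- s + 1))"
      by (intro C_diff_mult C_diff_flat_exp C_diff_compose_affine[where L = uminus] bounded_linear_minus bounded_linear_ident)
    then show ?thesis unfolding b_def by (simp add: algebra_simps)
  qed
  have b0: "b s \<ge> 0" for s by (simp add: b_def flat_exp_def)
  have bout: "b s = 0" if "s \<notin> {0<..<1}" for s using that by (auto simp: b_def flat_exp_def)
  have bout': "b s = 0" if "s \<notin> {0..1}" for s using that by (intro bout) auto
  have cb: "continuous_on S b" for S using Cb[of 0] by (auto intro: continuous_on_subset)
  have bi: "set_integrable lborel {0..1} b" by (rule borel_integrable_atLeastAtMost') (rule cb)
  have beq: "(\<lambda>s. indicator {0..1} s *\<^sub>R b s) = b" using bout' by (auto simp: indicator_def fun_eq_iff)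
  define Z where "Z = (LINT s|lborel. b s)"
  have "Z = integral {0..1} b"
    using set_borel_integral_eq_integral(2)[OF bi] unfolding set_lebesgue_integral_def beq Z_def .
  moreover have "integral {0..1} b \<noteq> 0"
  proof
    assume "integral {0..1} b = 0"
    then have "b (1/2) = 0"
      using integral_eq_0_iff[OF cb, of 0 1] b0 by auto
    then show False by (simp add: b_def flat_exp_def)
  qed
  moreover have "Z \<ge> 0" unfolding Z_def by (intro integral_nonneg_AE) (simp add: b0)
  ultimately have Z: "Z > 0" by simp
  have "C_diff k (\<lambda>s. 1 / Z * b s)" for k by (intro C_diff_mult C_diff_const Cb)
  moreover have "(LINT s|lborel. 1 / Z * b s) = 1" using Z by (simp add: Z_def[symmetric])
  ultimately show ?thesis using b0 bout Z by (intro exI[of _ "\<lambda>s. 1 / Z * b s"]) auto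
qed

lemma integrable_continuous_compact_support:
  fixes f :: "real \<Rightarrow> real"
  assumes "continuous_on {a..b} f" "\<And>s. s \<notin> {a..b} \<Longrightarrow> f s = 0"
  shows "integrable lborel f" "(LINT s|lborel. f s) = integral {a..b} f"
proof -
  have i: "set_integrable lborel {a..b} f" by (rule borel_integrable_atLeastAtMost') (rule assms)
  have eq: "(\<lambda>s. indicator {a..b} s *\<^sub>R f s) = f" using assms(2) by (auto simp: indicator_def fun_eq_iff)
  show "integrable lborel f" using i unfolding set_integrable_def eq .
  show "(LINT s|lborel. f s) = integral {a..b} f"
    using set_borel_integral_eq_integral(2)[OF i] unfolding set_lebesgue_integral_def eq .
qed

lemma exists_smooth_step:
  "\<exists>H \<rho>::real \<Rightarrow> real. (\<forall>k. C_diff k H) \<and> (\<forall>s. (H has_real_derivative \<rho> s) (at s)) \<and>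
     (\<forall>s. 0 \<le> H s \<and> H s \<le> 1) \<and> (\<forall>s\<le>0. H s = 0) \<and> (\<forall>s\<ge>1. H s = 1) \<and>
     continuous_on UNIV \<rho> \<and> (\<forall>s. \<rho> s \<ge> 0) \<and> (\<forall>s. s \<notin> {0<..<1} \<longrightarrow> \<rho> s = 0) \<and> (LINT s|lborel. \<rho> s) = 1"
proof -
  obtain \<rho> :: "real \<Rightarrow> real" where C: "\<And>k. C_diff k \<rho>" and nn: "\<And>s. \<rho> s \<ge> 0"
    and out: "\<And>s. s \<notin> {0<..<1} \<Longrightarrow> \<rho> s = 0" and one: "(LINT s|lborel. \<rho> s) = 1"
    using exists_unit_bump by blast
  have cont: "continuous_on S \<rho>" for S using C[of 0] by (auto intro: continuous_on_subset)
  have int: "\<rho> integrable_on {a..b}" for a b by (rule integrable_continuous_real[OF cont])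
  define H where "H s = integral {0..s} \<rho>" for s
  have Hc: "H s = integral {c..s} \<rho>" if "c \<le> 0" "c \<le> s" for c s
  proof (cases "0 \<le> s")
    case True
    have "integral {c..0} \<rho> = integral {c..0} (\<lambda>_. 0)"
      by (rule Henstock_Kurzweil_Integration.integral_cong) (auto intro: out)
    then have "integral {c..0} \<rho> = 0" by simp
    then show ?thesis using Henstock_Kurzweil_Integration.integral_combine[OF that(1) True int] by (simp add: H_def)
  next
    case False
    have "integral {c..s} \<rho> = integral {c..s} (\<lambda>_. 0)"
      using False by (intro Henstock_Kurzweil_Integration.integral_cong) (auto intro: out)
    then show ?thesis using False by (simp add: H_def)
  qed
  have der: "(H has_real_derivative \<rho> s) (at s)" for s
  proof -
    define c where "c = - \<bar>s\<bar> - 1"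
    define d where "d = \<bar>s\<bar> + 1"
    have cd: "c < s" "s < d" "c \<le> 0" by (auto simp: c_def d_def)
    have "((\<lambda>s. integral {c..s} \<rho>) has_real_derivative \<rho> s) (at s within {c..d})"
      using cd by (intro integral_has_real_derivative cont) auto
    then have "((\<lambda>s. integral {c..s} \<rho>) has_real_derivative \<rho> s) (at s)"
      using cd at_within_Icc_at[of c s d] by simp
    moreover have "\<forall>\<^sub>F y in nhds s. H y = integral {c..y} \<rho>"
      using eventually_nhds_in_open[of "{c<..}" s] cd by (auto elim!: eventually_mono intro!: Hc)
    ultimately show ?thesis by (subst DERIV_cong_ev[OF refl _ refl])
  qed
  have CH: "C_diff k H" for k
  proof (cases k)
    case 0
    have "isCont H x" for x using der by (rule DERIV_isCont)
    then show ?thesis using 0 by (simp add: continuous_on_eq_continuous_at)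
  next
    case (Suc j)
    then show ?thesis using C_diff_Suc_real[OF der C] by simp
  qed
  have H1: "H 1 = 1"
    using integrable_continuous_compact_support(2)[OF cont, of 0 1] out one by (force simp: H_def)
  have Hge: "H s = 1" if "s \<ge> 1" for s
  proof -
    have "integral {1..s} \<rho> = integral {1..s} (\<lambda>_. 0)"
      by (rule Henstock_Kurzweil_Integration.integral_cong) (auto intro: out)
    then show ?thesis using H1 Henstock_Kurzweil_Integration.integral_combine[of 0 1 s \<rho>] that int by (simp add: H_def)
  qed
  have mono: "H x \<le> H y" if "x \<le> y" for x y
    by (rule DERIV_nonneg_imp_nondecreasing[OF that]) (use der nn in blast)
  have Hle: "H s = 0" if "s \<le> 0" for s using that by (cases "s = 0") (auto simp: H_def)
  have "0 \<le> H s \<and> H s \<le> 1" for s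
    using Hle[of s] mono[of 0 s] Hle[of 0] Hge[of s] mono[of s 1] H1 by (cases "s \<le> 0"; cases "s \<ge> 1") auto
  then show ?thesis using CH der Hle Hge cont nn out one by blast
qed

text \<open>Differences of two steep smooth steps. They approximate the indicator of \<open>{x<..y}\<close> boundedly, and
  their derivatives approximate a point mass at \<open>x\<close> minus a point mass at \<open>y\<close>, uniformly bounded as measures. The steps rise to
  the right of \<open>x\<close> and \<open>y\<close>, so the support stays in \<open>{x..y + 1}\<close>.\<close>

lemma exists_cutoffs:
  fixes x y :: real
  assumes xy: "x \<le> y" and U: "{x..y + 1} \<subseteq> U"
  shows "\<exists>\<psi>::nat \<Rightarrow> real \<Rightarrow> real. (\<forall>n. test_fun U (\<psi> n)) \<and> (\<forall>n s. \<bar>\<psi> n s\<bar> \<le> 1) \<and>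
     (\<forall>n s. s \<notin> {x..y + 1} \<longrightarrow> \<psi> n s = 0) \<and>
     (\<forall>s. (\<lambda>n. \<psi> n s) \<longlonglongrightarrow> indicator {x<..y} s) \<and>
     (\<forall>A. continuous_on UNIV A \<longrightarrow> (\<lambda>n. LINT s|lborel. A s * deriv (\<psi> n) s) \<longlonglongrightarrow> A x - A y) \<and>
     (\<forall>A K n. continuous_on UNIV A \<longrightarrow> (\<forall>s\<in>{x..y + 1}. \<bar>A s\<bar> \<le> K) \<longrightarrow>
        \<bar>LINT s|lborel. A s * deriv (\<psi> n) s\<bar> \<le> 2 * K)"
proof -
  obtain H \<rho> :: "real \<Rightarrow> real" where C: "\<And>k. C_diff k H" and der: "\<And>s. (H has_real_derivative \<rho> s) (at s)"
    and H01: "\<And>s. 0 \<le> H s" "\<And>s. H s \<le> 1" and Hle: "\<And>s. s \<le> 0 \<Longrightarrow> H s = 0" and Hge: "\<And>s. s \<ge> 1 \<Longrightarrow> H s = 1"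
    and cont: "continuous_on UNIV \<rho>" and nn: "\<And>s. \<rho> s \<ge> 0"
    and out: "\<And>s. s \<notin> {0<..<1} \<Longrightarrow> \<rho> s = 0" and one: "(LINT s|lborel. \<rho> s) = 1"
    using exists_smooth_step by blast
  define N where "N n = real (Suc n)" for n
  have N: "N n > 0" "N n \<ge> 1" for n by (auto simp: N_def)
  define \<psi> where "\<psi> n s = H (N n * (s - x)) - H (N n * (s - y))" for n s
  have d\<psi>: "deriv (\<psi> n) s = N n * \<rho> (N n * (s - x)) - N n * \<rho> (N n * (s - y))" for n s
    unfolding \<psi>_def
    by (rule DERIV_imp_deriv) (auto intro!: derivative_eq_intros DERIV_chain2[OF der])
  have supp: "\<psi> n s = 0" if s: "s \<notin> {x..y + 1}" for n s
  proof -
    consider "s < x" | "s > y + 1" using s by force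
    then show ?thesis
    proof cases
      case 1
      then have "N n * (s - x) \<le> 0" "N n * (s - y) \<le> 0" using N[of n] xy by (auto simp: mult_le_0_iff)
      then show ?thesis by (simp add: \<psi>_def Hle)
    next
      case 2
      have "N n * (s - x) \<ge> 1 * 1" "N n * (s - y) \<ge> 1 * 1" using N[of n] xy 2 by (intro mult_mono; simp)+
      then show ?thesis by (simp add: \<psi>_def Hge)
    qed
  qed
  have Ck: "C_diff k (\<psi> n)" for k n
  proof -
    have "C_diff k (\<lambda>s. H (N n * s + (- N n * x)) + (- 1) * H (N n * s + (- N n * y)))"
      by (intro C_diff_add C_diff_mult C_diff_const C_diff_compose_affine C bounded_linear_mult_right)
    then show ?thesis by (simp add: \<psi>_def[abs_def] algebra_simps)
  qed
  have test: "test_fun U (\<psi> n)" for n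
    unfolding test_fun_def using Ck U supp by (intro conjI exI[of _ "{x..y+1}"]) auto
  have bound: "\<bar>\<psi> n s\<bar> \<le> 1" for n s
    using H01[of "N n * (s - x)"] H01[of "N n * (s - y)"] by (simp add: \<psi>_def)
  have Hlim: "(\<lambda>n. H (N n * (s - z))) \<longlonglongrightarrow> (if z < s then 1 else 0)" for s z
  proof (cases "z < s")
    case True
    obtain m :: nat where m: "1 / (s - z) \<le> real m" using real_arch_simple by blast
    have "H (N n * (s - z)) = 1" if "n \<ge> m" for n
    proof (rule Hge)
      have "1 / (s - z) \<le> N n" using m that by (simp add: N_def)
      then show "1 \<le> N n * (s - z)" using True by (simp add: field_simps)
    qed
    then have "\<forall>\<^sub>F n in sequentially. H (N n * (s - z)) = 1" by (auto simp: eventually_sequentially)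
    then show ?thesis using True by (simp add: tendsto_eventually)
  next
    case False
    then have "H (N n * (s - z)) = 0" for n using N[of n] by (intro Hle) (auto simp: mult_le_0_iff)
    then show ?thesis using False by simp
  qed
  have lim: "(\<lambda>n. \<psi> n s) \<longlonglongrightarrow> indicator {x<..y} s" for s
    using tendsto_diff[OF Hlim[of s x] Hlim[of s y]] xy unfolding \<psi>_def by (auto simp: indicator_def split: if_splits)
  have shift: "integrable lborel (\<lambda>r. A (z + r / N n) * \<rho> r)"
      "integrable lborel (\<lambda>s. A s * (N n * \<rho> (N n * (s - z))))"
      "(LINT s|lborel. A s * (N n * \<rho> (N n * (s - z)))) = (LINT r|lborel. A (z + r / N n) * \<rho> r)"
    if A: "continuous_on UNIV A" for A :: "real \<Rightarrow> real" and z n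
  proof -
    have c1: "continuous_on UNIV (\<lambda>r. A (z + r / N n) * \<rho> r)"
      by (intro continuous_intros cont continuous_on_compose2[OF A]) (use N[of n] in auto)
    have c2: "continuous_on UNIV (\<lambda>s. A s * (N n * \<rho> (N n * (s - z))))"
      by (intro continuous_intros A continuous_on_compose2[OF cont]) auto
    show "integrable lborel (\<lambda>r. A (z + r / N n) * \<rho> r)"
      by (rule integrable_continuous_compact_support[of 0 1])
         (auto intro: out continuous_on_subset[OF c1])
    show "integrable lborel (\<lambda>s. A s * (N n * \<rho> (N n * (s - z))))"
    proof (rule integrable_continuous_compact_support[of z "z + 1"])
      fix s assume s: "s \<notin> {z..z + 1}"
      then consider "s < z" | "s > z + 1" by force
      then have "N n * (s - z) \<notin> {0<..<1}"
      proof cases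
        case 1
        then show ?thesis using N[of n] by (auto simp: zero_less_mult_iff)
      next
        case 2
        have "N n * (s - z) \<ge> 1 * 1" using N[of n] 2 by (intro mult_mono) auto
        then show ?thesis by auto
      qed
      then show "A s * (N n * \<rho> (N n * (s - z))) = 0" by (simp add: out)
    qed (rule continuous_on_subset[OF c2], simp)
    show "(LINT s|lborel. A s * (N n * \<rho> (N n * (s - z)))) = (LINT r|lborel. A (z + r / N n) * \<rho> r)"
    proof -
      have "(LINT s|lborel. A s * (N n * \<rho> (N n * (s - z)))) = 1 / N n * (LINT r|lborel. A (z + r / N n) * (N n * \<rho> r))"
        using N[of n] by (subst lborel_integral_real_affine[where c = "1 / N n" and t = z]) auto
      also have "(LINT r|lborel. A (z + r / N n) * (N n * \<rho> r)) = (LINT r|lborel. N n * (A (z + r / N n) * \<rho> r))"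
        by (intro Bochner_Integration.integral_cong) auto
      finally show ?thesis using N[of n] by simp
    qed
  qed
  have split: "(LINT s|lborel. A s * deriv (\<psi> n) s) =
       (LINT r|lborel. A (x + r / N n) * \<rho> r) - (LINT r|lborel. A (y + r / N n) * \<rho> r)"
    if A: "continuous_on UNIV A" for A n
    using shift[OF A] by (simp add: d\<psi> right_diff_distrib Bochner_Integration.integral_diff)
  have int\<rho>: "integrable lborel \<rho>"
    by (rule integrable_continuous_compact_support[of 0 1]) (auto intro: out continuous_on_subset[OF cont])
  have bnd1: "\<bar>A (z + r / N n)\<bar> \<le> K"
    if "\<forall>s\<in>{z..z+1}. \<bar>A s\<bar> \<le> K" "r \<in> {0<..<1}" for A :: "real \<Rightarrow> real" and K z n r
  proof -
    have "r / N n \<le> 1" using that(2) N[of n] by (simp add: field_simps)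
    moreover have "r / N n \<ge> 0" using that(2) N[of n] by simp
    ultimately show ?thesis using that(1) by auto
  qed
  have bnd2: "\<bar>A (z + r / N n) * \<rho> r\<bar> \<le> K * \<rho> r"
    if "\<forall>s\<in>{z..z+1}. \<bar>A s\<bar> \<le> K" for A :: "real \<Rightarrow> real" and K z n r
    using bnd1[OF that, of r n] nn[of r] out[of r]
    by (cases "r \<in> {0<..<1}") (auto simp: abs_mult intro!: mult_right_mono)
  have bnd3: "\<bar>LINT r|lborel. A (z + r / N n) * \<rho> r\<bar> \<le> K"
    if A: "continuous_on UNIV A" and K: "\<forall>s\<in>{z..z+1}. \<bar>A s\<bar> \<le> K" for A :: "real \<Rightarrow> real" and K z n
  proof -
    have "norm (LINT r|lborel. A (z + r / N n) * \<rho> r) \<le> (LINT r|lborel. K * \<rho> r)"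
      by (rule Bochner_Integration.integral_norm_bound_integral[OF shift(1)[OF A]])
         (use int\<rho> bnd2[OF K] in auto)
    then show ?thesis by (simp add: one)
  qed
  have lim1: "(\<lambda>n. LINT r|lborel. A (z + r / N n) * \<rho> r) \<longlonglongrightarrow> A z"
    if A: "continuous_on UNIV A" for A :: "real \<Rightarrow> real" and z
  proof -
    obtain K where K: "\<forall>s\<in>{z..z+1}. \<bar>A s\<bar> \<le> K"
      using continuous_bounded_on_Icc[OF continuous_on_subset[OF A, of "{z..z+1}"]] by auto
    have "(\<lambda>n. LINT r|lborel. A (z + r / N n) * \<rho> r) \<longlonglongrightarrow> (LINT r|lborel. A z * \<rho> r)"
    proof (rule integral_dominated_convergence[where w = "\<lambda>r. K * \<rho> r"])
      show "(\<lambda>r. A z * \<rho> r) \<in> borel_measurable lborel" using int\<rho> by auto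
      show "(\<lambda>r. A (z + r / N n) * \<rho> r) \<in> borel_measurable lborel" for n using shift(1)[OF A] by auto
      show "integrable lborel (\<lambda>r. K * \<rho> r)" using int\<rho> by auto
      show "AE r in lborel. norm (A (z + r / N n) * \<rho> r) \<le> K * \<rho> r" for n using bnd2[OF K] by auto
      have "(\<lambda>n. A (z + r / N n) * \<rho> r) \<longlonglongrightarrow> A z * \<rho> r" for r
      proof -
        have "(\<lambda>n. r * (1 / real (Suc n))) \<longlonglongrightarrow> r * 0"
          by (intro tendsto_intros LIMSEQ_Suc[OF lim_1_over_n])
        then have "(\<lambda>n. z + r / N n) \<longlonglongrightarrow> z + 0" by (intro tendsto_intros) (simp add: N_def)
        moreover have "isCont A z" using A by (simp add: continuous_on_eq_continuous_at)
        ultimately show ?thesis by (intro tendsto_intros isCont_tendsto_compose[of z A]) auto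
      qed
      then show "AE r in lborel. (\<lambda>n. A (z + r / N n) * \<rho> r) \<longlonglongrightarrow> A z * \<rho> r" by auto
    qed
    then show ?thesis by (simp add: one)
  qed
  have fin: "(\<lambda>n. LINT s|lborel. A s * deriv (\<psi> n) s) \<longlonglongrightarrow> A x - A y" if "continuous_on UNIV A" for A
    unfolding split[OF that] by (intro tendsto_diff lim1 that)
  have fin2: "\<bar>LINT s|lborel. A s * deriv (\<psi> n) s\<bar> \<le> 2 * K"
    if "continuous_on UNIV A" "\<forall>s\<in>{x..y + 1}. \<bar>A s\<bar> \<le> K" for A K n
    using bnd3[OF that(1), of x K n] bnd3[OF that(1), of y K n] that(2) xy unfolding split[OF that(1)] by auto
  show ?thesis using test bound supp lim fin fin2 by (intro exI[of _ \<psi>]) blast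
qed

section \<open>Primitives of locally integrable functions\<close>

text \<open>Absolute continuity of \<open>f\<close> with derivative \<open>g\<close>, in integrated form: \<open>g\<close> matters up to null sets only.\<close>

definition is_primitive :: "(real \<Rightarrow> real) \<Rightarrow> (real \<Rightarrow> real) \<Rightarrow> bool" where
  "is_primitive f g \<longleftrightarrow> locally_integrable g \<and> (\<forall>x y. x \<le> y \<longrightarrow> f y - f x = integral {x..y} g)"

lemma locally_integrableD:
  assumes "locally_integrable g"
  shows "set_integrable lborel {a..b} g" "g integrable_on {a..b}" "(\<lambda>x. \<bar>g x\<bar>) integrable_on {a..b}"
    "(LINT s:{a..b}|lborel. g s) = integral {a..b} g"
proof -
  show 1: "set_integrable lborel {a..b} g" using assms by (simp add: locally_integrable_def)
  show "g integrable_on {a..b}" "(LINT s:{a..b}|lborel. g s) = integral {a..b} g"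
    using set_borel_integral_eq_integral[OF 1] by auto
  have "set_integrable lborel {a..b} (\<lambda>x. \<bar>g x\<bar>)" using set_integrable_abs[OF 1] by simp
  then show "(\<lambda>x. \<bar>g x\<bar>) integrable_on {a..b}" by (rule set_borel_integral_eq_integral)
qed

lemma locally_integrable_continuous: "continuous_on UNIV g \<Longrightarrow> locally_integrable g"
  unfolding locally_integrable_def
  by (auto intro!: borel_integrable_atLeastAtMost' intro: continuous_on_subset)

lemma locally_integrable_measurable:
  assumes "locally_integrable g" shows "g \<in> borel_measurable borel"
proof (rule borel_measurable_LIMSEQ_real)
  show "(\<lambda>n::nat. indicator {- real n..real n} x * g x) \<longlonglongrightarrow> g x" for x
  proof -
    obtain m :: nat where "\<bar>x\<bar> \<le> real m" using real_arch_simple by blast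
    then have "indicator {- real n..real n} x * g x = g x" if "n \<ge> m" for n
      using that by (auto simp: indicator_def)
    then show ?thesis by (intro tendsto_eventually) (auto simp: eventually_sequentially)
  qed
  show "(\<lambda>x. indicator {- real n..real n} x * g x) \<in> borel_measurable borel" for n
    using borel_measurable_integrable[OF locally_integrableD(1)[OF assms, of "- real n" "real n", unfolded set_integrable_def]]
    by simp
qed

lemma locally_integrable_mult_continuous:
  assumes "continuous_on UNIV f" "locally_integrable g"
  shows "locally_integrable (\<lambda>x. f x * g x)"
  unfolding locally_integrable_def
proof (intro allI)
  fix a b :: real
  obtain K where K: "K \<ge> 0" "\<forall>s\<in>{a..b}. \<bar>f s\<bar> \<le> K"
    using continuous_bounded_on_Icc[OF continuous_on_subset[OF assms(1), of "{a..b}"]] by auto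
  have [measurable]: "f \<in> borel_measurable borel" "g \<in> borel_measurable borel"
    using assms by (auto intro: borel_measurable_continuous_onI locally_integrable_measurable)
  have "set_integrable lborel {a..b} (\<lambda>x. K * g x)"
    using locally_integrableD(1)[OF assms(2)] by (rule set_integrable_mult_right)
  then show "set_integrable lborel {a..b} (\<lambda>x. f x * g x)"
    unfolding set_integrable_def
    by (rule Bochner_Integration.integrable_bound)
       (use K in \<open>auto simp: indicator_def abs_mult intro!: AE_I2 mult_right_mono\<close>)
qed

lemma locally_integrable_add:
  "locally_integrable f \<Longrightarrow> locally_integrable g \<Longrightarrow> locally_integrable (\<lambda>x. f x + g x)"
  unfolding locally_integrable_def by (intro allI set_integral_add(1)) simp_all

lemma is_primitive_continuous:
  assumes "is_primitive f g" shows "continuous_on UNIV f"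
proof -
  have "isCont f x" for x
  proof -
    have eq: "f y = f (x - 1) + integral {x - 1..y} g" if "y \<in> {x - 1..x + 1}" for y
    proof -
      have "f y - f (x - 1) = integral {x - 1..y} g" using assms that by (simp add: is_primitive_def)
      then show ?thesis by simp
    qed
    have "continuous_on {x - 1..x + 1} (\<lambda>y. f (x - 1) + integral {x - 1..y} g)"
      using assms by (intro continuous_intros indefinite_integral_continuous_1 locally_integrableD) (simp add: is_primitive_def)
    then have "continuous_on {x - 1..x + 1} f"
      by (rule continuous_on_eq) (rule eq[symmetric])
    then show "isCont f x" by (rule continuous_on_interior) auto
  qed
  then show ?thesis by (simp add: continuous_on_eq_continuous_at)
qed

text \<open>The product rule. On a short interval \<open>{c..b}\<close> the increment of the product is the integral of
  \<open>f b * q + p c * g\<close>, which differs from the claimed integrand by little relative to \<open>\<bar>q\<bar> + \<bar>g\<bar>\<close>.\<close>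

lemma is_primitive_mult:
  assumes f: "is_primitive f g" and p: "is_primitive p q"
  shows "is_primitive (\<lambda>x. f x * p x) (\<lambda>x. f x * q x + p x * g x)"
  unfolding is_primitive_def
proof (intro conjI allI impI)
  have li: "locally_integrable g" "locally_integrable q" using f p by (auto simp: is_primitive_def)
  have cf: "continuous_on UNIV f" and cp: "continuous_on UNIV p" using f p is_primitive_continuous by auto
  show L: "locally_integrable (\<lambda>x. f x * q x + p x * g x)"
    by (intro locally_integrable_add locally_integrable_mult_continuous cf cp li)
  fix x y :: real assume xy: "x \<le> y"
  define r where "r s = f s * q s + p s * g s" for s
  define w where "w s = f s * p s - integral {x..s} r" for s
  define W where "W s = \<bar>q s\<bar> + \<bar>g s\<bar>" for s
  define V where "V s = integral {x..s} W" for s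
  have ir: "r integrable_on {c..d}" for c d unfolding r_def by (rule locally_integrableD(2)[OF L])
  have iW: "W integrable_on {c..d}" for c d unfolding W_def
    by (intro Henstock_Kurzweil_Integration.integrable_add locally_integrableD(3) li)
  have "w y = w x"
  proof (rule increment_le_if_locally_le[OF xy, where V = V])
    fix e :: real assume e: "e > 0"
    have "uniformly_continuous_on {x..y} f" "uniformly_continuous_on {x..y} p"
      by (auto intro!: compact_uniformly_continuous intro: continuous_on_subset[OF cf] continuous_on_subset[OF cp])
    with e obtain d1 d2 where d: "d1 > 0" "d2 > 0"
      and d1: "\<And>s t. s \<in> {x..y} \<Longrightarrow> t \<in> {x..y} \<Longrightarrow> \<bar>s - t\<bar> < d1 \<Longrightarrow> \<bar>f s - f t\<bar> < e"
      and d2: "\<And>s t. s \<in> {x..y} \<Longrightarrow> t \<in> {x..y} \<Longrightarrow> \<bar>s - t\<bar> < d2 \<Longrightarrow> \<bar>p s - p t\<bar> < e"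
      unfolding uniformly_continuous_on_def dist_real_def by (metis (no_types, lifting))
    show "\<exists>d>0. \<forall>c b. x \<le> c \<and> c \<le> b \<and> b \<le> y \<and> b - c < d \<longrightarrow> \<bar>w b - w c\<bar> \<le> e * (V b - V c)"
    proof (intro exI[of _ "min d1 d2"] conjI allI impI)
      fix c b assume cb: "x \<le> c \<and> c \<le> b \<and> b \<le> y \<and> b - c < min d1 d2"
      have c1: "integral {x..b} r - integral {x..c} r = integral {c..b} r"
        using Henstock_Kurzweil_Integration.integral_combine[of x c b r] cb ir by fastforce
      have c2: "V b - V c = integral {c..b} W"
        unfolding V_def using Henstock_Kurzweil_Integration.integral_combine[of x c b W] cb iW by fastforce
      have ig: "(\<lambda>s. k * q s) integrable_on {c..b}" "(\<lambda>s. k * g s) integrable_on {c..b}" for k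
        using locally_integrableD(2)[OF li(1)] locally_integrableD(2)[OF li(2)] by (auto intro: integrable_on_mult_right)
      have "f b * p b - f c * p c = f b * (p b - p c) + p c * (f b - f c)" by (simp add: algebra_simps)
      also have "\<dots> = f b * integral {c..b} q + p c * integral {c..b} g"
        using f p cb by (simp add: is_primitive_def)
      also have "\<dots> = integral {c..b} (\<lambda>s. f b * q s + p c * g s)"
        by (subst Henstock_Kurzweil_Integration.integral_add) (use ig in auto)
      finally have "w b - w c = integral {c..b} (\<lambda>s. f b * q s + p c * g s) - integral {c..b} r"
        unfolding w_def using c1 by simp
      also have "\<dots> = integral {c..b} (\<lambda>s. f b * q s + p c * g s - r s)"
        by (rule Henstock_Kurzweil_Integration.integral_diff[symmetric])
           (intro Henstock_Kurzweil_Integration.integrable_add ig ir)+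
      finally have wb: "w b - w c = integral {c..b} (\<lambda>s. f b * q s + p c * g s - r s)" .
      have "norm (integral {c..b} (\<lambda>s. f b * q s + p c * g s - r s)) \<le> integral {c..b} (\<lambda>s. e * W s)"
      proof (rule integral_norm_bound_integral)
        show "(\<lambda>s. f b * q s + p c * g s - r s) integrable_on {c..b}"
          by (intro Henstock_Kurzweil_Integration.integrable_diff Henstock_Kurzweil_Integration.integrable_add ig ir)
        show "(\<lambda>s. e * W s) integrable_on {c..b}" using iW by (rule integrable_on_mult_right)
        fix s assume s: "s \<in> {c..b}"
        have "\<bar>f b - f s\<bar> \<le> e" "\<bar>p c - p s\<bar> \<le> e"
          using d1[of b s] d2[of c s] s cb by force+
        then have "\<bar>(f b - f s) * q s\<bar> \<le> e * \<bar>q s\<bar>" "\<bar>(p c - p s) * g s\<bar> \<le> e * \<bar>g s\<bar>"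
          by (auto simp: abs_mult intro!: mult_right_mono)
        moreover have "f b * q s + p c * g s - r s = (f b - f s) * q s + (p c - p s) * g s"
          by (simp add: r_def algebra_simps)
        ultimately show "norm (f b * q s + p c * g s - r s) \<le> e * W s"
          unfolding real_norm_def W_def distrib_left by linarith
      qed
      then show "\<bar>w b - w c\<bar> \<le> e * (V b - V c)" unfolding wb c2 by simp
    qed (use d in auto)
  qed
  then have "f y * p y - f x * p x = integral {x..y} r" by (simp add: w_def)
  then show "f y * p y - f x * p x = integral {x..y} (\<lambda>x. f x * q x + p x * g x)"
    unfolding r_def[abs_def] .
qed

text \<open>Integration by parts is the product rule on an interval that contains the support of the test function.\<close>

lemma is_primitive_imp_has_weak_deriv:
  assumes "is_primitive f g" shows "has_weak_deriv f g"
  unfolding has_weak_deriv_def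
proof (intro conjI allI impI)
  have cf: "continuous_on UNIV f" using assms by (rule is_primitive_continuous)
  show "locally_integrable f" using cf by (rule locally_integrable_continuous)
  show lg: "locally_integrable g" using assms by (simp add: is_primitive_def)
  fix \<phi> :: "real \<Rightarrow> real" assume \<phi>: "test_fun UNIV \<phi>"
  note d = test_fun_deriv_real[OF \<phi>]
  have prim: "is_primitive \<phi> (deriv \<phi>)"
    unfolding is_primitive_def
  proof (intro conjI allI impI)
    show "locally_integrable (deriv \<phi>)" using d(2) by (rule locally_integrable_continuous)
    fix x y :: real assume "x \<le> y"
    then have "(deriv \<phi> has_integral \<phi> y - \<phi> x) {x..y}"
      by (rule fundamental_theorem_of_calculus)
         (use d(1) in \<open>auto simp: has_real_derivative_iff_has_vector_derivative[symmetric] intro: has_field_derivative_at_within\<close>)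
    then show "\<phi> y - \<phi> x = integral {x..y} (deriv \<phi>)" by (simp add: integral_unique)
  qed
  obtain K where K: "compact K" "\<And>x. x \<notin> K \<Longrightarrow> \<phi> x = 0" using \<phi> by (auto simp: test_fun_def)
  obtain R where R: "\<And>x. x \<in> K \<Longrightarrow> \<bar>x\<bar> \<le> R" using compact_imp_bounded[OF K(1)] by (auto simp: bounded_iff)
  define c where "c = \<bar>R\<bar> + 1"
  have z: "\<phi> x = 0" if "x \<notin> {- c<..<c}" for x
    using that R[of x] by (intro K(2)) (auto simp: c_def)
  have z': "\<phi> x = 0" if "x \<notin> {- c..c}" for x using that by (intro z) auto
  have dz: "deriv \<phi> x = 0" if "x \<notin> {- c..c}" for x
  proof -
    have "\<forall>\<^sub>F y in nhds x. \<phi> y = 0"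
    proof (rule eventually_mono[OF eventually_nhds_in_open])
      show "open (- {- c..c})" by auto
      show "x \<in> - {- c..c}" using that by simp
    qed (use z' in blast)
    then have "(\<phi> has_real_derivative 0) (at x)" by (subst DERIV_cong_ev[OF refl _ refl, of _ "\<lambda>_. 0"]) auto
    then show ?thesis by (rule DERIV_imp_deriv)
  qed
  have i1: "integrable lborel (\<lambda>x. f x * deriv \<phi> x)" "(LINT x|lborel. f x * deriv \<phi> x) = integral {- c..c} (\<lambda>x. f x * deriv \<phi> x)"
  proof -
    have "continuous_on {- c..c} (\<lambda>x. f x * deriv \<phi> x)"
      by (intro continuous_on_mult continuous_on_subset[OF cf] continuous_on_subset[OF d(2)]) auto
    moreover have "f x * deriv \<phi> x = 0" if "x \<notin> {- c..c}" for x using dz[OF that] by simp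
    ultimately show "integrable lborel (\<lambda>x. f x * deriv \<phi> x)"
      "(LINT x|lborel. f x * deriv \<phi> x) = integral {- c..c} (\<lambda>x. f x * deriv \<phi> x)"
      using integrable_continuous_compact_support[of "- c" c "\<lambda>x. f x * deriv \<phi> x"] by blast+
  qed
  have lg\<phi>: "locally_integrable (\<lambda>x. \<phi> x * g x)" by (intro locally_integrable_mult_continuous d(3) lg)
  have eq: "(\<lambda>x. indicator {- c..c} x *\<^sub>R (\<phi> x * g x)) = (\<lambda>x. g x * \<phi> x)"
  proof
    fix x show "indicator {- c..c} x *\<^sub>R (\<phi> x * g x) = g x * \<phi> x"
      by (cases "x \<in> {- c..c}") (simp_all add: z' mult.commute)
  qed
  have i2: "(LINT x|lborel. g x * \<phi> x) = integral {- c..c} (\<lambda>x. \<phi> x * g x)"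
    using locally_integrableD(4)[OF lg\<phi>, of "- c" c] unfolding set_lebesgue_integral_def eq .
  have "f c * \<phi> c - f (- c) * \<phi> (- c) = integral {- c..c} (\<lambda>x. f x * deriv \<phi> x + \<phi> x * g x)"
  proof -
    have "- c \<le> c" by (simp add: c_def)
    then show ?thesis using is_primitive_mult[OF assms prim] unfolding is_primitive_def by blast
  qed
  also have "\<dots> = integral {- c..c} (\<lambda>x. f x * deriv \<phi> x) + integral {- c..c} (\<lambda>x. \<phi> x * g x)"
    by (intro Henstock_Kurzweil_Integration.integral_add locally_integrableD(2)[OF lg\<phi>] integrable_continuous_real
        continuous_on_mult continuous_on_subset[OF cf] continuous_on_subset[OF d(2)]) auto
  finally show "(LINT x|lborel. f x * deriv \<phi> x) = - (LINT x|lborel. g x * \<phi> x)"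
    unfolding i1 i2 using z[of c] z[of "- c"] by simp
qed

lemma cutoff_integral_limit:
  fixes B :: "real \<Rightarrow> real" and \<psi> :: "nat \<Rightarrow> real \<Rightarrow> real"
  assumes B: "set_integrable lborel {x..y + 1} B" and xy: "x \<le> y"
    and \<psi>: "\<And>n. \<psi> n \<in> borel_measurable borel" "\<And>n s. \<bar>\<psi> n s\<bar> \<le> 1" "\<And>n s. s \<notin> {x..y + 1} \<Longrightarrow> \<psi> n s = 0"
      "\<And>s. (\<lambda>n. \<psi> n s) \<longlonglongrightarrow> indicator {x<..y} s"
  shows "(\<lambda>n. LINT s|lborel. B s * \<psi> n s) \<longlonglongrightarrow> integral {x..y} B"
proof -
  define C where "C s = indicator {x..y + 1} s *\<^sub>R B s" for s
  have C: "integrable lborel C" using B by (simp add: set_integrable_def C_def[abs_def])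
  have [measurable]: "C \<in> borel_measurable borel" using borel_measurable_integrable[OF C] by simp
  note \<psi>(1)[measurable]
  have eq: "(LINT s|lborel. B s * \<psi> n s) = (LINT s|lborel. C s * \<psi> n s)" for n
    by (intro Bochner_Integration.integral_cong refl) (use \<psi>(3) in \<open>auto simp: C_def indicator_def\<close>)
  have "(\<lambda>n. LINT s|lborel. C s * \<psi> n s) \<longlonglongrightarrow> (LINT s|lborel. C s * indicator {x<..y} s)"
  proof (rule integral_dominated_convergence[where w = "\<lambda>s. \<bar>C s\<bar>"])
    show "AE s in lborel. norm (C s * \<psi> n s) \<le> \<bar>C s\<bar>" for n
      using \<psi>(2)[of n] by (auto simp: abs_mult intro!: mult_left_le)
    show "AE s in lborel. (\<lambda>n. C s * \<psi> n s) \<longlonglongrightarrow> C s * indicator {x<..y} s"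
      by (intro AE_I2 tendsto_intros \<psi>)
  qed (use C in auto)
  also have "(LINT s|lborel. C s * indicator {x<..y} s) = (LINT s:{x..y}|lborel. B s)"
    unfolding set_lebesgue_integral_def
  proof (rule integral_cong_AE)
    show "(\<lambda>s. indicator {x..y} s *\<^sub>R B s) \<in> borel_measurable lborel"
      using set_integrable_subset[OF B, of "{x..y}"] unfolding set_integrable_def by (auto intro: borel_measurable_integrable)
    show "AE s in lborel. C s * indicator {x<..y} s = indicator {x..y} s *\<^sub>R B s"
      using AE_lborel_singleton[of x] by eventually_elim (auto simp: C_def indicator_def)
  qed auto
  also have "\<dots> = integral {x..y} B"
    by (rule set_borel_integral_eq_integral(2)[OF set_integrable_subset[OF B]]) auto
  finally show ?thesis unfolding eq .
qed

text \<open>The lemma of du Bois-Reymond: test with the cutoffs of \<open>{x<..y}\<close>. It serves in space, for weak derivatives, and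
  in time, for the weak form of the equation.\<close>

lemma weak_deriv_imp_increment:
  assumes A: "continuous_on UNIV A" and B: "locally_integrable B"
    and xy: "x \<le> y" and U: "{x..y + 1} \<subseteq> U"
    and weak: "\<And>\<theta>. test_fun U \<theta> \<Longrightarrow> (LINT s|lborel. A s * deriv \<theta> s) = - (LINT s|lborel. B s * \<theta> s)"
  shows "A y - A x = integral {x..y} B"
proof -
  obtain \<psi> :: "nat \<Rightarrow> real \<Rightarrow> real" where \<psi>: "\<And>n. test_fun U (\<psi> n)" "\<And>n s. \<bar>\<psi> n s\<bar> \<le> 1"
      "\<And>n s. s \<notin> {x..y + 1} \<Longrightarrow> \<psi> n s = 0" "\<And>s. (\<lambda>n. \<psi> n s) \<longlonglongrightarrow> indicator {x<..y} s"
    and lim: "(\<lambda>n. LINT s|lborel. A s * deriv (\<psi> n) s) \<longlonglongrightarrow> A x - A y"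
    using exists_cutoffs[OF xy U] A by blast
  have m: "\<psi> n \<in> borel_measurable borel" for n
    using test_fun_deriv_real(3)[OF \<psi>(1)] by (rule borel_measurable_continuous_onI)
  have "(\<lambda>n. LINT s|lborel. B s * \<psi> n s) \<longlonglongrightarrow> integral {x..y} B"
    by (rule cutoff_integral_limit[OF locally_integrableD(1)[OF B] xy m]) (use \<psi> in auto)
  then have "(\<lambda>n. LINT s|lborel. A s * deriv (\<psi> n) s) \<longlonglongrightarrow> - integral {x..y} B"
    unfolding weak[OF \<psi>(1)] by (rule tendsto_minus)
  with lim have "A x - A y = - integral {x..y} B" by (rule LIMSEQ_unique)
  then show ?thesis by simp
qed

lemma has_weak_deriv_imp_is_primitive:
  assumes "has_weak_deriv f g" "continuous_on UNIV f"
  shows "is_primitive f g"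
  unfolding is_primitive_def
  using assms by (auto simp: has_weak_deriv_def intro!: weak_deriv_imp_increment[where U = UNIV])

text \<open>Equality of the integrals passes from intervals to Borel sets by induction over the latter.\<close>

lemma interval_integrals_determine_function:
  fixes f g :: "real \<Rightarrow> real"
  assumes f: "set_integrable lborel {a..b} f" and g: "set_integrable lborel {a..b} g"
    and eq: "\<And>x y. a \<le> x \<Longrightarrow> x \<le> y \<Longrightarrow> y \<le> b \<Longrightarrow> integral {x..y} f = integral {x..y} g"
  shows "AE x in lborel. x \<in> {a..b} \<longrightarrow> f x = g x"
proof -
  define F where "F x = indicator {a..b} x *\<^sub>R f x" for x
  define G where "G x = indicator {a..b} x *\<^sub>R g x" for x
  have iF: "integrable lborel F" and iG: "integrable lborel G"
    using f g by (auto simp: set_integrable_def F_def[abs_def] G_def[abs_def])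
  have iD: "integrable lborel (\<lambda>x. F x - G x)" using iF iG by auto
  have iDA: "set_integrable lborel A (\<lambda>x. F x - G x)" if "A \<in> sets borel" for A
    using integrable_mult_indicator[OF _ iD, of A] that by (simp add: set_integrable_def)
  have int: "(LINT x:{c..d}|lborel. F x - G x) = 0" for c d
  proof (cases "max a c \<le> min b d")
    case True
    have s: "set_integrable lborel {max a c..min b d} f" "set_integrable lborel {max a c..min b d} g"
      using f g by (auto intro: set_integrable_subset)
    have "(LINT x:{c..d}|lborel. F x - G x) = (LINT x:{max a c..min b d}|lborel. f x - g x)"
      unfolding set_lebesgue_integral_def
      by (intro Bochner_Integration.integral_cong) (auto simp: F_def G_def indicator_def)
    also have "\<dots> = (LINT x:{max a c..min b d}|lborel. f x) - (LINT x:{max a c..min b d}|lborel. g x)"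
      using s by (rule set_integral_diff)
    also have "\<dots> = 0"
      unfolding set_borel_integral_eq_integral(2)[OF s(1)] set_borel_integral_eq_integral(2)[OF s(2)]
      using eq[of "max a c" "min b d"] True by auto
    finally show ?thesis .
  next
    case False
    then have "indicator {c..d} x *\<^sub>R (F x - G x) = 0" for x by (auto simp: F_def G_def indicator_def)
    then show ?thesis by (simp only: set_lebesgue_integral_def Bochner_Integration.integral_zero)
  qed
  have tot: "(LINT x|lborel. F x - G x) = 0"
  proof -
    have "(LINT x:{a..b}|lborel. F x - G x) = (LINT x|lborel. F x - G x)"
      unfolding set_lebesgue_integral_def by (intro Bochner_Integration.integral_cong) (auto simp: F_def G_def indicator_def)
    then show ?thesis using int[of a b] by simp
  qed
  have zero: "(LINT x:A|lborel. F x - G x) = 0" if "A \<in> sets borel" for A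
    using that
  proof (induction rule: borel_set_induct)
    case empty
    show ?case by (simp add: set_lebesgue_integral_def)
  next
    case (interval c d)
    show ?case by (rule int)
  next
    case (compl A)
    have "(LINT x:A \<union> - A|lborel. F x - G x) = (LINT x:A|lborel. F x - G x) + (LINT x:- A|lborel. F x - G x)"
      using compl by (intro set_integral_Un iDA) auto
    moreover have "(LINT x:A \<union> - A|lborel. F x - G x) = 0" using tot by (simp add: set_lebesgue_integral_def)
    ultimately show ?case using compl by simp
  next
    case (union A)
    then show ?case
      by (subst lebesgue_integral_countable_add) (auto simp: disjoint_family_on_def intro!: iDA)
  qed
  have "AE x in lborel. F x = G x"
  proof (rule density_unique_real[OF iF iG])
    fix A :: "real set" assume A: "A \<in> sets lborel"
    have "set_integrable lborel A F" "set_integrable lborel A G"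
      using integrable_mult_indicator[OF A iF] integrable_mult_indicator[OF A iG] by (simp_all add: set_integrable_def)
    then show "(LINT x:A|lborel. F x) = (LINT x:A|lborel. G x)"
      using zero[of A] A set_integral_diff[of lborel A F G] by simp
  qed
  then show ?thesis by eventually_elim (auto simp: F_def G_def)
qed

section \<open>Limits in the mean square\<close>

lemma integrable_square_diff:
  fixes A B :: "'a \<Rightarrow> real"
  assumes [measurable]: "A \<in> borel_measurable M" "B \<in> borel_measurable M"
    and "integrable M (\<lambda>x. (A x)\<^sup>2)" "integrable M (\<lambda>x. (B x)\<^sup>2)"
  shows "integrable M (\<lambda>x. (A x - B x)\<^sup>2)"
proof (rule Bochner_Integration.integrable_bound)
  show "integrable M (\<lambda>x. 2 * (A x)\<^sup>2 + 2 * (B x)\<^sup>2)" using assms by auto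
  have "(A x - B x)\<^sup>2 \<le> 2 * (A x)\<^sup>2 + 2 * (B x)\<^sup>2" for x
    using zero_le_power2[of "A x + B x"] by (simp add: power2_sum power2_diff)
  then show "AE x in M. norm ((A x - B x)\<^sup>2) \<le> norm (2 * (A x)\<^sup>2 + 2 * (B x)\<^sup>2)" by auto
qed auto

text \<open>By \<open>A\<^sup>2 - B\<^sup>2 = (A - B)\<^sup>2 + 2 B (A - B)\<close> and the inequality of the means with a small parameter \<open>\<eta>\<close>, convergence in mean square
  implies convergence of the squares in mean.\<close>

lemma tendsto_weighted_square_integral:
  fixes A :: "nat \<Rightarrow> 'a \<Rightarrow> real" and B k :: "'a \<Rightarrow> real"
  assumes m[measurable]: "\<And>n. A n \<in> borel_measurable M" "B \<in> borel_measurable M" "k \<in> borel_measurable M"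
    and iA: "\<And>n. integrable M (\<lambda>x. (A n x)\<^sup>2)" and iB: "integrable M (\<lambda>x. (B x)\<^sup>2)"
    and lim: "(\<lambda>n. LINT x|M. (A n x - B x)\<^sup>2) \<longlonglongrightarrow> 0"
    and k: "\<And>x. \<bar>k x\<bar> \<le> K"
  shows "(\<lambda>n. LINT x|M. k x * (A n x)\<^sup>2) \<longlonglongrightarrow> (LINT x|M. k x * (B x)\<^sup>2)"
proof (rule LIMSEQ_I)
  fix e :: real assume e: "e > 0"
  define b where "b = (LINT x|M. (B x)\<^sup>2)"
  have b: "b \<ge> 0" unfolding b_def by simp
  define K' where "K' = \<bar>K\<bar> + 1"
  have K': "K' > 0" "\<And>x. \<bar>k x\<bar> \<le> K'"
    using k by (auto simp: K'_def intro: order_trans[of _ K])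
  \<comment> \<open>Chosen so that the term with \<open>B\<close> contributes at most half of \<open>e\<close>.\<close>
  define \<eta> where "\<eta> = e / (2 * K' * (b + 1))"
  have \<eta>: "\<eta> > 0" using e b K' by (simp add: \<eta>_def)
  define d where "d n = (LINT x|M. (A n x - B x)\<^sup>2)" for n
  have "(\<lambda>n. K' * ((1 + 1 / \<eta>) * d n)) \<longlonglongrightarrow> K' * ((1 + 1 / \<eta>) * 0)"
    unfolding d_def by (intro tendsto_intros lim)
  then obtain N where N: "\<And>n. n \<ge> N \<Longrightarrow> \<bar>K' * ((1 + 1 / \<eta>) * d n)\<bar> < e / 2"
    using LIMSEQ_D[of _ 0 "e / 2"] e by fastforce
  have bndk: "integrable M (\<lambda>x. k x * (F x)\<^sup>2)" if [measurable]: "F \<in> borel_measurable M" and "integrable M (\<lambda>x. (F x)\<^sup>2)" for F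
    by (rule Bochner_Integration.integrable_bound[OF integrable_mult_right[OF that(2), of K']])
       (use K' in \<open>auto simp: abs_mult intro!: mult_right_mono\<close>)
  have "norm ((LINT x|M. k x * (A n x)\<^sup>2) - (LINT x|M. k x * (B x)\<^sup>2)) < e" if "n \<ge> N" for n
  proof -
    have iD: "integrable M (\<lambda>x. (A n x - B x)\<^sup>2)" by (rule integrable_square_diff[OF m(1) m(2) iA iB])
    have "(LINT x|M. k x * (A n x)\<^sup>2) - (LINT x|M. k x * (B x)\<^sup>2) = (LINT x|M. k x * (A n x)\<^sup>2 - k x * (B x)\<^sup>2)"
      by (rule Bochner_Integration.integral_diff[symmetric]) (intro bndk m iA iB)+
    also have "norm \<dots> \<le> (LINT x|M. norm (k x * (A n x)\<^sup>2 - k x * (B x)\<^sup>2))"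
      by (rule integral_norm_bound)
    also have "\<dots> \<le> (LINT x|M. K' * ((1 + 1 / \<eta>) * (A n x - B x)\<^sup>2 + \<eta> * (B x)\<^sup>2))"
    proof (rule integral_mono)
      show "integrable M (\<lambda>x. norm (k x * (A n x)\<^sup>2 - k x * (B x)\<^sup>2))"
        by (intro integrable_norm Bochner_Integration.integrable_diff bndk m iA iB)
      show "integrable M (\<lambda>x. K' * ((1 + 1 / \<eta>) * (A n x - B x)\<^sup>2 + \<eta> * (B x)\<^sup>2))" using iD iB by auto
      fix x
      define r where "r = A n x - B x"
      have "\<bar>2 * B x * r\<bar> \<le> \<eta> * (B x)\<^sup>2 + 1 / \<eta> * r\<^sup>2"
      proof -
        have "0 \<le> (\<eta> * \<bar>B x\<bar> - \<bar>r\<bar>)\<^sup>2 / \<eta>" using \<eta> by simp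
        also have "\<dots> = \<eta> * (B x)\<^sup>2 + 1 / \<eta> * r\<^sup>2 - \<bar>2 * B x * r\<bar>"
          using \<eta> by (simp add: power2_diff power_mult_distrib abs_mult field_simps power2_eq_square)
        finally show ?thesis by simp
      qed
      moreover have "(A n x)\<^sup>2 - (B x)\<^sup>2 = r\<^sup>2 + 2 * B x * r" by (simp add: r_def power2_eq_square algebra_simps)
      ultimately have "\<bar>(A n x)\<^sup>2 - (B x)\<^sup>2\<bar> \<le> (1 + 1 / \<eta>) * r\<^sup>2 + \<eta> * (B x)\<^sup>2"
        using zero_le_power2[of r] unfolding distrib_right by linarith
      then have "\<bar>k x\<bar> * \<bar>(A n x)\<^sup>2 - (B x)\<^sup>2\<bar> \<le> K' * ((1 + 1 / \<eta>) * r\<^sup>2 + \<eta> * (B x)\<^sup>2)"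
        using K' by (intro mult_mono) auto
      then show "norm (k x * (A n x)\<^sup>2 - k x * (B x)\<^sup>2) \<le> K' * ((1 + 1 / \<eta>) * (A n x - B x)\<^sup>2 + \<eta> * (B x)\<^sup>2)"
        by (simp add: r_def abs_mult[symmetric] right_diff_distrib)
    qed
    also have "\<dots> = K' * ((1 + 1 / \<eta>) * d n) + K' * \<eta> * b"
      using iD iB by (simp add: d_def b_def algebra_simps)
    also have "K' * \<eta> * b \<le> e / 2"
    proof -
      have "K' * \<eta> * b = e / 2 * (b / (b + 1))" using K'(1) b by (simp add: \<eta>_def)
      also have "\<dots> \<le> e / 2" using e b by (intro mult_left_le) auto
      finally show ?thesis .
    qed
    finally show ?thesis
      using N[OF that] abs_ge_self[of "K' * ((1 + 1 / \<eta>) * d n)"] unfolding real_norm_def by linarith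
  qed
  then show "\<exists>no. \<forall>n\<ge>no. norm ((LINT x|M. k x * (A n x)\<^sup>2) - (LINT x|M. k x * (B x)\<^sup>2)) < e" by blast
qed

text \<open>The Riesz-Fischer theorem. On a finite measure space, a subsequence with rapidly decreasing mean square increments
  has absolutely summable increments almost everywhere. The pointwise limit is the limit in mean square by Fatou's lemma.\<close>

lemma L2_complete:
  fixes D :: "nat \<Rightarrow> 'a \<Rightarrow> real"
  assumes "finite_measure M" and m[measurable]: "\<And>n. D n \<in> borel_measurable M"
    and sq: "\<And>n. integrable M (\<lambda>x. (D n x)\<^sup>2)"
    and cauchy: "\<And>e. e > 0 \<Longrightarrow> \<exists>N. \<forall>m\<ge>N. \<forall>n\<ge>N. (LINT x|M. (D m x - D n x)\<^sup>2) \<le> e"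
  shows "\<exists>g\<in>borel_measurable M. integrable M (\<lambda>x. (g x)\<^sup>2) \<and> (\<lambda>n. LINT x|M. (D n x - g x)\<^sup>2) \<longlonglongrightarrow> 0"
proof -
  interpret finite_measure M by fact
  have iD: "integrable M (\<lambda>x. (D i x - D j x)\<^sup>2)" for i j by (rule integrable_square_diff[OF m m sq sq])
  define q :: "nat \<Rightarrow> real" where "q k = (1/4) ^ k" for k
  obtain N where N: "\<And>k m n. m \<ge> N k \<Longrightarrow> n \<ge> N k \<Longrightarrow> (LINT x|M. (D m x - D n x)\<^sup>2) \<le> q k"
    using cauchy[of "q _"] by (auto simp: q_def) metis
  \<comment> \<open>Partial sums make the indices of the subsequence monotone.\<close>
  define R where "R k = (\<Sum>i\<le>k. N i)" for k
  have RN: "R j \<ge> N k" if "j \<ge> k" for j k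
    unfolding R_def using that by (intro member_le_sum) auto
  define E where "E k = D (R k)" for k
  have [measurable]: "E k \<in> borel_measurable M" for k by (simp add: E_def)
  have L1: "(\<integral>\<^sup>+x. ennreal \<bar>E (Suc k) x - E k x\<bar> \<partial>M) \<le> ennreal ((1/2) ^ k * (1 + measure M (space M)))" for k
  proof -
    have i: "integrable M (\<lambda>x. 2 ^ k * (E (Suc k) x - E k x)\<^sup>2 + (1/2) ^ k)"
      using iD[of "R (Suc k)" "R k"] by (auto simp: E_def)
    have "(\<integral>\<^sup>+x. ennreal \<bar>E (Suc k) x - E k x\<bar> \<partial>M) \<le> (\<integral>\<^sup>+x. ennreal (2 ^ k * (E (Suc k) x - E k x)\<^sup>2 + (1/2) ^ k) \<partial>M)"
    proof (intro nn_integral_mono ennreal_leI)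
      fix x
      define r where "r = \<bar>E (Suc k) x - E k x\<bar>"
      have "0 \<le> (2 ^ k * r - 1)\<^sup>2 / 2 ^ k" by simp
      also have "\<dots> = 2 ^ k * r\<^sup>2 + (1/2) ^ k - 2 * r"
        by (simp add: power2_diff power_mult_distrib field_simps power2_eq_square)
      finally have "2 * r \<le> 2 ^ k * r\<^sup>2 + (1/2) ^ k" by simp
      moreover have "r \<ge> 0" by (simp add: r_def)
      ultimately have "r \<le> 2 ^ k * r\<^sup>2 + (1/2) ^ k" by linarith
      then show "\<bar>E (Suc k) x - E k x\<bar> \<le> 2 ^ k * (E (Suc k) x - E k x)\<^sup>2 + (1/2) ^ k" by (simp add: r_def)
    qed
    also have "\<dots> = ennreal (LINT x|M. 2 ^ k * (E (Suc k) x - E k x)\<^sup>2 + (1/2) ^ k)"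
      by (rule nn_integral_eq_integral[OF i]) auto
    also have "\<dots> \<le> ennreal ((1/2) ^ k * (1 + measure M (space M)))"
    proof (rule ennreal_leI)
      have "(LINT x|M. 2 ^ k * (E (Suc k) x - E k x)\<^sup>2 + (1/2) ^ k)
          = 2 ^ k * (LINT x|M. (E (Suc k) x - E k x)\<^sup>2) + (1/2) ^ k * measure M (space M)"
        using iD[of "R (Suc k)" "R k"] by (simp add: E_def)
      also have "\<dots> \<le> 2 ^ k * q k + (1/2) ^ k * measure M (space M)"
        unfolding E_def by (intro add_right_mono mult_left_mono N RN) auto
      also have "2 ^ k * q k = (1/2) ^ k" unfolding q_def by (simp add: power_mult_distrib[symmetric])
      finally show "(LINT x|M. 2 ^ k * (E (Suc k) x - E k x)\<^sup>2 + (1/2) ^ k) \<le> (1/2) ^ k * (1 + measure M (space M))"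
        by (simp add: algebra_simps)
    qed
    finally show ?thesis .
  qed
  have "(\<integral>\<^sup>+x. (\<Sum>k. ennreal \<bar>E (Suc k) x - E k x\<bar>) \<partial>M) = (\<Sum>k. \<integral>\<^sup>+x. ennreal \<bar>E (Suc k) x - E k x\<bar> \<partial>M)"
    by (rule nn_integral_suminf) auto
  also have "\<dots> \<le> (\<Sum>k. ennreal ((1/2) ^ k * (1 + measure M (space M))))"
    by (intro suminf_le L1) auto
  also have "\<dots> = ennreal (\<Sum>k. (1/2) ^ k * (1 + measure M (space M)))"
    by (rule suminf_ennreal_eq) (auto intro!: summable_sums summable_mult2 summable_geometric)
  finally have "(\<integral>\<^sup>+x. (\<Sum>k. ennreal \<bar>E (Suc k) x - E k x\<bar>) \<partial>M) \<noteq> \<infinity>"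
    by (auto simp: top_unique)
  then have "AE x in M. (\<Sum>k. ennreal \<bar>E (Suc k) x - E k x\<bar>) \<noteq> \<infinity>"
    by (intro nn_integral_noteq_infinite) auto
  then have conv: "AE x in M. (\<lambda>k. E k x) \<longlonglongrightarrow> lim (\<lambda>k. E k x)"
  proof eventually_elim
    case (elim x)
    then have "summable (\<lambda>k. \<bar>E (Suc k) x - E k x\<bar>)"
      by (intro summable_suminf_not_top) auto
    then have "summable (\<lambda>k. E (Suc k) x - E k x)" by (rule summable_rabs_cancel)
    then have "convergent (\<lambda>n. \<Sum>k<n. E (Suc k) x - E k x)" by (simp add: summable_iff_convergent)
    moreover have "(\<Sum>k<n. E (Suc k) x - E k x) = E n x - E 0 x" for n
      by (rule sum_lessThan_telescope[where f = "\<lambda>k. E k x"])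
    ultimately have "convergent (\<lambda>n. E n x - E 0 x)" by simp
    then have "convergent (\<lambda>n. (E n x - E 0 x) + E 0 x)" by (intro convergent_add convergent_const)
    then show ?case by (simp add: convergent_LIMSEQ_iff)
  qed
  define g where "g x = lim (\<lambda>k. E k x)" for x
  have [measurable]: "g \<in> borel_measurable M" unfolding g_def by measurable
  have fatou: "(\<integral>\<^sup>+x. ennreal ((D n x - g x)\<^sup>2) \<partial>M) \<le> ennreal (q k)" if n: "n \<ge> N k" for n k
  proof -
    have "(\<integral>\<^sup>+x. ennreal ((D n x - g x)\<^sup>2) \<partial>M) = (\<integral>\<^sup>+x. liminf (\<lambda>j. ennreal ((D n x - E j x)\<^sup>2)) \<partial>M)"
    proof (rule nn_integral_cong_AE)
      show "AE x in M. ennreal ((D n x - g x)\<^sup>2) = liminf (\<lambda>j. ennreal ((D n x - E j x)\<^sup>2))"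
        using conv
      proof eventually_elim
        case (elim x)
        have "(\<lambda>j. ennreal ((D n x - E j x)\<^sup>2)) \<longlonglongrightarrow> ennreal ((D n x - g x)\<^sup>2)"
          using elim unfolding g_def by (intro tendsto_intros)
        from lim_imp_Liminf[OF sequentially_bot this] show ?case by (rule sym)
      qed
    qed
    also have "\<dots> \<le> liminf (\<lambda>j. \<integral>\<^sup>+x. ennreal ((D n x - E j x)\<^sup>2) \<partial>M)"
      by (rule nn_integral_liminf) auto
    also have "\<dots> \<le> ennreal (q k)"
    proof (rule Liminf_le)
      show "\<forall>\<^sub>F j in sequentially. (\<integral>\<^sup>+x. ennreal ((D n x - E j x)\<^sup>2) \<partial>M) \<le> ennreal (q k)"
        using eventually_ge_at_top[of k]
      proof eventually_elim
        case (elim j)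
        have "(\<integral>\<^sup>+x. ennreal ((D n x - E j x)\<^sup>2) \<partial>M) = ennreal (LINT x|M. (D n x - E j x)\<^sup>2)"
          unfolding E_def by (rule nn_integral_eq_integral[OF iD]) auto
        also have "\<dots> \<le> ennreal (q k)" unfolding E_def by (intro ennreal_leI N n RN elim)
        finally show ?case .
      qed
    qed auto
    finally show ?thesis .
  qed
  have ig: "integrable M (\<lambda>x. (D n x - g x)\<^sup>2)" "(LINT x|M. (D n x - g x)\<^sup>2) \<le> q k" if "n \<ge> N k" for n k
  proof -
    show i: "integrable M (\<lambda>x. (D n x - g x)\<^sup>2)"
      by (rule integrableI_bounded) (use fatou[OF that] in \<open>auto simp: top_unique less_top[symmetric]\<close>)
    show "(LINT x|M. (D n x - g x)\<^sup>2) \<le> q k"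
      using fatou[OF that] nn_integral_eq_integral[OF i] by (simp add: q_def)
  qed
  have "integrable M (\<lambda>x. (D (N 0) x - (D (N 0) x - g x))\<^sup>2)"
    by (rule integrable_square_diff[OF _ _ sq ig(1)[of 0]]) auto
  then have "integrable M (\<lambda>x. (g x)\<^sup>2)" by simp
  moreover have "(\<lambda>n. LINT x|M. (D n x - g x)\<^sup>2) \<longlonglongrightarrow> 0"
  proof (rule LIMSEQ_I)
    fix e :: real assume "e > 0"
    then obtain k where k: "q k < e" unfolding q_def using real_arch_pow_inv[of e "1/4"] by auto
    have "norm ((LINT x|M. (D n x - g x)\<^sup>2) - 0) < e" if "n \<ge> N k" for n
      using ig(2)[OF that] k by (simp add: integral_nonneg_AE)
    then show "\<exists>no. \<forall>n\<ge>no. norm ((LINT x|M. (D n x - g x)\<^sup>2) - 0) < e" by blast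
  qed
  ultimately show ?thesis by (intro bexI[of _ g]) auto
qed

section \<open>Dyadic difference quotients\<close>

text \<open>The inequality of Cauchy and Schwarz, from the integral of \<open>(r - c)\<^sup>2 \<ge> 0\<close> where \<open>c\<close> is the mean of \<open>r\<close>.\<close>

lemma square_of_integral_le:
  fixes r :: "real \<Rightarrow> real"
  assumes "x \<le> y" "r integrable_on {x..y}" "(\<lambda>s. (r s)\<^sup>2) integrable_on {x..y}"
  shows "(integral {x..y} r)\<^sup>2 \<le> (y - x) * integral {x..y} (\<lambda>s. (r s)\<^sup>2)"
proof (cases "x = y")
  case False
  define h where "h = y - x"
  have h: "h > 0" using False assms(1) by (simp add: h_def)
  define c where "c = integral {x..y} r / h"
  have "integral {x..y} (\<lambda>s. 2 * c * r s - c\<^sup>2) \<le> integral {x..y} (\<lambda>s. (r s)\<^sup>2)"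
  proof (rule Henstock_Kurzweil_Integration.integral_le)
    show "(\<lambda>s. 2 * c * r s - c\<^sup>2) integrable_on {x..y}"
      using assms(2) by (intro Henstock_Kurzweil_Integration.integrable_diff integrable_on_mult_right integrable_const_ivl)
    show "2 * c * r s - c\<^sup>2 \<le> (r s)\<^sup>2" for s using zero_le_power2[of "r s - c"] by (simp add: power2_diff algebra_simps)
  qed fact
  also have "integral {x..y} (\<lambda>s. 2 * c * r s - c\<^sup>2) = 2 * c * integral {x..y} r - c\<^sup>2 * h"
    using assms(1,2) by (subst Henstock_Kurzweil_Integration.integral_diff) (auto intro: integrable_on_mult_right simp: h_def)
  also have "\<dots> = (integral {x..y} r)\<^sup>2 / h" using h by (simp add: c_def power2_eq_square field_simps)
  finally show ?thesis using h by (simp add: h_def field_simps)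
qed simp

definition node :: "real \<Rightarrow> real \<Rightarrow> nat \<Rightarrow> nat \<Rightarrow> real" where
  "node a b n j = a + (b - a) * real j / 2 ^ n"

definition slope :: "(real \<Rightarrow> real) \<Rightarrow> real \<Rightarrow> real \<Rightarrow> nat \<Rightarrow> nat \<Rightarrow> real" where
  "slope f a b n j = (f (node a b n (Suc j)) - f (node a b n j)) / ((b - a) / 2 ^ n)"

text \<open>The step function of the difference quotients of \<open>f\<close> on the \<open>2 ^ n\<close> equal cells of \<open>{a..b}\<close>.\<close>

definition dyadic_slope :: "(real \<Rightarrow> real) \<Rightarrow> real \<Rightarrow> real \<Rightarrow> nat \<Rightarrow> real \<Rightarrow> real" where
  "dyadic_slope f a b n y = slope f a b n (nat \<lfloor>(y - a) / (b - a) * 2 ^ n\<rfloor>)"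

lemma node_0: "node a b n 0 = a" and node_top: "node a b n (2 ^ n) = b"
  by (simp_all add: node_def)

lemma node_Suc: "node a b n (Suc j) = node a b n j + (b - a) / 2 ^ n"
  by (simp add: node_def field_simps)

lemma node_refine: "node a b (n + d) (j * 2 ^ d) = node a b n j"
  by (simp add: node_def power_add)

lemma node_mono: "a \<le> b \<Longrightarrow> i \<le> j \<Longrightarrow> node a b n i \<le> node a b n j"
  by (auto simp: node_def intro!: divide_right_mono mult_left_mono)

lemma node_in: assumes "a \<le> b" "j \<le> 2 ^ n" shows "node a b n j \<in> {a..b}"
  using node_mono[of a b 0 j n] node_mono[of a b j "2 ^ n" n] assms by (simp add: node_0 node_top)

lemma dyadic_slope_on_cell:
  assumes "a < b" "node a b n j \<le> y" "y < node a b n (Suc j)"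
  shows "dyadic_slope f a b n y = slope f a b n j"
proof -
  have "real j \<le> (y - a) / (b - a) * 2 ^ n" "(y - a) / (b - a) * 2 ^ n < real j + 1"
    using assms by (auto simp: node_def field_simps)
  then have "\<lfloor>(y - a) / (b - a) * 2 ^ n\<rfloor> = int j" by (intro floor_unique) auto
  then show ?thesis by (simp add: dyadic_slope_def)
qed

lemma has_integral_cells:
  fixes \<phi> :: "real \<Rightarrow> real"
  assumes ab: "a < b" and im: "i \<le> m"
    and cell: "\<And>j. i \<le> j \<Longrightarrow> j < m \<Longrightarrow> (\<phi> has_integral I j) {node a b n j..node a b n (Suc j)}"
  shows "(\<phi> has_integral (\<Sum>j=i..<m. I j)) {node a b n i..node a b n m}"
  using im cell
proof (induction m rule: dec_induct)
  case base
  have "(\<phi> has_integral 0) (cbox (node a b n i) (node a b n i))" by (rule has_integral_refl)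
  then show ?case by simp
next
  case (step m)
  have "(\<phi> has_integral (\<Sum>j=i..<m. I j) + I m) {node a b n i..node a b n (Suc m)}"
    using step ab by (intro has_integral_combine[of "node a b n i" "node a b n m"] node_mono) auto
  then show ?case using step by simp
qed

lemma has_integral_dyadic_cell:
  fixes \<Phi> \<psi> :: "real \<Rightarrow> real"
  assumes ab: "a < b" and \<psi>: "(\<psi> has_integral J) {node a b n j..node a b n (Suc j)}"
  shows "((\<lambda>y. \<Phi> (dyadic_slope f a b n y) * \<psi> y) has_integral \<Phi> (slope f a b n j) * J)
    {node a b n j..node a b n (Suc j)}"
proof (rule has_integral_spike_finite[of "{node a b n (Suc j)}"])
  show "((\<lambda>y. \<Phi> (slope f a b n j) * \<psi> y) has_integral \<Phi> (slope f a b n j) * J) {node a b n j..node a b n (Suc j)}"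
    using \<psi> by (rule has_integral_mult_right)
qed (use dyadic_slope_on_cell[OF ab] in auto)

lemma has_integral_dyadic_slope:
  fixes \<Phi> :: "real \<Rightarrow> real"
  assumes ab: "a < b" and im: "i \<le> m"
  shows "((\<lambda>y. \<Phi> (dyadic_slope f a b n y)) has_integral (\<Sum>j=i..<m. \<Phi> (slope f a b n j) * ((b - a) / 2 ^ n)))
    {node a b n i..node a b n m}"
proof (rule has_integral_cells[OF ab im])
  fix j
  have "((\<lambda>_. 1::real) has_integral ((b - a) / 2 ^ n)) {node a b n j..node a b n (Suc j)}"
    using has_integral_const_real[of "1::real" "node a b n j" "node a b n (Suc j)"] ab by (simp add: node_Suc)
  from has_integral_dyadic_cell[OF ab this, of \<Phi> f]
  show "((\<lambda>y. \<Phi> (dyadic_slope f a b n y)) has_integral \<Phi> (slope f a b n j) * ((b - a) / 2 ^ n))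
    {node a b n j..node a b n (Suc j)}" by simp
qed

text \<open>A finer step function has the same integral over each coarser cell, because increments telescope: the step
  functions form a martingale.\<close>

lemma has_integral_finer_dyadic_slope:
  assumes ab: "a < b" and im: "i \<le> m"
  shows "(dyadic_slope f a b (n + d) has_integral f (node a b n m) - f (node a b n i)) {node a b n i..node a b n m}"
proof -
  have "(dyadic_slope f a b (n + d) has_integral
      (\<Sum>j=i * 2 ^ d..<m * 2 ^ d. slope f a b (n + d) j * ((b - a) / 2 ^ (n + d)))) {node a b n i..node a b n m}"
    using has_integral_dyadic_slope[OF ab, of "i * 2 ^ d" "m * 2 ^ d" "\<lambda>x. x" f "n + d"] im by (simp add: node_refine)
  also have "(\<Sum>j=i * 2 ^ d..<m * 2 ^ d. slope f a b (n + d) j * ((b - a) / 2 ^ (n + d)))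
    = (\<Sum>j=i * 2 ^ d..<m * 2 ^ d. f (node a b (n + d) (Suc j)) - f (node a b (n + d) j))"
    using ab by (simp add: slope_def)
  also have "\<dots> = f (node a b (n + d) (m * 2 ^ d)) - f (node a b (n + d) (i * 2 ^ d))"
    using im by (intro sum_Suc_diff') simp
  finally show ?thesis by (simp add: node_refine)
qed

text \<open>The square of the \<open>L\<^sup>2\<close> norm of the step function of difference quotients.\<close>

definition dyadic_energy :: "(real \<Rightarrow> real) \<Rightarrow> real \<Rightarrow> real \<Rightarrow> nat \<Rightarrow> real" where
  "dyadic_energy f a b n = (\<Sum>j<2 ^ n. (slope f a b n j)\<^sup>2 * ((b - a) / 2 ^ n))"

text \<open>Orthogonality of martingale increments: the inner product of two of the step functions is the energy of the
  coarser one.\<close>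

lemma dyadic_slope_products:
  assumes ab: "a < b"
  shows "((\<lambda>y. dyadic_slope f a b n y * dyadic_slope f a b (n + d) y) has_integral dyadic_energy f a b n) {a..b}"
proof -
  have "((\<lambda>y. dyadic_slope f a b n y * dyadic_slope f a b (n + d) y) has_integral
      (\<Sum>j=0..<2 ^ n. slope f a b n j * (f (node a b n (Suc j)) - f (node a b n j)))) {node a b n 0..node a b n (2 ^ n)}"
    by (intro has_integral_cells ab has_integral_dyadic_cell[where \<Phi> = "\<lambda>x. x"] has_integral_finer_dyadic_slope) auto
  also have "(\<Sum>j=0..<2 ^ n. slope f a b n j * (f (node a b n (Suc j)) - f (node a b n j))) = dyadic_energy f a b n"
    unfolding dyadic_energy_def using ab
    by (intro sum.cong) (auto simp: slope_def power2_eq_square)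
  finally show ?thesis by (simp add: node_0 node_top)
qed

lemma dyadic_slope_measurable [measurable]: "dyadic_slope f a b n \<in> borel_measurable borel"
  unfolding dyadic_slope_def[abs_def] by measurable

lemma dyadic_slope_bounded:
  assumes ab: "a < b"
  shows "\<exists>K. \<forall>y\<in>{a..b}. \<bar>dyadic_slope f a b n y\<bar> \<le> K"
proof (intro exI ballI)
  fix y assume y: "y \<in> {a..b}"
  have "(y - a) / (b - a) * 2 ^ n \<le> 1 * 2 ^ n" using y ab by (intro mult_right_mono) (auto simp: field_simps)
  then have "nat \<lfloor>(y - a) / (b - a) * 2 ^ n\<rfloor> \<le> 2 ^ n" by (simp add: nat_le_iff floor_le_iff)
  then have "\<bar>slope f a b n (nat \<lfloor>(y - a) / (b - a) * 2 ^ n\<rfloor>)\<bar> \<le> (\<Sum>j\<le>2 ^ n. \<bar>slope f a b n j\<bar>)"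
    by (intro member_le_sum) auto
  then show "\<bar>dyadic_slope f a b n y\<bar> \<le> (\<Sum>j\<le>2 ^ n. \<bar>slope f a b n j\<bar>)" by (simp add: dyadic_slope_def)
qed

lemma set_integrable_bounded:
  fixes \<phi> :: "real \<Rightarrow> real"
  assumes [measurable]: "\<phi> \<in> borel_measurable borel" and "\<And>y. y \<in> {a..b} \<Longrightarrow> \<bar>\<phi> y\<bar> \<le> K"
  shows "set_integrable lborel {a..b} \<phi>"
  unfolding set_integrable_def
proof (rule Bochner_Integration.integrable_bound)
  show "integrable lborel (\<lambda>y. indicator {a..b} y * K)"
    by (intro integrable_mult_left integrable_real_indicator) (auto simp: emeasure_lborel_Icc_eq)
  show "AE x in lborel. norm (indicat_real {a..b} x *\<^sub>R \<phi> x) \<le> norm (indicat_real {a..b} x * K)"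
    using assms(2) by (auto simp: indicator_def intro: order_trans[OF _ abs_ge_self])
qed auto

lemma finite_measure_restrict_Icc: "finite_measure (restrict_space lborel {a..b::real})"
  by (rule finite_measureI) (simp add: emeasure_restrict_space space_restrict_space emeasure_lborel_Icc_eq)

text \<open>The criterion of F. Riesz for a square-integrable derivative. By orthogonality, the squared distance of two step functions is
  the difference of their energies. These increase and are bounded, hence the step functions converge in mean square, and the limit
  is a derivative of \<open>f\<close> because it has the right integrals between dyadic points.\<close>

lemma riesz_dyadic:
  fixes f :: "real \<Rightarrow> real"
  assumes ab: "a < b" and cont: "continuous_on {a..b} f"
    and bound: "\<And>n. dyadic_energy f a b n \<le> B"
  shows "\<exists>g. g \<in> borel_measurable borel \<and> set_integrable lborel {a..b} g \<and>
     set_integrable lborel {a..b} (\<lambda>s. (g s)\<^sup>2) \<and>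
     (\<forall>x y. a \<le> x \<longrightarrow> x \<le> y \<longrightarrow> y \<le> b \<longrightarrow> f y - f x = integral {x..y} g) \<and>
     integral {a..b} (\<lambda>s. (g s)\<^sup>2) \<le> B \<and>
     (\<lambda>n. LINT s:{a..b}|lborel. (dyadic_slope f a b n s - g s)\<^sup>2) \<longlonglongrightarrow> 0"
proof -
  define M where "M = restrict_space lborel {a..b}"
  interpret finite_measure M unfolding M_def by (rule finite_measure_restrict_Icc)
  define D where "D = dyadic_slope f a b"
  define E where "E = dyadic_energy f a b"
  have Dm[measurable]: "D n \<in> borel_measurable borel" for n by (simp add: D_def)
  have DM[measurable]: "D n \<in> borel_measurable M" for n
    unfolding M_def by (rule measurable_restrict_space1) simp
  have intM: "integrable M \<phi> \<longleftrightarrow> set_integrable lborel {a..b} \<phi>" for \<phi> :: "real \<Rightarrow> real"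
    by (simp add: M_def integrable_restrict_space set_integrable_def)
  have lintM: "(LINT s|M. \<phi> s) = (LINT s:{a..b}|lborel. \<phi> s)" for \<phi> :: "real \<Rightarrow> real"
    by (simp add: M_def integral_restrict_space set_lebesgue_integral_def)
  obtain K where K: "\<And>n y. y \<in> {a..b} \<Longrightarrow> \<bar>D n y\<bar> \<le> K n"
    using dyadic_slope_bounded[OF ab, of f] unfolding D_def by metis
  have DD: "set_integrable lborel {a..b} (\<lambda>s. D n s * D m s)" for n m
  proof (rule set_integrable_bounded[where K = "K n * K m"])
    show "\<bar>D n y * D m y\<bar> \<le> K n * K m" if "y \<in> {a..b}" for y
      unfolding abs_mult by (intro mult_mono K that order_trans[OF abs_ge_zero K[OF that]]) auto
  qed simp
  have DDi: "(LINT s:{a..b}|lborel. D n s * D (n + d) s) = E n" for n d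
    using set_borel_integral_eq_integral(2)[OF DD] dyadic_slope_products[OF ab, of f n d]
    by (simp add: D_def E_def integral_unique)
  have diff: "(LINT s:{a..b}|lborel. (D (n + d) s - D n s)\<^sup>2) = E (n + d) - E n" for n d
  proof -
    have "(LINT s:{a..b}|lborel. (D (n + d) s - D n s)\<^sup>2)
        = (LINT s:{a..b}|lborel. D (n + d) s * D (n + d) s - 2 * (D n s * D (n + d) s) + D n s * D n s)"
      by (simp add: power2_eq_square algebra_simps)
    also have "\<dots> = (LINT s:{a..b}|lborel. D (n + d) s * D (n + d) s - 2 * (D n s * D (n + d) s)) + (LINT s:{a..b}|lborel. D n s * D n s)"
      by (intro set_integral_add(2) set_integral_diff(1) set_integrable_mult_right DD)
    also have "\<dots> = E (n + d) - 2 * E n + E n"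
      using DDi[of "n + d" 0] DDi[of n 0] DDi[of n d]
      by (subst set_integral_diff(2)) (auto intro!: set_integrable_mult_right DD)
    finally show ?thesis by simp
  qed
  have Emono: "E n \<le> E (n + d)" for n d
  proof -
    have "0 \<le> (LINT s:{a..b}|lborel. (D (n + d) s - D n s)\<^sup>2)"
      unfolding set_lebesgue_integral_def by (intro integral_nonneg_AE) auto
    then show ?thesis using diff by simp
  qed
  have "incseq E" using Emono by (auto simp: incseq_def dest: le_Suc_ex)
  moreover have "\<And>n. E n \<le> B" using bound by (simp add: E_def)
  ultimately obtain L where L: "E \<longlonglongrightarrow> L" "\<And>n. E n \<le> L"
    using incseq_convergent[of E B] by metis
  have cauchy: "\<exists>N. \<forall>m\<ge>N. \<forall>n\<ge>N. (LINT x|M. (D m x - D n x)\<^sup>2) \<le> e" if e: "e > 0" for e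
  proof -
    obtain N where N: "\<And>n. n \<ge> N \<Longrightarrow> L - e < E n"
      using order_tendstoD(1)[OF L(1), of "L - e"] e unfolding eventually_sequentially by auto
    have *: "(LINT x|M. (D m x - D n x)\<^sup>2) \<le> e" if "n \<ge> N" "m \<ge> n" for m n
    proof -
      obtain d where "m = n + d" using \<open>m \<ge> n\<close> le_Suc_ex by blast
      then show ?thesis unfolding lintM using diff[of n d] N[OF that(1)] L(2)[of m] by simp
    qed
    have "(LINT x|M. (D m x - D n x)\<^sup>2) \<le> e" if "n \<ge> N" "m \<ge> N" for m n
      using *[of n m] *[of m n] that by (cases "n \<le> m") (auto simp: power2_commute[of "D m _"])
    then show ?thesis by blast
  qed
  have sq: "integrable M (\<lambda>x. (D n x)\<^sup>2)" for n unfolding intM using DD[of n n] by (simp add: power2_eq_square)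
  obtain g0 where g0: "g0 \<in> borel_measurable M" "integrable M (\<lambda>x. (g0 x)\<^sup>2)"
    "(\<lambda>n. LINT x|M. (D n x - g0 x)\<^sup>2) \<longlonglongrightarrow> 0"
    using L2_complete[OF finite_measure_axioms DM sq cauchy] by blast
  define g where "g x = indicator {a..b} x *\<^sub>R g0 x" for x
  have gm[measurable]: "g \<in> borel_measurable borel"
    using g0(1) unfolding M_def g_def[abs_def] by (subst (asm) borel_measurable_restrict_space_iff) auto
  have gM[measurable]: "g \<in> borel_measurable M" unfolding M_def by (rule measurable_restrict_space1) simp
  have geq: "g x = g0 x" if "x \<in> space M" for x using that by (simp add: g_def M_def space_restrict_space)
  have g2: "integrable M (\<lambda>x. (g x)\<^sup>2)" using g0(2) by (subst Bochner_Integration.integrable_cong[OF refl, of _ _ "\<lambda>x. (g0 x)\<^sup>2"]) (auto simp: geq)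
  have lim: "(\<lambda>n. LINT x|M. (D n x - g x)\<^sup>2) \<longlonglongrightarrow> 0"
  proof -
    have "(LINT x|M. (D n x - g x)\<^sup>2) = (LINT x|M. (D n x - g0 x)\<^sup>2)" for n
      by (rule Bochner_Integration.integral_cong) (auto simp: geq)
    with g0(3) show ?thesis by simp
  qed
  have g1: "integrable M g"
  proof (rule Bochner_Integration.integrable_bound)
    show "integrable M (\<lambda>x. 1 + (g x)\<^sup>2)" using g2 by auto
    have "\<bar>z\<bar> \<le> 1 + z\<^sup>2" for z :: real
      using zero_le_power2[of "\<bar>z\<bar> - 1"] by (simp add: power2_diff)
    then show "AE x in M. norm (g x) \<le> norm (1 + (g x)\<^sup>2)" by auto
  qed simp
  have D1: "set_integrable lborel {a..b} (D n)" for n by (rule set_integrable_bounded[of _ a b "K n"]) (auto simp: K)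
  have "(\<lambda>n. LINT x|M. 1 * (D n x)\<^sup>2) \<longlonglongrightarrow> (LINT x|M. 1 * (g x)\<^sup>2)"
    by (rule tendsto_weighted_square_integral[where K = 1, OF DM gM _ sq g2 lim]) auto
  then have "(\<lambda>n. E n) \<longlonglongrightarrow> (LINT x|M. (g x)\<^sup>2)"
    unfolding lintM using DDi[of _ 0] by (simp add: power2_eq_square)
  then have "(LINT x|M. (g x)\<^sup>2) \<le> B"
    using \<open>\<And>n. E n \<le> B\<close> by (intro LIMSEQ_le_const2) auto
  then have gB: "integral {a..b} (\<lambda>s. (g s)\<^sup>2) \<le> B"
    using g2 set_borel_integral_eq_integral(2) unfolding lintM intM by metis
  have gi: "set_integrable lborel {a..b} g" using g1 by (simp add: intM)
  have dm: "set_integrable lborel {a..b} (\<lambda>s. (D n s - g s)\<^sup>2)" for n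
    using integrable_square_diff[OF DM gM sq g2] by (simp add: intM)
  have sub: "set_integrable lborel {x..y} \<phi>" if "a \<le> x" "y \<le> b" "set_integrable lborel {a..b} \<phi>" for x y and \<phi> :: "real \<Rightarrow> real"
    using that by (intro set_integrable_subset[OF that(3)]) auto
  have nodes: "f (node a b n j) - f a = integral {a..node a b n j} g" if j: "j \<le> 2 ^ n" for n j
  proof -
    define y where "y = node a b n j"
    have y: "a \<le> y" "y \<le> b" using node_in[of a b j n] ab j by (auto simp: y_def)
    have "(\<lambda>d. (b - a) * (LINT x|M. (D (n + d) x - g x)\<^sup>2)) \<longlonglongrightarrow> (b - a) * 0"
      using LIMSEQ_ignore_initial_segment[OF lim, of n] by (intro tendsto_intros) (simp add: add.commute)
    moreover have "(f y - f a - integral {a..y} g)\<^sup>2 \<le> (b - a) * (LINT x|M. (D (n + d) x - g x)\<^sup>2)" for d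
    proof -
      have 1: "D (n + d) integrable_on {a..y}" "integral {a..y} (D (n + d)) = f y - f a"
        using has_integral_finer_dyadic_slope[OF ab, of 0 j f n d] by (auto simp: D_def y_def node_0 integral_unique)
      have 2: "g integrable_on {a..y}" using set_borel_integral_eq_integral(1)[OF sub[OF _ y(2) gi]] by auto
      have 3: "(\<lambda>s. (D (n + d) s - g s)\<^sup>2) integrable_on {a..y}" "(\<lambda>s. (D (n + d) s - g s)\<^sup>2) integrable_on {a..b}"
        using set_borel_integral_eq_integral(1)[OF sub[OF _ y(2) dm]] set_borel_integral_eq_integral(1)[OF dm] by auto
      have "f y - f a - integral {a..y} g = integral {a..y} (\<lambda>s. D (n + d) s - g s)"
        using 1 2 by (simp add: Henstock_Kurzweil_Integration.integral_diff)
      then have "(f y - f a - integral {a..y} g)\<^sup>2 \<le> (y - a) * integral {a..y} (\<lambda>s. (D (n + d) s - g s)\<^sup>2)"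
        using square_of_integral_le[OF y(1) Henstock_Kurzweil_Integration.integrable_diff[OF 1(1) 2] 3(1)] by simp
      also have "\<dots> \<le> (b - a) * integral {a..b} (\<lambda>s. (D (n + d) s - g s)\<^sup>2)"
        using y ab 3 by (intro mult_mono integral_subset_le Henstock_Kurzweil_Integration.integral_nonneg) auto
      also have "integral {a..b} (\<lambda>s. (D (n + d) s - g s)\<^sup>2) = (LINT x|M. (D (n + d) x - g x)\<^sup>2)"
        using set_borel_integral_eq_integral(2)[OF dm] by (simp add: lintM)
      finally show ?thesis .
    qed
    ultimately have "(f y - f a - integral {a..y} g)\<^sup>2 \<le> (b - a) * 0"
      by (intro LIMSEQ_le_const) auto
    then show ?thesis by (simp add: y_def)
  qed
  define F where "F y = f y - f a - integral {a..y} g" for y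
  have gint: "g integrable_on {a..b}" using set_borel_integral_eq_integral(1)[OF gi] .
  have contF: "continuous_on {a..b} F" unfolding F_def
    by (intro continuous_intros cont indefinite_integral_continuous_1 gint)
  have F0: "F y = 0" if y: "y \<in> {a..b}" for y
  proof -
    \<comment> \<open>The last node to the left of \<open>y\<close>.\<close>
    define j where "j n = nat \<lfloor>(y - a) / (b - a) * 2 ^ n\<rfloor>" for n
    have j: "j n \<le> 2 ^ n" for n
    proof -
      have "(y - a) / (b - a) * 2 ^ n \<le> 1 * 2 ^ n" using y ab by (intro mult_right_mono) (auto simp: field_simps)
      then show ?thesis by (simp add: nat_le_iff floor_le_iff j_def)
    qed
    have b1: "\<bar>node a b n (j n) - y\<bar> \<le> (b - a) * (1/2) ^ n" for n
    proof -
      define z where "z = (y - a) / (b - a) * 2 ^ n"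
      have "z \<ge> 0" using y ab by (simp add: z_def)
      then have "real (j n) \<le> z" "z \<le> real (j n) + 1" unfolding j_def z_def[symmetric] by linarith+
      then have "\<bar>real (j n) - z\<bar> \<le> 1" by linarith
      moreover have "node a b n (j n) - y = (b - a) * (1/2) ^ n * (real (j n) - z)"
        using ab by (simp add: node_def z_def field_simps power_divide)
      ultimately show ?thesis using ab by (simp add: abs_mult mult_left_le)
    qed
    have "(\<lambda>n. (b - a) * (1/2) ^ n) \<longlonglongrightarrow> (b - a) * 0" by (intro tendsto_intros LIMSEQ_realpow_zero) auto
    then have lim0: "(\<lambda>n. (b - a) * (1/2) ^ n) \<longlonglongrightarrow> 0" by simp
    have "(\<lambda>n. \<bar>node a b n (j n) - y\<bar>) \<longlonglongrightarrow> 0"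
      by (rule tendsto_sandwich[OF always_eventually always_eventually tendsto_const lim0]) (use b1 in auto)
    then have "(\<lambda>n. node a b n (j n)) \<longlonglongrightarrow> y" by (simp add: tendsto_rabs_zero_iff LIM_zero_iff)
    moreover have "node a b n (j n) \<in> {a..b}" for n using node_in[of a b "j n" n] ab j by simp
    ultimately have "(\<lambda>n. F (node a b n (j n))) \<longlonglongrightarrow> F y"
      using contF y by (intro continuous_on_tendsto_compose[OF contF]) auto
    moreover have "F (node a b n (j n)) = 0" for n using nodes[OF j] by (simp add: F_def)
    ultimately show ?thesis by (simp add: LIMSEQ_const_iff)
  qed
  have "f y - f x = integral {x..y} g" if "a \<le> x" "x \<le> y" "y \<le> b" for x y
  proof -
    have "g integrable_on {a..y}" using gint that by (intro integrable_subinterval_real[OF gint]) auto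
    then have "integral {a..x} g + integral {x..y} g = integral {a..y} g"
      using that by (intro Henstock_Kurzweil_Integration.integral_combine) auto
    then show ?thesis using F0[of x] F0[of y] that by (simp add: F_def)
  qed
  then show ?thesis
    using gm gi g2 gB lim by (intro exI[of _ g]) (auto simp: intM lintM D_def)
qed

lemma square_integrable_cell:
  fixes g \<Phi> :: "real \<Rightarrow> real"
  assumes g[measurable]: "g \<in> borel_measurable borel" and sq: "set_integrable lborel {a..b} (\<lambda>s. (g s)\<^sup>2)"
    and \<Phi>[measurable]: "\<Phi> \<in> borel_measurable borel" and le: "\<And>x. \<bar>\<Phi> x\<bar> \<le> x\<^sup>2" and xy: "a \<le> x" "y \<le> b"
  shows "set_integrable lborel {x..y} (\<lambda>s. \<Phi> (g s))" "(\<lambda>s. \<Phi> (g s)) integrable_on {x..y}"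
    "(LINT s:{x..y}|lborel. \<Phi> (g s)) = integral {x..y} (\<lambda>s. \<Phi> (g s))"
proof -
  have "set_integrable lborel {a..b} (\<lambda>s. \<Phi> (g s))"
    unfolding set_integrable_def
    by (rule Bochner_Integration.integrable_bound[OF sq[unfolded set_integrable_def]])
       (simp_all add: indicator_def le)
  then show 1: "set_integrable lborel {x..y} (\<lambda>s. \<Phi> (g s))"
    by (rule set_integrable_subset) (use xy in auto)
  show "(\<lambda>s. \<Phi> (g s)) integrable_on {x..y}" "(LINT s:{x..y}|lborel. \<Phi> (g s)) = integral {x..y} (\<lambda>s. \<Phi> (g s))"
    using set_borel_integral_eq_integral[OF 1] by auto
qed

text \<open>The one-sided form of the inequality of Cauchy and Schwarz. It rests on \<open>2 c r - c\<^sup>2 \<le> (r\<^sup>-)\<^sup>2\<close> for \<open>c \<le> 0\<close>, with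
  equality for \<open>r = c\<close>.\<close>

lemma neg_part_square_of_integral_le:
  fixes r :: "real \<Rightarrow> real"
  assumes "x \<le> y" "r integrable_on {x..y}" "(\<lambda>s. (max (- r s) 0)\<^sup>2) integrable_on {x..y}"
  shows "(max (- integral {x..y} r) 0)\<^sup>2 / (y - x) \<le> integral {x..y} (\<lambda>s. (max (- r s) 0)\<^sup>2)"
proof (cases "x = y")
  case False
  define h where "h = y - x"
  have h: "h > 0" using False assms(1) by (simp add: h_def)
  define n where "n = max (- integral {x..y} r) 0"
  \<comment> \<open>The value of \<open>c\<close> for which the tangent to the convex function \<open>(r\<^sup>-)\<^sup>2\<close> is optimal.\<close>
  define c where "c = - n / h"
  have c: "c \<le> 0" using h by (simp add: c_def n_def)
  have n: "n * integral {x..y} r = - n\<^sup>2" by (simp add: n_def max_def power2_eq_square)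
  have "integral {x..y} (\<lambda>s. 2 * c * r s - c\<^sup>2) \<le> integral {x..y} (\<lambda>s. (max (- r s) 0)\<^sup>2)"
  proof (rule Henstock_Kurzweil_Integration.integral_le)
    show "(\<lambda>s. 2 * c * r s - c\<^sup>2) integrable_on {x..y}"
      using assms(2) by (intro Henstock_Kurzweil_Integration.integrable_diff integrable_on_mult_right integrable_const_ivl)
    show "2 * c * r s - c\<^sup>2 \<le> (max (- r s) 0)\<^sup>2" for s
    proof (cases "r s \<le> 0")
      case True
      then show ?thesis using zero_le_power2[of "r s - c"] by (simp add: max_def power2_diff algebra_simps)
    next
      case False
      then have "c * r s \<le> 0" using c by (simp add: mult_le_0_iff)
      moreover have "2 * c * r s = 2 * (c * r s)" by simp
      ultimately have "2 * c * r s - c\<^sup>2 \<le> 0" using zero_le_power2[of c] by linarith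
      then show ?thesis using False by (simp add: max_def)
    qed
  qed fact
  also have "integral {x..y} (\<lambda>s. 2 * c * r s - c\<^sup>2) = 2 * c * integral {x..y} r - c\<^sup>2 * h"
    using assms(1,2) by (subst Henstock_Kurzweil_Integration.integral_diff) (auto intro: integrable_on_mult_right simp: h_def)
  also have "\<dots> = n\<^sup>2 / h"
  proof -
    have "2 * c * integral {x..y} r = - 2 / h * (n * integral {x..y} r)" by (simp add: c_def)
    then have "2 * c * integral {x..y} r - c\<^sup>2 * h = 2 * n\<^sup>2 / h - (n / h)\<^sup>2 * h"
      unfolding n by (simp add: c_def)
    also have "\<dots> = n\<^sup>2 / h" using h by (simp add: power2_eq_square)
    finally show ?thesis .
  qed
  finally show ?thesis by (simp add: h_def n_def)
qed simp

lemma integral_cells: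
  fixes \<phi> :: "real \<Rightarrow> real"
  assumes "a < b" "\<phi> integrable_on {a..b}"
  shows "(\<Sum>j<2 ^ n. integral {node a b n j..node a b n (Suc j)} \<phi>) = integral {a..b} \<phi>"
proof -
  have "(\<phi> has_integral (\<Sum>j=0..<2 ^ n. integral {node a b n j..node a b n (Suc j)} \<phi>)) {node a b n 0..node a b n (2 ^ n)}"
  proof (rule has_integral_cells)
    fix j :: nat assume j: "j < 2 ^ n"
    show "(\<phi> has_integral integral {node a b n j..node a b n (Suc j)} \<phi>) {node a b n j..node a b n (Suc j)}"
      using node_in[of a b j n] node_in[of a b "Suc j" n] assms j
      by (intro integrable_integral integrable_subinterval_real[OF assms(2)]) auto
  qed (use assms in auto)
  then show ?thesis by (simp add: node_0 node_top integral_unique atLeast0LessThan)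
qed

lemma dyadic_energy_le:
  assumes ab: "a < b" and prim: "is_primitive f g" and sq: "set_integrable lborel {a..b} (\<lambda>s. (g s)\<^sup>2)"
  shows "dyadic_energy f a b n \<le> integral {a..b} (\<lambda>s. (g s)\<^sup>2)"
proof -
  have li: "locally_integrable g" using prim by (simp add: is_primitive_def)
  have gm: "g \<in> borel_measurable borel" using li by (rule locally_integrable_measurable)
  have i2: "(\<lambda>s. (g s)\<^sup>2) integrable_on {x..y}" if "a \<le> x" "y \<le> b" for x y
    by (rule square_integrable_cell(2)[OF gm sq _ _ that, of "\<lambda>x. x\<^sup>2"]) auto
  define h where "h = (b - a) / 2 ^ n"
  have h: "h > 0" using ab by (simp add: h_def)
  have "dyadic_energy f a b n \<le> (\<Sum>j<2 ^ n. integral {node a b n j..node a b n (Suc j)} (\<lambda>s. (g s)\<^sup>2))"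
    unfolding dyadic_energy_def
  proof (rule sum_mono)
    fix j :: nat assume "j \<in> {..<2 ^ n}"
    then have j: "node a b n j \<in> {a..b}" "node a b n (Suc j) \<in> {a..b}" using node_in[of a b j n] node_in[of a b "Suc j" n] ab by auto
    define d where "d = f (node a b n (Suc j)) - f (node a b n j)"
    have "d = integral {node a b n j..node a b n (Suc j)} g"
      unfolding d_def using prim node_mono[of a b j "Suc j" n] ab by (simp add: is_primitive_def)
    then have "d\<^sup>2 \<le> h * integral {node a b n j..node a b n (Suc j)} (\<lambda>s. (g s)\<^sup>2)"
      using square_of_integral_le[of "node a b n j" "node a b n (Suc j)" g] ab locally_integrableD(2)[OF li] i2 j
      by (auto simp: node_Suc h_def)
    then have "d\<^sup>2 / h \<le> integral {node a b n j..node a b n (Suc j)} (\<lambda>s. (g s)\<^sup>2)"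
      using h by (simp add: divide_le_eq mult.commute)
    moreover have "(slope f a b n j)\<^sup>2 * ((b - a) / 2 ^ n) = d\<^sup>2 / h"
      using h by (simp add: slope_def d_def h_def[symmetric] power2_eq_square)
    ultimately show "(slope f a b n j)\<^sup>2 * ((b - a) / 2 ^ n) \<le> integral {node a b n j..node a b n (Suc j)} (\<lambda>s. (g s)\<^sup>2)"
      by simp
  qed
  also have "\<dots> = integral {a..b} (\<lambda>s. (g s)\<^sup>2)" by (rule integral_cells[OF ab i2]) auto
  finally show ?thesis .
qed

text \<open>The limit that the criterion of Riesz produces has the same integrals over intervals as \<open>g\<close>.\<close>

lemma dyadic_slope_converges:
  assumes ab: "a < b" and prim: "is_primitive f g" and sq: "set_integrable lborel {a..b} (\<lambda>s. (g s)\<^sup>2)"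
  shows "(\<lambda>n. LINT s:{a..b}|lborel. (dyadic_slope f a b n s - g s)\<^sup>2) \<longlonglongrightarrow> 0"
proof -
  have li: "locally_integrable g" using prim by (simp add: is_primitive_def)
  have gm[measurable]: "g \<in> borel_measurable borel" using li by (rule locally_integrable_measurable)
  have cont: "continuous_on {a..b} f" using is_primitive_continuous[OF prim] by (rule continuous_on_subset) auto
  obtain g' where g': "g' \<in> borel_measurable borel" "set_integrable lborel {a..b} g'"
     "\<And>x y. a \<le> x \<Longrightarrow> x \<le> y \<Longrightarrow> y \<le> b \<Longrightarrow> f y - f x = integral {x..y} g'"
     "(\<lambda>n. LINT s:{a..b}|lborel. (dyadic_slope f a b n s - g' s)\<^sup>2) \<longlonglongrightarrow> 0"
    using riesz_dyadic[OF ab cont dyadic_energy_le[OF ab prim sq]] by blast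
  note g'(1)[measurable]
  have "AE x in lborel. x \<in> {a..b} \<longrightarrow> g x = g' x"
    by (rule interval_integrals_determine_function[OF locally_integrableD(1)[OF li] g'(2)])
       (use g'(3) prim in \<open>auto simp: is_primitive_def\<close>)
  then have "(LINT s:{a..b}|lborel. (dyadic_slope f a b n s - g' s)\<^sup>2) = (LINT s:{a..b}|lborel. (dyadic_slope f a b n s - g s)\<^sup>2)" for n
    unfolding set_lebesgue_integral_def
    by (intro integral_cong_AE) (auto simp: indicator_def elim!: eventually_mono)
  with g'(4) show ?thesis by simp
qed

text \<open>The sums of \<open>(q\<^sup>-)\<^sup>2 / h\<close> over dyadic partitions exhaust the energy of the negative part of \<open>g\<close>, since taking negative
  parts is a contraction.\<close>

lemma neg_slope_energy_converges:
  assumes ab: "a < b" and prim: "is_primitive f g" and sq: "set_integrable lborel {a..b} (\<lambda>s. (g s)\<^sup>2)"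
  shows "(\<lambda>n. \<Sum>j<2 ^ n. (max (- slope f a b n j) 0)\<^sup>2 * ((b - a) / 2 ^ n)) \<longlonglongrightarrow>
     integral {a..b} (\<lambda>s. (max (- g s) 0)\<^sup>2)"
proof -
  have li: "locally_integrable g" using prim by (simp add: is_primitive_def)
  have gm[measurable]: "g \<in> borel_measurable borel" using li by (rule locally_integrable_measurable)
  define N :: "real \<Rightarrow> real" where "N x = max (- x) 0" for x
  have Nm[measurable]: "N \<in> borel_measurable borel" unfolding N_def[abs_def] by measurable
  have N2: "\<bar>(N x)\<^sup>2\<bar> \<le> x\<^sup>2" for x by (simp add: N_def max_def)
  have N2m: "(\<lambda>x. (N x)\<^sup>2) \<in> borel_measurable borel" by measurable
  have NL: "(N x - N y)\<^sup>2 \<le> (x - y)\<^sup>2" for x y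
    by (subst abs_le_square_iff[symmetric]) (auto simp: N_def max_def abs_minus_commute)
  define D where "D n s = dyadic_slope f a b n s" for n s
  have Dm[measurable]: "D n \<in> borel_measurable borel" for n unfolding D_def[abs_def] by measurable
  define M where "M = restrict_space lborel {a..b}"
  have intM: "integrable M \<phi> \<longleftrightarrow> set_integrable lborel {a..b} \<phi>" for \<phi> :: "real \<Rightarrow> real"
    by (simp add: M_def integrable_restrict_space set_integrable_def)
  have lintM: "(LINT s|M. \<phi> s) = (LINT s:{a..b}|lborel. \<phi> s)" for \<phi> :: "real \<Rightarrow> real"
    by (simp add: M_def integral_restrict_space set_lebesgue_integral_def)
  have mM: "\<phi> \<in> borel_measurable M" if "\<phi> \<in> borel_measurable borel" for \<phi> :: "real \<Rightarrow> real"
    unfolding M_def using that by (intro measurable_restrict_space1) simp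
  have Dsq: "set_integrable lborel {a..b} (\<lambda>s. (D n s)\<^sup>2)" for n
  proof -
    obtain K where K: "\<And>y. y \<in> {a..b} \<Longrightarrow> \<bar>D n y\<bar> \<le> K"
      using dyadic_slope_bounded[OF ab, of f n] unfolding D_def by metis
    show ?thesis
    proof (rule set_integrable_bounded[where K = "K\<^sup>2"])
      show "\<bar>(D n y)\<^sup>2\<bar> \<le> K\<^sup>2" if "y \<in> {a..b}" for y
        using power_mono[OF K[OF that] abs_ge_zero, of 2] by simp
    qed measurable
  qed
  have NDsq: "set_integrable lborel {a..b} (\<lambda>s. (N (D n s))\<^sup>2)" for n
    by (rule square_integrable_cell(1)[OF Dm Dsq N2m N2 order_refl order_refl])
  have Nsq: "set_integrable lborel {a..b} (\<lambda>s. (N (g s))\<^sup>2)"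
    by (rule square_integrable_cell(1)[OF gm sq N2m N2 order_refl order_refl])
  have NDM: "(\<lambda>s. N (D n s)) \<in> borel_measurable M" and NgM: "(\<lambda>s. N (g s)) \<in> borel_measurable M"
    and DM: "D n \<in> borel_measurable M" and gM: "g \<in> borel_measurable M" for n
    by (intro mM; measurable)+
  have lim: "(\<lambda>n. LINT s|M. (N (D n s) - N (g s))\<^sup>2) \<longlonglongrightarrow> 0"
  proof (rule tendsto_sandwich[OF always_eventually always_eventually tendsto_const])
    show "(\<lambda>n. LINT s|M. (D n s - g s)\<^sup>2) \<longlonglongrightarrow> 0"
      unfolding lintM D_def by (rule dyadic_slope_converges[OF ab prim sq])
    show "\<forall>n. (LINT s|M. (N (D n s) - N (g s))\<^sup>2) \<le> (LINT s|M. (D n s - g s)\<^sup>2)"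
    proof (intro allI integral_mono NL)
      fix n
      show "integrable M (\<lambda>s. (N (D n s) - N (g s))\<^sup>2)"
        by (rule integrable_square_diff[OF NDM NgM]) (use NDsq Nsq in \<open>simp_all add: intM\<close>)
      show "integrable M (\<lambda>s. (D n s - g s)\<^sup>2)"
        by (rule integrable_square_diff[OF DM gM]) (use Dsq sq in \<open>simp_all add: intM\<close>)
    qed
  qed auto
  have "(\<lambda>n. LINT s|M. 1 * (N (D n s))\<^sup>2) \<longlonglongrightarrow> (LINT s|M. 1 * (N (g s))\<^sup>2)"
    by (rule tendsto_weighted_square_integral[where K = 1, OF NDM NgM _ _ _ lim])
       (use NDsq Nsq in \<open>simp_all add: intM\<close>)
  moreover have "(LINT s|M. (N (g s))\<^sup>2) = integral {a..b} (\<lambda>s. (max (- g s) 0)\<^sup>2)"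
    unfolding lintM using set_borel_integral_eq_integral(2)[OF Nsq] by (simp add: N_def)
  moreover have "(LINT s|M. (N (D n s))\<^sup>2) = (\<Sum>j<2 ^ n. (max (- slope f a b n j) 0)\<^sup>2 * ((b - a) / 2 ^ n))" for n
    unfolding lintM using set_borel_integral_eq_integral(2)[OF NDsq[of n]]
      has_integral_dyadic_slope[OF ab, of 0 "2 ^ n" "\<lambda>x. (N x)\<^sup>2" f n]
    by (simp add: node_0 node_top D_def N_def integral_unique atLeast0LessThan)
  ultimately show ?thesis by simp
qed

section \<open>Curves of a flow and the growth of the velocity gap\<close>

lemma integral_right_derivative:
  fixes g :: "real \<Rightarrow> real"
  assumes "continuous_on {a..b} g" "a \<le> t" "t < b"
  shows "((\<lambda>s. integral {t..s} g) has_real_derivative g t) (at_right t)"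
proof -
  have "((\<lambda>s. integral {t..s} g) has_real_derivative g t) (at t within {t..b})"
    by (rule integral_has_real_derivative[OF continuous_on_subset[OF assms(1)]]) (use assms in auto)
  then show ?thesis using assms by (simp add: at_within_Icc_at_right)
qed

lemma window_integral_derivative:
  fixes p :: "real \<Rightarrow> real"
  assumes p: "continuous_on UNIV p" and \<epsilon>: "\<epsilon> \<ge> 0"
  shows "((\<lambda>z. integral {z..z + \<epsilon>} p) has_real_derivative p (z + \<epsilon>) - p z) (at z)"
proof -
  have pc: "continuous_on S p" for S using p by (rule continuous_on_subset) simp
  define L where "L = z - 1"
  define U where "U y = integral {L..y} p" for y
  have U: "(U has_real_derivative p y) (at y)" if "y \<ge> z" for y
  proof -
    have "(U has_real_derivative p y) (at y within {L..y + 1})"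
      unfolding U_def by (rule integral_has_real_derivative[OF pc]) (use that in \<open>auto simp: L_def\<close>)
    then show ?thesis using that at_within_Icc_at[of L y "y + 1"] by (simp add: L_def)
  qed
  have "((\<lambda>z. U (z + \<epsilon>) - U z) has_real_derivative p (z + \<epsilon>) * 1 - p z) (at z)"
    by (rule DERIV_diff[OF DERIV_chain2[OF U] U]) (use \<epsilon> in \<open>auto intro!: derivative_eq_intros\<close>)
  moreover have "\<forall>\<^sub>F y in nhds z. integral {y..y + \<epsilon>} p = U (y + \<epsilon>) - U y"
  proof (rule eventually_mono[OF eventually_nhds_in_open[of "{L<..}" z]])
    fix y assume "y \<in> {L<..}"
    then show "integral {y..y + \<epsilon>} p = U (y + \<epsilon>) - U y"
      using Henstock_Kurzweil_Integration.integral_combine[of L y "y + \<epsilon>" p] \<epsilon> integrable_continuous_real[OF pc]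
      unfolding U_def by fastforce
  qed (auto simp: L_def)
  ultimately show ?thesis by (subst DERIV_cong_ev[OF refl _ refl]) auto
qed

lemma average_tendsto:
  fixes p :: "real \<Rightarrow> real"
  assumes p: "continuous_on {z..z + 1} p"
  shows "(\<lambda>n. real (Suc n) * integral {z..z + 1 / real (Suc n)} p) \<longlonglongrightarrow> p z"
proof -
  have "((\<lambda>s. integral {z..s} p) has_real_derivative p z) (at_right z)"
    by (rule integral_right_derivative[OF p]) auto
  then have "((\<lambda>s. integral {z..s} p / (s - z)) \<longlongrightarrow> p z) (at_right z)"
    by (simp add: has_field_derivative_iff)
  moreover have "filterlim (\<lambda>n. z + 1 / real (Suc n)) (at_right z) sequentially"
  proof (rule tendsto_imp_filterlim_at_right)
    have "(\<lambda>n. z + 1 / real (Suc n)) \<longlonglongrightarrow> z + 0" by (intro tendsto_intros LIMSEQ_Suc[OF lim_1_over_n])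
    then show "(\<lambda>n. z + 1 / real (Suc n)) \<longlonglongrightarrow> z" by simp
  qed auto
  ultimately have "(\<lambda>n. integral {z..z + 1 / real (Suc n)} p / (z + 1 / real (Suc n) - z)) \<longlonglongrightarrow> p z"
    by (rule filterlim_compose)
  then show ?thesis by (simp add: mult.commute)
qed

lemma neg_part_square_deriv:
  "((\<lambda>x::real. (max (- x) 0)\<^sup>2) has_real_derivative - 2 * max (- x) 0) (at x)"
proof (cases x "0::real" rule: linorder_cases)
  case less
  have "((\<lambda>x::real. x\<^sup>2) has_real_derivative 2 * x) (at x)" by (auto intro!: derivative_eq_intros)
  moreover have "\<forall>\<^sub>F y in nhds x. (max (- y) 0)\<^sup>2 = y\<^sup>2"
    by (rule eventually_mono[OF eventually_nhds_in_open[of "{..<0}" x]]) (use less in auto)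
  ultimately show ?thesis using less by (subst DERIV_cong_ev[OF refl, of _ "\<lambda>x. x\<^sup>2"]) auto
next
  case greater
  have "((\<lambda>x::real. 0) has_real_derivative 0) (at x)" by simp
  moreover have "\<forall>\<^sub>F y in nhds x. (max (- y) 0)\<^sup>2 = (0::real)"
    by (rule eventually_mono[OF eventually_nhds_in_open[of "{0<..}" x]]) (use greater in auto)
  ultimately show ?thesis using greater by (subst DERIV_cong_ev[OF refl, of _ "\<lambda>x. 0"]) auto
next
  case equal
  have "((\<lambda>y::real. (max (- y) 0)\<^sup>2 / y) \<longlongrightarrow> 0) (at 0)"
  proof (rule tendsto_rabs_zero_cancel, rule tendsto_sandwich[OF always_eventually always_eventually tendsto_const])
    show "((\<lambda>y::real. \<bar>y\<bar>) \<longlongrightarrow> 0) (at 0)" by (rule tendsto_eq_intros) auto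
    show "\<forall>y::real. \<bar>(max (- y) 0)\<^sup>2 / y\<bar> \<le> \<bar>y\<bar>" by (auto simp: max_def power2_eq_square)
  qed auto
  then show ?thesis using equal by (simp add: has_field_derivative_iff)
qed

definition window_gap :: "real \<Rightarrow> (real \<Rightarrow> real) \<Rightarrow> real \<Rightarrow> real \<Rightarrow> real" where
  "window_gap \<epsilon> p x z = integral {z..z + \<epsilon>} p - integral {x..x + \<epsilon>} p"

text \<open>A lower bound for the growth of the window gap of a solution with profile \<open>p\<close>: the integral comes from the
  sources in the two windows, the other terms are the flux \<open>p\<^sup>2 / 2\<close> through their ends.\<close>

definition window_rate :: "real \<Rightarrow> real \<Rightarrow> (real \<Rightarrow> real) \<Rightarrow> real \<Rightarrow> real \<Rightarrow> real" where
  "window_rate C \<epsilon> p x z =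
     integral {0..\<epsilon>} (\<lambda>r. (p (z + r) - p (x + r))\<^sup>2 / (2 * (z - x)) - C * (z - x))
       - ((p (z + \<epsilon>))\<^sup>2 - (p z)\<^sup>2) / 2 + ((p (x + \<epsilon>))\<^sup>2 - (p x)\<^sup>2) / 2"

text \<open>What the proof retains of a weak solution \<open>w\<close> with \<open>v = w\<^sub>x\<close> on the time interval \<open>[0, T]\<close>. The last assumption is
  the balance law for the integrals of \<open>w\<close> over two fixed windows, with the difference of the sources replaced by
  its lower bound. Every term of the rate is quadratic in \<open>w\<close> or constant, so that the assumptions are invariant under \<open>w(t, x) \<mapsto> -w(T - t, x)\<close>.\<close>

locale CH_flow =
  fixes T C B :: real and w v :: "real \<Rightarrow> real \<Rightarrow> real"
  assumes w_cont: "continuous_on ({0..T} \<times> UNIV) (\<lambda>(t, x). w t x)"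
    and w_prim: "\<And>t. t \<in> {0..T} \<Longrightarrow> is_primitive (w t) (v t)"
    and v_sq: "\<And>t. t \<in> {0..T} \<Longrightarrow> integrable lborel (\<lambda>x. (v t x)\<^sup>2)"
    and v_energy: "\<And>t. t \<in> {0..T} \<Longrightarrow> (LINT x|lborel. (v t x)\<^sup>2) \<le> B"
    and C_nonneg: "0 \<le> C"
    and windows: "\<And>\<sigma> \<tau> x z \<epsilon>. \<lbrakk>0 \<le> \<sigma>; \<sigma> \<le> \<tau>; \<tau> \<le> T; x < z; 0 < \<epsilon>\<rbrakk> \<Longrightarrow>
      integral {\<sigma>..\<tau>} (\<lambda>t. window_rate C \<epsilon> (w t) x z) \<le> window_gap \<epsilon> (w \<tau>) x z - window_gap \<epsilon> (w \<sigma>) x z"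
begin

definition curve :: "real \<Rightarrow> real \<Rightarrow> (real \<Rightarrow> real) \<Rightarrow> bool" where
  "curve a b \<zeta> \<longleftrightarrow> (\<forall>t\<in>{a..b}. (\<zeta> has_real_derivative w t (\<zeta> t)) (at t within {a..b}))"

lemma curve_continuous: "curve a b \<zeta> \<Longrightarrow> continuous_on {a..b} \<zeta>"
  unfolding curve_def continuous_on_eq_continuous_within using DERIV_continuous by blast

lemma curve_subinterval: "curve a b \<zeta> \<Longrightarrow> a \<le> c \<Longrightarrow> d \<le> b \<Longrightarrow> curve c d \<zeta>"
  unfolding curve_def by (meson DERIV_subset atLeastAtMost_iff atLeastatMost_subset_iff order_trans)

lemma curve_right_derivative:
  assumes "curve a b \<zeta>" "a \<le> t" "t < b"
  shows "(\<zeta> has_real_derivative w t (\<zeta> t)) (at_right t)"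
proof -
  have "(\<zeta> has_real_derivative w t (\<zeta> t)) (at t within {t..b})"
    by (rule DERIV_subset[of \<zeta> _ t "{a..b}"]) (use assms in \<open>simp_all add: curve_def\<close>)
  then show ?thesis using assms(3) by (simp add: at_within_Icc_at_right)
qed

lemma w_space_continuous: "t \<in> {0..T} \<Longrightarrow> continuous_on S (w t)"
  by (rule continuous_on_subset[OF is_primitive_continuous[OF w_prim]]) auto

lemma w_compose_continuous:
  assumes "continuous_on S f" "continuous_on S g" "\<And>p. p \<in> S \<Longrightarrow> f p \<in> {0..T}"
  shows "continuous_on S (\<lambda>p. w (f p) (g p))"
proof -
  have "continuous_on S (\<lambda>p. (\<lambda>(t, x). w t x) (f p, g p))"
    by (rule continuous_on_compose2[OF w_cont continuous_on_Pair[OF assms(1,2)]]) (use assms(3) in blast)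
  then show ?thesis by simp
qed

lemma gap_rate_continuous:
  assumes xz: "continuous_on {a..b} x" "continuous_on {a..b} z" "\<And>t. t \<in> {a..b} \<Longrightarrow> x t < z t"
    and ab: "0 \<le> a" "b \<le> T"
  shows "continuous_on ({a..b} \<times> {0..\<epsilon>}) (\<lambda>(t, r). (w t (z t + r) - w t (x t + r))\<^sup>2 / (2 * (z t - x t)) - C * (z t - x t))"
proof -
  have z: "continuous_on ({a..b} \<times> {0..\<epsilon>}) (\<lambda>p. z (fst p))" "continuous_on ({a..b} \<times> {0..\<epsilon>}) (\<lambda>p. x (fst p))"
    by (auto intro!: continuous_on_compose2[OF xz(1)] continuous_on_compose2[OF xz(2)] continuous_on_fst continuous_on_id)
  show ?thesis unfolding case_prod_beta
    by (intro continuous_intros w_compose_continuous z) (use ab xz(3) in force)+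
qed

lemma window_rate_continuous:
  assumes "continuous_on {a..b} x" "continuous_on {a..b} z" "\<And>t. t \<in> {a..b} \<Longrightarrow> x t < z t"
    and "0 \<le> a" "b \<le> T"
  shows "continuous_on {a..b} (\<lambda>t. integral {0..\<epsilon>} (\<lambda>r. (w t (z t + r) - w t (x t + r))\<^sup>2 / (2 * (z t - x t)) - C * (z t - x t)))"
  using integral_continuous_on_param[of "{a..b}" 0 \<epsilon> "\<lambda>t r. (w t (z t + r) - w t (x t + r))\<^sup>2 / (2 * (z t - x t)) - C * (z t - x t)"]
    gap_rate_continuous[OF assms] by simp

text \<open>The derivative of a window integral that is due to the motion of the window alone. The mean value theorem in space avoids
  any differentiability of \<open>w\<close> in time.\<close>

lemma moving_endpoint:
  assumes c: "curve a b \<zeta>" and ab: "0 \<le> a" "b \<le> T" and t: "a \<le> t" "t < b" and \<epsilon>: "\<epsilon> > 0"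
  shows "((\<lambda>s. integral {\<zeta> s..\<zeta> s + \<epsilon>} (w s) - integral {\<zeta> t..\<zeta> t + \<epsilon>} (w s)) has_real_derivative
     (w t (\<zeta> t + \<epsilon>) - w t (\<zeta> t)) * w t (\<zeta> t)) (at_right t)"
proof -
  define W where "W s z = integral {z..z + \<epsilon>} (w s)" for s z
  have "\<exists>\<xi>. \<bar>\<xi> - \<zeta> t\<bar> \<le> \<bar>\<zeta> s - \<zeta> t\<bar> \<and> W s (\<zeta> s) - W s (\<zeta> t) = (\<zeta> s - \<zeta> t) * (w s (\<xi> + \<epsilon>) - w s \<xi>)"
    if s: "s \<in> {t..b}" for s
  proof -
    have d: "((\<lambda>z. W s z) has_real_derivative w s (z + \<epsilon>) - w s z) (at z)" for z
      unfolding W_def by (rule window_integral_derivative[OF w_space_continuous]) (use s t ab \<epsilon> in auto)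
    show ?thesis
    proof (cases "\<zeta> s" "\<zeta> t" rule: linorder_cases)
      case less
      from MVT2[OF less d] obtain \<xi> where "\<xi> > \<zeta> s" "\<xi> < \<zeta> t" "W s (\<zeta> t) - W s (\<zeta> s) = (\<zeta> t - \<zeta> s) * (w s (\<xi> + \<epsilon>) - w s \<xi>)" by blast
      then show ?thesis by (intro exI[of _ \<xi>]) (auto simp: algebra_simps)
    next
      case greater
      from MVT2[OF greater d] obtain \<xi> where "\<xi> < \<zeta> s" "\<xi> > \<zeta> t" "W s (\<zeta> s) - W s (\<zeta> t) = (\<zeta> s - \<zeta> t) * (w s (\<xi> + \<epsilon>) - w s \<xi>)" by blast
      then show ?thesis by (intro exI[of _ \<xi>]) auto
    qed (auto intro!: exI[of _ "\<zeta> t"])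
  qed
  then obtain \<xi> where \<xi>: "\<And>s. s \<in> {t..b} \<Longrightarrow> \<bar>\<xi> s - \<zeta> t\<bar> \<le> \<bar>\<zeta> s - \<zeta> t\<bar>"
    "\<And>s. s \<in> {t..b} \<Longrightarrow> W s (\<zeta> s) - W s (\<zeta> t) = (\<zeta> s - \<zeta> t) * (w s (\<xi> s + \<epsilon>) - w s (\<xi> s))" by metis
  have ev: "\<forall>\<^sub>F s in at_right t. s \<in> {t<..<b}" using t(2) by (rule eventually_at_right_real)
  have z: "(\<zeta> has_real_derivative w t (\<zeta> t)) (at_right t)" by (rule curve_right_derivative[OF c t])
  then have "(\<zeta> \<longlongrightarrow> \<zeta> t) (at_right t)" by (metis DERIV_continuous continuous_within)
  then have lz: "((\<lambda>s. \<bar>\<zeta> s - \<zeta> t\<bar>) \<longlongrightarrow> 0) (at_right t)" by (simp add: LIM_zero_iff tendsto_rabs_zero_iff)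
  have "((\<lambda>s. \<bar>\<xi> s - \<zeta> t\<bar>) \<longlongrightarrow> 0) (at_right t)"
    by (rule tendsto_sandwich[OF _ _ tendsto_const lz]) (use \<xi>(1) in \<open>auto intro!: eventually_mono[OF ev]\<close>)
  then have l\<xi>: "(\<xi> \<longlongrightarrow> \<zeta> t) (at_right t)" by (simp add: LIM_zero_iff tendsto_rabs_zero_iff)
  have lw: "((\<lambda>s. w s (c s)) \<longlongrightarrow> w t l) (at_right t)" if "(c \<longlongrightarrow> l) (at_right t)" for c l
  proof -
    have "((\<lambda>s. (s, c s)) \<longlongrightarrow> (t, l)) (at_right t)" by (intro tendsto_intros that)
    then have "((\<lambda>s. (\<lambda>(t, x). w t x) (s, c s)) \<longlongrightarrow> (\<lambda>(t, x). w t x) (t, l)) (at_right t)"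
      by (rule continuous_on_tendsto_compose[OF w_cont]) (use t ab in \<open>auto intro!: eventually_mono[OF ev]\<close>)
    then show ?thesis by simp
  qed
  have "((\<lambda>s. (\<zeta> s - \<zeta> t) / (s - t) * (w s (\<xi> s + \<epsilon>) - w s (\<xi> s))) \<longlongrightarrow> w t (\<zeta> t) * (w t (\<zeta> t + \<epsilon>) - w t (\<zeta> t))) (at_right t)"
    using z by (intro tendsto_intros lw l\<xi>) (simp add: has_field_derivative_iff)
  then have "((\<lambda>s. (W s (\<zeta> s) - W s (\<zeta> t)) / (s - t)) \<longlongrightarrow> (w t (\<zeta> t + \<epsilon>) - w t (\<zeta> t)) * w t (\<zeta> t)) (at_right t)"
    unfolding mult.commute[of "w t (\<zeta> t)"]
    by (rule Lim_transform_eventually) (use \<xi>(2) in \<open>auto intro!: eventually_mono[OF ev]\<close>)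
  then show ?thesis by (simp add: has_field_derivative_iff W_def)
qed

text \<open>If the windows move with the flow, transport and flux combine to
  \<open>(w(\<zeta> + \<epsilon>) - w(\<zeta>)) w(\<zeta>) - 1/2 (w(\<zeta> + \<epsilon>)\<^sup>2 - w(\<zeta>)\<^sup>2) = - 1/2 (w(\<zeta> + \<epsilon>) - w(\<zeta>))\<^sup>2\<close>, which is small of higher order in \<open>\<epsilon>\<close>.\<close>

lemma moving_windows:
  assumes ab: "0 \<le> a" "a \<le> b" "b \<le> T" and c: "curve a b \<eta>" "curve a b \<zeta>"
    and lt: "\<And>t. t \<in> {a..b} \<Longrightarrow> \<eta> t < \<zeta> t" and \<epsilon>: "\<epsilon> > 0"
  shows "integral {a..b} (\<lambda>t. integral {0..\<epsilon>} (\<lambda>r. (w t (\<zeta> t + r) - w t (\<eta> t + r))\<^sup>2 / (2 * (\<zeta> t - \<eta> t)) - C * (\<zeta> t - \<eta> t))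
        - (w t (\<zeta> t + \<epsilon>) - w t (\<zeta> t))\<^sup>2 / 2 + (w t (\<eta> t + \<epsilon>) - w t (\<eta> t))\<^sup>2 / 2)
    \<le> (integral {\<zeta> b..\<zeta> b + \<epsilon>} (w b) - integral {\<eta> b..\<eta> b + \<epsilon>} (w b))
      - (integral {\<zeta> a..\<zeta> a + \<epsilon>} (w a) - integral {\<eta> a..\<eta> a + \<epsilon>} (w a))"
proof -
  define W where "W s z = integral {z..z + \<epsilon>} (w s)" for s z
  define J where "J s = W s (\<zeta> s) - W s (\<eta> s)" for s
  define A where "A x z t = integral {0..\<epsilon>} (\<lambda>r. (w t (z + r) - w t (x + r))\<^sup>2 / (2 * (z - x)) - C * (z - x))" for x z t
  define R where "R x z t = A x z t - ((w t (z + \<epsilon>))\<^sup>2 - (w t z)\<^sup>2) / 2 + ((w t (x + \<epsilon>))\<^sup>2 - (w t x)\<^sup>2) / 2" for x z t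
  define G where "G t = A (\<eta> t) (\<zeta> t) t - (w t (\<zeta> t + \<epsilon>) - w t (\<zeta> t))\<^sup>2 / 2 + (w t (\<eta> t + \<epsilon>) - w t (\<eta> t))\<^sup>2 / 2" for t
  note cc = curve_continuous[OF c(1)] curve_continuous[OF c(2)]
  have wc: "continuous_on {a..b} (\<lambda>t. w t (z t + k))" "continuous_on {a..b} (\<lambda>t. w t (z t))"
    if "continuous_on {a..b} z" for z k
    using ab that by (auto intro!: w_compose_continuous continuous_intros)
  have Gc: "continuous_on {a..b} G" unfolding G_def A_def
    by (intro continuous_on_add continuous_on_diff continuous_on_divide continuous_on_power continuous_on_const window_rate_continuous wc cc lt ab) auto
  have Rc: "continuous_on {a..b} (R x z)" if "x < z" for x z unfolding R_def A_def
    by (intro continuous_on_add continuous_on_diff continuous_on_divide continuous_on_power continuous_on_const window_rate_continuous wc ab that) auto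
  have Wc: "continuous_on {a..b} (\<lambda>s. W s (z s))" if z: "continuous_on {a..b} z" for z
  proof -
    have zc: "continuous_on ({a..b} \<times> {0..\<epsilon>}) (\<lambda>p. z (fst p))"
      by (auto intro!: continuous_on_compose2[OF z] continuous_on_fst continuous_on_id)
    have "continuous_on {a..b} (\<lambda>t. integral (cbox 0 \<epsilon>) (\<lambda>r. w t (z t + r)))"
    proof (rule integral_continuous_on_param)
      have "continuous_on ({a..b} \<times> {0..\<epsilon>}) (\<lambda>p. w (fst p) (z (fst p) + snd p))"
        by (intro w_compose_continuous continuous_intros zc) (use ab in auto)
      then show "continuous_on ({a..b} \<times> cbox 0 \<epsilon>) (\<lambda>(t, r). w t (z t + r))" by (simp add: case_prod_beta)
    qed
    moreover have "integral {0..\<epsilon>} (\<lambda>r. w t (z t + r)) = W t (z t)" for t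
      using integral_shift_Icc_real[of 0 \<epsilon> "w t" "z t"] unfolding W_def by (simp add: o_def add.commute)
    ultimately show ?thesis by simp
  qed
  have "integral {a..b} G - J b \<le> integral {a..a} G - J a"
  proof (rule right_dini_nonincreasing[OF ab(2)])
    show "continuous_on {a..b} (\<lambda>t. integral {a..t} G - J t)"
      unfolding J_def by (intro continuous_intros indefinite_integral_continuous_1 integrable_continuous_real Gc Wc cc)
    fix t assume t: "a \<le> t" "t < b"
    \<comment> \<open>From \<open>t\<close> to \<open>s\<close> the windows stand still; then they move at the fixed time \<open>s\<close>. The derivatives of the two effects add up to \<open>G\<close>.\<close>
    define \<Psi> where "\<Psi> s = integral {t..s} G - (W s (\<zeta> s) - W s (\<zeta> t)) + (W s (\<eta> s) - W s (\<eta> t)) - integral {t..s} (R (\<eta> t) (\<zeta> t))" for s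
    have lt': "\<eta> t < \<zeta> t" using lt t by auto
    have "(\<Psi> has_real_derivative G t - (w t (\<zeta> t + \<epsilon>) - w t (\<zeta> t)) * w t (\<zeta> t) + (w t (\<eta> t + \<epsilon>) - w t (\<eta> t)) * w t (\<eta> t) - R (\<eta> t) (\<zeta> t) t) (at_right t)"
      unfolding \<Psi>_def W_def
      by (intro DERIV_diff DERIV_add integral_right_derivative[of a b] moving_endpoint[of a b] Gc Rc lt' c ab t \<epsilon>)
    also have "G t - (w t (\<zeta> t + \<epsilon>) - w t (\<zeta> t)) * w t (\<zeta> t) + (w t (\<eta> t + \<epsilon>) - w t (\<eta> t)) * w t (\<eta> t) - R (\<eta> t) (\<zeta> t) t = 0"
      by (simp add: G_def R_def power2_eq_square field_simps)
    finally have der: "(\<Psi> has_real_derivative 0) (at_right t)" .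
    have "(integral {a..s} G - J s) - (integral {a..t} G - J t) \<le> \<Psi> s - \<Psi> t" if s: "s \<in> {t<..<b}" for s
    proof -
      have 1: "integral {a..t} G + integral {t..s} G = integral {a..s} G"
        using s t ab by (intro Henstock_Kurzweil_Integration.integral_combine integrable_continuous_real continuous_on_subset[OF Gc]) auto
      have "integral {t..s} (\<lambda>r. window_rate C \<epsilon> (w r) (\<eta> t) (\<zeta> t))
          \<le> window_gap \<epsilon> (w s) (\<eta> t) (\<zeta> t) - window_gap \<epsilon> (w t) (\<eta> t) (\<zeta> t)"
        by (rule windows) (use s t ab lt' \<epsilon> in auto)
      then have 2: "integral {t..s} (R (\<eta> t) (\<zeta> t)) \<le> (W s (\<zeta> t) - W s (\<eta> t)) - (W t (\<zeta> t) - W t (\<eta> t))"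
        unfolding R_def[abs_def] A_def W_def window_rate_def window_gap_def .
      have "\<Psi> t = 0" by (simp add: \<Psi>_def)
      then show ?thesis using 1 2 by (simp add: \<Psi>_def J_def)
    qed
    then have "\<forall>\<^sub>F s in at_right t. (integral {a..s} G - J s) - (integral {a..t} G - J t) \<le> \<Psi> s - \<Psi> t"
      by (intro eventually_mono[OF eventually_at_right_real[OF t(2)]])
    with der show "\<exists>\<Psi>. (\<Psi> has_real_derivative 0) (at_right t) \<and>
       (\<forall>\<^sub>F s in at_right t. (integral {a..s} G - J s) - (integral {a..t} G - J t) \<le> \<Psi> s - \<Psi> t)" by blast
  qed
  then show ?thesis by (simp add: G_def[abs_def] A_def J_def W_def)
qed

end

text \<open>Where two solutions of the same differential equation meet, their derivatives agree; so their maximum is a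
  solution too.\<close>

lemma max_has_derivative:
  fixes f g :: "real \<Rightarrow> real"
  assumes f: "(f has_real_derivative F) (at t within S)" and g: "(g has_real_derivative G) (at t within S)"
    and fg: "g t \<le> f t \<Longrightarrow> F = D" "f t \<le> g t \<Longrightarrow> G = D"
  shows "((\<lambda>t. max (f t) (g t)) has_real_derivative D) (at t within S)"
proof -
  have cf: "(f \<longlongrightarrow> f t) (at t within S)" and cg: "(g \<longlongrightarrow> g t) (at t within S)"
    using DERIV_continuous[OF f] DERIV_continuous[OF g] by (simp_all add: continuous_within)
  consider "f t < g t" | "g t < f t" | "f t = g t" by linarith
  then show ?thesis
  proof cases
    case 1
    have "((\<lambda>s. g s - f s) \<longlongrightarrow> g t - f t) (at t within S)" by (intro tendsto_intros cf cg)
    then have "\<forall>\<^sub>F s in at t within S. 0 < g s - f s" using 1 by (intro order_tendstoD(1)) auto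
    then have "\<forall>\<^sub>F s in at t within S. max (f s) (g s) = g s" by eventually_elim auto
    then show ?thesis using g fg 1
      by (subst has_field_derivative_cong_eventually[where g = g]) auto
  next
    case 2
    have "((\<lambda>s. f s - g s) \<longlongrightarrow> f t - g t) (at t within S)" by (intro tendsto_intros cf cg)
    then have "\<forall>\<^sub>F s in at t within S. 0 < f s - g s" using 2 by (intro order_tendstoD(1)) auto
    then have "\<forall>\<^sub>F s in at t within S. max (f s) (g s) = f s" by eventually_elim auto
    then show ?thesis using f fg 2
      by (subst has_field_derivative_cong_eventually[where g = f]) auto
  next
    case 3
    have lf: "((\<lambda>s. \<bar>(f s - f t) / (s - t) - D\<bar>) \<longlongrightarrow> 0) (at t within S)"
      and lg: "((\<lambda>s. \<bar>(g s - g t) / (s - t) - D\<bar>) \<longlongrightarrow> 0) (at t within S)"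
      using f g fg 3 by (simp_all add: has_field_derivative_iff LIM_zero_iff tendsto_rabs_zero_iff)
    have "((\<lambda>s. (max (f s) (g s) - max (f t) (g t)) / (s - t) - D) \<longlongrightarrow> 0) (at t within S)"
    proof (rule tendsto_rabs_zero_cancel, rule tendsto_sandwich[OF always_eventually always_eventually tendsto_const])
      show "((\<lambda>s. \<bar>(f s - f t) / (s - t) - D\<bar> + \<bar>(g s - g t) / (s - t) - D\<bar>) \<longlongrightarrow> 0) (at t within S)"
        using tendsto_add[OF lf lg] by simp
      show "\<forall>s. \<bar>(max (f s) (g s) - max (f t) (g t)) / (s - t) - D\<bar> \<le> \<bar>(f s - f t) / (s - t) - D\<bar> + \<bar>(g s - g t) / (s - t) - D\<bar>"
        using 3 by (auto simp: max_def)
    qed auto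
    then show ?thesis by (simp add: has_field_derivative_iff LIM_zero_iff)
  qed
qed

lemma min_has_derivative:
  fixes f g :: "real \<Rightarrow> real"
  assumes f: "(f has_real_derivative F) (at t within S)" and g: "(g has_real_derivative G) (at t within S)"
    and fg: "f t \<le> g t \<Longrightarrow> F = D" "g t \<le> f t \<Longrightarrow> G = D"
  shows "((\<lambda>t. min (f t) (g t)) has_real_derivative D) (at t within S)"
proof -
  have "((\<lambda>t. max (- f t) (- g t)) has_real_derivative - D) (at t within S)"
    by (rule max_has_derivative[OF DERIV_minus[OF f] DERIV_minus[OF g]]) (use fg in auto)
  moreover have "(\<lambda>t. min (f t) (g t)) = (\<lambda>t. - max (- f t) (- g t))" by (auto simp: min_def max_def fun_eq_iff)
  ultimately show ?thesis using DERIV_minus by force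
qed

context CH_flow
begin

lemma v_sq_Icc:
  assumes t: "t \<in> {0..T}"
  shows "set_integrable lborel {x..y} (\<lambda>s. (v t s)\<^sup>2)" "(\<lambda>s. (v t s)\<^sup>2) integrable_on {x..y}"
    "0 \<le> integral {x..y} (\<lambda>s. (v t s)\<^sup>2)" "integral {x..y} (\<lambda>s. (v t s)\<^sup>2) \<le> B"
proof -
  show 1: "set_integrable lborel {x..y} (\<lambda>s. (v t s)\<^sup>2)"
    unfolding set_integrable_def by (rule integrable_mult_indicator[OF _ v_sq[OF t]]) simp
  note 2 = set_borel_integral_eq_integral[OF 1]
  show "(\<lambda>s. (v t s)\<^sup>2) integrable_on {x..y}" by (rule 2(1))
  show "0 \<le> integral {x..y} (\<lambda>s. (v t s)\<^sup>2)" by (rule Henstock_Kurzweil_Integration.integral_nonneg[OF 2(1)]) simp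
  have "(LINT s:{x..y}|lborel. (v t s)\<^sup>2) \<le> (LINT s|lborel. (v t s)\<^sup>2)"
    unfolding set_lebesgue_integral_def
    by (rule integral_mono[OF 1[unfolded set_integrable_def] v_sq[OF t]]) (simp add: indicator_def)
  then show "integral {x..y} (\<lambda>s. (v t s)\<^sup>2) \<le> B" using 2(2) v_energy[OF t] by simp
qed

lemma v_locally_integrable: "t \<in> {0..T} \<Longrightarrow> locally_integrable (v t)"
  using w_prim by (simp add: is_primitive_def)

lemma w_increment: "t \<in> {0..T} \<Longrightarrow> x \<le> y \<Longrightarrow> w t y - w t x = integral {x..y} (v t)"
  using w_prim by (simp add: is_primitive_def)

lemma w_increment_square:
  assumes "t \<in> {0..T}" "x \<le> y"
  shows "(w t y - w t x)\<^sup>2 \<le> (y - x) * integral {x..y} (\<lambda>s. (v t s)\<^sup>2)"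
  unfolding w_increment[OF assms]
  by (rule square_of_integral_le[OF assms(2) locally_integrableD(2)[OF v_locally_integrable] v_sq_Icc(2)]) (fact assms)+

text \<open>The inequality \<open>q' \<ge> q\<^sup>2 / (2h) - C h\<close> in integrated form: divide the balance law of the moving windows
  by \<open>\<epsilon>\<close> and let \<open>\<epsilon>\<close> tend to \<open>0\<close>. The remaining flux is dominated, as
  \<open>(w(\<zeta> + \<epsilon>) - w(\<zeta>))\<^sup>2 / \<epsilon>\<close> is at most the integral of \<open>v\<^sup>2\<close> over the window, which is bounded and tends to \<open>0\<close>.\<close>

lemma velocity_gap_growth:
  assumes ab: "0 \<le> a" "a \<le> b" "b \<le> T" and c: "curve a b \<eta>" "curve a b \<zeta>"
    and lt: "\<And>t. t \<in> {a..b} \<Longrightarrow> \<eta> t < \<zeta> t"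
  shows "integral {a..b} (\<lambda>t. (w t (\<zeta> t) - w t (\<eta> t))\<^sup>2 / (2 * (\<zeta> t - \<eta> t)) - C * (\<zeta> t - \<eta> t))
    \<le> (w b (\<zeta> b) - w b (\<eta> b)) - (w a (\<zeta> a) - w a (\<eta> a))"
proof -
  note cc = curve_continuous[OF c(1)] curve_continuous[OF c(2)]
  define e where "e n = 1 / real (Suc n)" for n
  have e: "e n > 0" "e n \<le> 1" for n by (auto simp: e_def)
  have e0: "e \<longlonglongrightarrow> 0" unfolding e_def by (rule LIMSEQ_Suc[OF lim_1_over_n])
  define k where "k t r = (w t (\<zeta> t + r) - w t (\<eta> t + r))\<^sup>2 / (2 * (\<zeta> t - \<eta> t)) - C * (\<zeta> t - \<eta> t)" for t r
  define g where "g n t = real (Suc n) * integral {0..e n} (k t) - real (Suc n) * (w t (\<zeta> t + e n) - w t (\<zeta> t))\<^sup>2 / 2" for n t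
  define J where "J n t = integral {\<zeta> t..\<zeta> t + e n} (w t) - integral {\<eta> t..\<eta> t + e n} (w t)" for n t
  have kc: "continuous_on ({a..b} \<times> {0..1}) (\<lambda>(t, r). k t r)"
    unfolding k_def by (rule gap_rate_continuous[OF cc lt ab(1,3)])
  have "bounded ((\<lambda>(t, r). k t r) ` ({a..b} \<times> {0..1}))"
    by (intro compact_imp_bounded compact_continuous_image kc compact_Times compact_Icc)
  then obtain K where K: "\<And>t r. t \<in> {a..b} \<Longrightarrow> r \<in> {0..1} \<Longrightarrow> \<bar>k t r\<bar> \<le> K"
    unfolding bounded_iff by fastforce
  have kc1: "continuous_on {0..1} (k t)" if "t \<in> {a..b}" for t
  proof -
    have "(\<lambda>r. (t, r)) ` {0..1} \<subseteq> {a..b} \<times> {0..1}" using that by auto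
    from continuous_on_compose2[OF kc _ this] show ?thesis by (simp add: continuous_on_Pair continuous_on_id)
  qed
  have Ac: "continuous_on {a..b} (\<lambda>t. integral {0..e n} (k t))" for n
    unfolding k_def by (rule window_rate_continuous[OF cc lt ab(1,3)])
  have gc: "continuous_on {a..b} (g n)" for n
    unfolding g_def using ab by (intro continuous_intros Ac w_compose_continuous cc) auto
  have dw: "real (Suc n) * (w t (\<zeta> t + e n) - w t (\<zeta> t))\<^sup>2 \<le> integral {\<zeta> t..\<zeta> t + e n} (\<lambda>s. (v t s)\<^sup>2)" if "t \<in> {a..b}" for n t
  proof -
    have "t \<in> {0..T}" using that ab by auto
    from w_increment_square[OF this, of "\<zeta> t" "\<zeta> t + e n"] e(1)[of n]
    have "(w t (\<zeta> t + e n) - w t (\<zeta> t))\<^sup>2 \<le> e n * integral {\<zeta> t..\<zeta> t + e n} (\<lambda>s. (v t s)\<^sup>2)" by simp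
    then have "real (Suc n) * (w t (\<zeta> t + e n) - w t (\<zeta> t))\<^sup>2 \<le> real (Suc n) * (e n * integral {\<zeta> t..\<zeta> t + e n} (\<lambda>s. (v t s)\<^sup>2))"
      by (rule mult_left_mono) simp
    also have "\<dots> = integral {\<zeta> t..\<zeta> t + e n} (\<lambda>s. (v t s)\<^sup>2)" by (simp add: e_def)
    finally show ?thesis .
  qed
  have step: "integral {a..b} (g n) \<le> real (Suc n) * (J n b - J n a)" for n
  proof -
    define m where "m t = integral {0..e n} (k t) - (w t (\<zeta> t + e n) - w t (\<zeta> t))\<^sup>2 / 2 + (w t (\<eta> t + e n) - w t (\<eta> t))\<^sup>2 / 2" for t
    have mc: "continuous_on {a..b} m"
      unfolding m_def using ab by (intro continuous_intros Ac w_compose_continuous cc) auto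
    have "integral {a..b} (g n) \<le> integral {a..b} (\<lambda>t. real (Suc n) * m t)"
    proof (rule Henstock_Kurzweil_Integration.integral_le)
      show "g n integrable_on {a..b}" by (rule integrable_continuous_real[OF gc])
      show "(\<lambda>t. real (Suc n) * m t) integrable_on {a..b}" by (intro integrable_continuous_real continuous_intros mc)
      show "g n t \<le> real (Suc n) * m t" for t
        by (simp add: g_def m_def algebra_simps)
    qed
    also have "\<dots> = real (Suc n) * integral {a..b} m" by simp
    also have "\<dots> \<le> real (Suc n) * (J n b - J n a)"
      unfolding m_def k_def J_def by (intro mult_left_mono moving_windows[OF ab c lt e(1)]) auto
    finally show ?thesis .
  qed
  have lim1: "(\<lambda>n. integral {a..b} (g n)) \<longlonglongrightarrow> integral {a..b} (\<lambda>t. k t 0)"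
  proof (rule dominated_convergence(2)[where h = "\<lambda>_. K + B / 2"])
    show "g n integrable_on {a..b}" for n by (rule integrable_continuous_real[OF gc])
    show "(\<lambda>_. K + B / 2) integrable_on {a..b}" by (rule integrable_const_ivl)
  next
    fix n t assume t: "t \<in> {a..b}"
    have t': "t \<in> {0..T}" using t ab by auto
    have "norm (integral {0..e n} (k t)) \<le> K * (e n - 0)"
      by (rule integral_bound) (use e[of n] K[OF t] in \<open>auto intro: continuous_on_subset[OF kc1[OF t]]\<close>)
    then have "real (Suc n) * \<bar>integral {0..e n} (k t)\<bar> \<le> real (Suc n) * (K * e n)" by (intro mult_left_mono) auto
    then have 1: "\<bar>real (Suc n) * integral {0..e n} (k t)\<bar> \<le> K" by (simp add: abs_mult e_def)
    have 2: "real (Suc n) * (w t (\<zeta> t + e n) - w t (\<zeta> t))\<^sup>2 \<le> B"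
      using dw[OF t, of n] v_sq_Icc(4)[OF t', of "\<zeta> t" "\<zeta> t + e n"] by linarith
    have 3: "0 \<le> real (Suc n) * (w t (\<zeta> t + e n) - w t (\<zeta> t))\<^sup>2" by simp
    show "norm (g n t) \<le> K + B / 2" unfolding g_def real_norm_def using 1 2 3 by linarith
  next
    fix t assume t: "t \<in> {a..b}"
    have t': "t \<in> {0..T}" using t ab by auto
    have "(\<lambda>n. real (Suc n) * integral {0..0 + e n} (k t)) \<longlonglongrightarrow> k t 0"
      unfolding e_def by (rule average_tendsto) (use kc1[OF t] in simp)
    then have l1: "(\<lambda>n. real (Suc n) * integral {0..e n} (k t)) \<longlonglongrightarrow> k t 0" by simp
    have "continuous_on {\<zeta> t..\<zeta> t + 1} (\<lambda>y. integral {\<zeta> t..y} (\<lambda>s. (v t s)\<^sup>2))"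
      by (rule indefinite_integral_continuous_1[OF v_sq_Icc(2)[OF t']])
    moreover have "(\<lambda>n. \<zeta> t + e n) \<longlonglongrightarrow> \<zeta> t + 0" by (intro tendsto_intros e0)
    ultimately have "(\<lambda>n. integral {\<zeta> t..\<zeta> t + e n} (\<lambda>s. (v t s)\<^sup>2)) \<longlonglongrightarrow> integral {\<zeta> t..\<zeta> t + 0} (\<lambda>s. (v t s)\<^sup>2)"
      by (rule continuous_on_tendsto_compose) (use e in \<open>auto simp: less_imp_le\<close>)
    then have l2: "(\<lambda>n. integral {\<zeta> t..\<zeta> t + e n} (\<lambda>s. (v t s)\<^sup>2)) \<longlonglongrightarrow> 0" by simp
    have l3: "(\<lambda>n. real (Suc n) * (w t (\<zeta> t + e n) - w t (\<zeta> t))\<^sup>2) \<longlonglongrightarrow> 0"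
      by (rule tendsto_sandwich[OF always_eventually always_eventually tendsto_const l2]) (use dw[OF t] in auto)
    have "(\<lambda>n. g n t) \<longlonglongrightarrow> k t 0 - 0 / 2"
      unfolding g_def by (intro tendsto_intros l1 l3) simp
    then show "(\<lambda>n. g n t) \<longlonglongrightarrow> k t 0" by simp
  qed
  have lim2: "(\<lambda>n. real (Suc n) * J n t) \<longlonglongrightarrow> w t (\<zeta> t) - w t (\<eta> t)" if "t \<in> {a..b}" for t
  proof -
    have "t \<in> {0..T}" using that ab by auto
    then have "(\<lambda>n. real (Suc n) * integral {\<zeta> t..\<zeta> t + e n} (w t) - real (Suc n) * integral {\<eta> t..\<eta> t + e n} (w t)) \<longlonglongrightarrow> w t (\<zeta> t) - w t (\<eta> t)"
      unfolding e_def by (intro tendsto_diff average_tendsto w_space_continuous)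
    then show ?thesis by (simp add: J_def right_diff_distrib)
  qed
  have "(\<lambda>n. real (Suc n) * (J n b - J n a)) \<longlonglongrightarrow> (w b (\<zeta> b) - w b (\<eta> b)) - (w a (\<zeta> a) - w a (\<eta> a))"
    unfolding right_diff_distrib using ab by (intro tendsto_diff lim2) auto
  from LIMSEQ_le[OF lim1 this] step show ?thesis by (simp add: k_def)
qed

text \<open>With \<open>n = q\<^sup>-\<close>, the derivative of \<open>n\<^sup>2 / h\<close> is at most \<open>- 2 n (q\<^sup>2 / (2h) - C h) / h - n\<^sup>2 q / h\<^sup>2\<close>. Since
  \<open>n q = - n\<^sup>2\<close>, the terms \<open>n\<^sup>3 / h\<^sup>2\<close> cancel and \<open>2 C n\<close> is left.\<close>

lemma compression_energy_step:
  assumes ab: "0 \<le> a" "a \<le> b" "b \<le> T" and c: "curve a b \<eta>" "curve a b \<zeta>"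
    and lt: "\<And>t. t \<in> {a..b} \<Longrightarrow> \<eta> t < \<zeta> t"
  shows "(max (- (w b (\<zeta> b) - w b (\<eta> b))) 0)\<^sup>2 / (\<zeta> b - \<eta> b)
    \<le> (max (- (w a (\<zeta> a) - w a (\<eta> a))) 0)\<^sup>2 / (\<zeta> a - \<eta> a)
      + integral {a..b} (\<lambda>t. 2 * C * max (- (w t (\<zeta> t) - w t (\<eta> t))) 0)"
proof -
  note cc = curve_continuous[OF c(1)] curve_continuous[OF c(2)]
  define q where "q t = w t (\<zeta> t) - w t (\<eta> t)" for t
  define h where "h t = \<zeta> t - \<eta> t" for t
  define \<kappa> where "\<kappa> t = (q t)\<^sup>2 / (2 * h t) - C * h t" for t
  define m where "m t = 2 * C * max (- q t) 0" for t
  have h: "h t > 0" if "t \<in> {a..b}" for t using lt[OF that] by (simp add: h_def)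
  have qc: "continuous_on {a..b} q" unfolding q_def using ab by (intro continuous_intros w_compose_continuous cc) auto
  have hc: "continuous_on {a..b} h" unfolding h_def by (intro continuous_intros cc)
  have \<kappa>c: "continuous_on {a..b} \<kappa>" unfolding \<kappa>_def by (intro continuous_intros qc hc) (use h in force)
  have mc: "continuous_on {a..b} m" unfolding m_def by (intro continuous_intros qc)
  have "(max (- q b) 0)\<^sup>2 / h b - integral {a..b} m \<le> (max (- q a) 0)\<^sup>2 / h a - integral {a..a} m"
  proof (rule right_dini_nonincreasing[OF ab(2)])
    show "continuous_on {a..b} (\<lambda>t. (max (- q t) 0)\<^sup>2 / h t - integral {a..t} m)"
      by (intro continuous_intros qc hc indefinite_integral_continuous_1 integrable_continuous_real mc) (use h in force)
    fix t assume t: "a \<le> t" "t < b"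
    \<comment> \<open>The velocity gap stays above \<open>p\<close>, and the quotient is nonincreasing in the gap.\<close>
    define p where "p s = q t + integral {t..s} \<kappa>" for s
    define n where "n = max (- q t) 0"
    define \<Psi> where "\<Psi> s = (max (- p s) 0)\<^sup>2 / h s - integral {t..s} m" for s
    have ht: "h t > 0" using h t by auto
    have pt: "p t = q t" by (simp add: p_def)
    have dp: "(p has_real_derivative \<kappa> t) (at_right t)"
      unfolding p_def using DERIV_add[OF DERIV_const integral_right_derivative[OF \<kappa>c t]] by simp
    have dh: "(h has_real_derivative q t) (at_right t)"
      unfolding h_def q_def by (intro DERIV_diff curve_right_derivative[of a b] c t)
    have dn: "((\<lambda>s. (max (- p s) 0)\<^sup>2) has_real_derivative - 2 * n * \<kappa> t) (at_right t)"
      using DERIV_chain2[OF neg_part_square_deriv dp] by (simp add: pt n_def)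
    have "(\<Psi> has_real_derivative (- 2 * n * \<kappa> t * h t - n\<^sup>2 * q t) / (h t * h t) - m t) (at_right t)"
      unfolding \<Psi>_def
      using DERIV_diff[OF DERIV_divide[OF dn dh] integral_right_derivative[OF mc t]] ht by (simp add: pt n_def)
    also have "(- 2 * n * \<kappa> t * h t - n\<^sup>2 * q t) / (h t * h t) - m t = 0"
    proof -
      have "n = 0 \<or> q t = - n" by (auto simp: n_def max_def)
      then have nqq: "n * (q t)\<^sup>2 = n ^ 3" and nnq: "n\<^sup>2 * q t = - (n ^ 3)"
        by (auto simp: power2_eq_square power3_eq_cube)
      have "2 * n * \<kappa> t * h t = n * (q t)\<^sup>2 - 2 * C * n * (h t * h t)"
        using ht by (simp add: \<kappa>_def field_simps power2_eq_square)
      then have "- 2 * n * \<kappa> t * h t - n\<^sup>2 * q t = 2 * C * n * (h t * h t)" unfolding nnq nqq by simp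
      then show ?thesis using ht by (simp add: m_def n_def)
    qed
    finally have der: "(\<Psi> has_real_derivative 0) (at_right t)" .
    have "((max (- q s) 0)\<^sup>2 / h s - integral {a..s} m) - ((max (- q t) 0)\<^sup>2 / h t - integral {a..t} m) \<le> \<Psi> s - \<Psi> t" if s: "s \<in> {t<..<b}" for s
    proof -
      have 1: "integral {a..t} m + integral {t..s} m = integral {a..s} m"
        using s t ab by (intro Henstock_Kurzweil_Integration.integral_combine integrable_continuous_real continuous_on_subset[OF mc]) auto
      have "integral {t..s} \<kappa> \<le> q s - q t"
        unfolding \<kappa>_def q_def h_def
        by (rule velocity_gap_growth) (use s t ab lt in \<open>auto intro: curve_subinterval[OF c(1)] curve_subinterval[OF c(2)]\<close>)
      then have "p s \<le> q s" by (simp add: p_def)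
      then have "(max (- q s) 0)\<^sup>2 \<le> (max (- p s) 0)\<^sup>2" by (intro power_mono) auto
      then have "(max (- q s) 0)\<^sup>2 / h s \<le> (max (- p s) 0)\<^sup>2 / h s" using h[of s] s t by (intro divide_right_mono) auto
      then show ?thesis using 1 by (simp add: \<Psi>_def pt)
    qed
    then have "\<forall>\<^sub>F s in at_right t. ((max (- q s) 0)\<^sup>2 / h s - integral {a..s} m) - ((max (- q t) 0)\<^sup>2 / h t - integral {a..t} m) \<le> \<Psi> s - \<Psi> t"
      by (intro eventually_mono[OF eventually_at_right_real[OF t(2)]])
    with der show "\<exists>\<Psi>. (\<Psi> has_real_derivative 0) (at_right t) \<and>
       (\<forall>\<^sub>F s in at_right t. ((max (- q s) 0)\<^sup>2 / h s - integral {a..s} m) - ((max (- q t) 0)\<^sup>2 / h t - integral {a..t} m) \<le> \<Psi> s - \<Psi> t)"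
      by blast
  qed
  then show ?thesis by (simp add: q_def h_def m_def[abs_def])
qed

text \<open>The curves may now touch. After the last time of contact their distance grows, so there are times with
  \<open>q > 0\<close> from which the quotient can be followed starting at \<open>0\<close>. When \<open>h = 0\<close> the quotient is \<open>0\<close> by convention, and
  the inequality holds with this value.\<close>

lemma compression_energy:
  assumes ab: "0 \<le> a" "a \<le> b" "b \<le> T" and c: "curve a b \<eta>" "curve a b \<zeta>"
    and le: "\<And>t. t \<in> {a..b} \<Longrightarrow> \<eta> t \<le> \<zeta> t"
  shows "(max (- (w b (\<zeta> b) - w b (\<eta> b))) 0)\<^sup>2 / (\<zeta> b - \<eta> b)
    \<le> (max (- (w a (\<zeta> a) - w a (\<eta> a))) 0)\<^sup>2 / (\<zeta> a - \<eta> a)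
      + integral {a..b} (\<lambda>t. 2 * C * max (- (w t (\<zeta> t) - w t (\<eta> t))) 0)"
proof -
  note cc = curve_continuous[OF c(1)] curve_continuous[OF c(2)]
  define q where "q t = w t (\<zeta> t) - w t (\<eta> t)" for t
  define h where "h t = \<zeta> t - \<eta> t" for t
  define m where "m t = 2 * C * max (- q t) 0" for t
  have h: "h t \<ge> 0" if "t \<in> {a..b}" for t using le[OF that] by (simp add: h_def)
  have qc: "continuous_on {a..b} q" unfolding q_def using ab by (intro continuous_intros w_compose_continuous cc) auto
  have hc: "continuous_on {a..b} h" unfolding h_def by (intro continuous_intros cc)
  have mc: "continuous_on {a..b} m" unfolding m_def by (intro continuous_intros qc)
  have m0: "m t \<ge> 0" for t using C_nonneg by (simp add: m_def)
  have mi: "m integrable_on {c..d}" if "a \<le> c" "d \<le> b" for c d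
    using that by (intro integrable_continuous_real continuous_on_subset[OF mc]) auto
  have step: "(max (- q b) 0)\<^sup>2 / h b \<le> (max (- q s) 0)\<^sup>2 / h s + integral {a..b} m"
    if s: "a \<le> s" "s \<le> b" and pos: "\<And>t. t \<in> {s..b} \<Longrightarrow> h t > 0" for s
  proof -
    have "(max (- q b) 0)\<^sup>2 / h b \<le> (max (- q s) 0)\<^sup>2 / h s + integral {s..b} m"
      unfolding q_def h_def m_def
      by (rule compression_energy_step) (use s ab pos in \<open>auto simp: h_def intro: curve_subinterval[OF c(1)] curve_subinterval[OF c(2)]\<close>)
    also have "integral {s..b} m \<le> integral {a..b} m"
      using s m0 by (intro integral_subset_le mi) auto
    finally show ?thesis by simp
  qed
  have I0: "integral {a..b} m \<ge> 0" using m0 by (intro Henstock_Kurzweil_Integration.integral_nonneg mi) auto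
  have "(max (- q b) 0)\<^sup>2 / h b \<le> (max (- q a) 0)\<^sup>2 / h a + integral {a..b} m"
  proof (cases "h b = 0 \<or> (\<forall>t\<in>{a..b}. h t > 0)")
    case True
    then show ?thesis
    proof
      assume "h b = 0"
      moreover have "0 \<le> (max (- q a) 0)\<^sup>2 / h a" using h[of a] ab by simp
      ultimately show ?thesis using I0 by simp
    next
      assume "\<forall>t\<in>{a..b}. h t > 0"
      then show ?thesis using ab by (intro step) auto
    qed
  next
    case False
    define S where "S = {a..b} \<inter> h -` {0}"
    have "closed S" unfolding S_def by (rule continuous_closed_preimage[OF hc]) auto
    moreover have "S \<noteq> {}" using False h unfolding S_def by force
    moreover have bdd: "bdd_above S" unfolding S_def by (rule bdd_aboveI[of _ b]) auto
    ultimately have SS: "Sup S \<in> S" using closed_contains_Sup by blast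
    \<comment> \<open>The last time of contact.\<close>
    define s0 where "s0 = Sup S"
    have s0: "a \<le> s0" "s0 \<le> b" "h s0 = 0" using SS by (auto simp: s0_def S_def)
    have hb: "h b > 0" using False h[of b] ab by auto
    then have s0b: "s0 < b" using s0 by (cases "s0 = b") auto
    have pos: "h t > 0" if "t \<in> {s0<..b}" for t
    proof (rule ccontr)
      assume "\<not> h t > 0"
      then have "t \<in> S" using h[of t] that s0 by (auto simp: S_def)
      then have "t \<le> s0" unfolding s0_def using bdd by (rule cSup_upper)
      with that show False by auto
    qed
    have "\<exists>s\<in>{s0<..<b}. h b - h s0 = q s * (b - s0)"
    proof (rule mvt_simple[OF s0b])
      fix t assume t: "s0 \<le> t" "t \<le> b"
      have "(h has_real_derivative q t) (at t within {a..b})"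
        unfolding h_def q_def using c t s0(1) by (intro DERIV_diff) (auto simp: curve_def)
      then have "(h has_real_derivative q t) (at t within {s0..b})"
        by (rule DERIV_subset) (use s0 in auto)
      then show "(h has_derivative (*) (q t)) (at t within {s0..b})" by (simp add: has_field_derivative_def)
    qed
    then obtain s where s: "s > s0" "s < b" "h b - h s0 = q s * (b - s0)" by auto
    then have "q s > 0" using hb s0 s0b by (simp add: zero_less_mult_iff)
    then have "(max (- q s) 0)\<^sup>2 / h s = 0" by simp
    moreover have "(max (- q b) 0)\<^sup>2 / h b \<le> (max (- q s) 0)\<^sup>2 / h s + integral {a..b} m"
      using s s0 by (intro step pos) auto
    moreover have "0 \<le> (max (- q a) 0)\<^sup>2 / h a" using h[of a] ab by simp
    ultimately show ?thesis by linarith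
  qed
  then show ?thesis by (simp add: q_def h_def m_def[abs_def])
qed

end

section \<open>Compression energy between two curves\<close>

lemma initial_le_of_chain:
  fixes x :: "nat \<Rightarrow> real"
  shows "(\<And>j. j < m \<Longrightarrow> x j \<le> x (Suc j)) \<Longrightarrow> x 0 \<le> x m"
proof (induction m)
  case (Suc m)
  have "x 0 \<le> x m" using Suc.prems by (intro Suc.IH) auto
  also have "x m \<le> x (Suc m)" using Suc.prems by simp
  finally show ?case .
qed simp

context CH_flow
begin

lemma curve_max:
  assumes "curve a b \<eta>" "curve a b \<zeta>" shows "curve a b (\<lambda>t. max (\<eta> t) (\<zeta> t))"
  unfolding curve_def
proof
  fix t assume t: "t \<in> {a..b}"
  show "((\<lambda>t. max (\<eta> t) (\<zeta> t)) has_real_derivative w t (max (\<eta> t) (\<zeta> t))) (at t within {a..b})"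
    by (rule max_has_derivative[where F = "w t (\<eta> t)" and G = "w t (\<zeta> t)"])
       (use assms t in \<open>auto simp: curve_def\<close>)
qed

text \<open>Peano's theorem needs a bounded velocity. Freezing the velocity outside the strip between \<open>\<alpha>\<close> and \<open>\<beta>\<close> makes it bounded, and the
  projection of the solution to the strip is a curve of the original flow.\<close>

lemma curve_in_strip_ending_at:
  assumes ab: "0 \<le> a" "a \<le> b" "b \<le> T" and c: "curve a b \<alpha>" "curve a b \<beta>"
    and le: "\<And>t. t \<in> {a..b} \<Longrightarrow> \<alpha> t \<le> \<beta> t" and x: "\<alpha> b \<le> x" "x \<le> \<beta> b"
  shows "\<exists>\<zeta>. curve a b \<zeta> \<and> \<zeta> b = x \<and> (\<forall>t\<in>{a..b}. \<alpha> t \<le> \<zeta> t \<and> \<zeta> t \<le> \<beta> t)"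
proof -
  note cc = curve_continuous[OF c(1)] curve_continuous[OF c(2)]
  define cl where "cl t = max a (min b t)" for t
  have cl: "cl t \<in> {a..b}" for t using ab by (auto simp: cl_def)
  have cl_id: "cl t = t" if "t \<in> {a..b}" for t using that by (auto simp: cl_def)
  define X where "X t y = max (\<alpha> t) (min (\<beta> t) y)" for t y
  \<comment> \<open>The velocity, frozen outside the strip and outside the time interval.\<close>
  define f where "f t y = w (cl t) (X (cl t) y)" for t y
  have c\<alpha>: "continuous_on UNIV (\<lambda>p. \<alpha> (cl (fst p)))" and c\<beta>: "continuous_on UNIV (\<lambda>p. \<beta> (cl (fst p)))"
    by (auto intro!: continuous_on_compose2[OF cc(1)] continuous_on_compose2[OF cc(2)] cl continuous_intros simp: cl_def)
       (use ab in auto)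
  have "continuous_on UNIV (\<lambda>p. f (fst p) (snd p))"
    unfolding f_def X_def
    by (intro w_compose_continuous continuous_intros c\<alpha> c\<beta>)
       (use cl ab in \<open>auto simp: cl_def intro!: continuous_intros\<close>)
  then have fc: "continuous_on UNIV (\<lambda>(t, y). f t y)" by (simp add: case_prod_beta)
  obtain A1 where A1: "\<And>t. t \<in> {a..b} \<Longrightarrow> \<bar>\<alpha> t\<bar> \<le> A1" using continuous_bounded_on_Icc[OF cc(1)] by blast
  obtain B1 where B1: "\<And>t. t \<in> {a..b} \<Longrightarrow> \<bar>\<beta> t\<bar> \<le> B1" using continuous_bounded_on_Icc[OF cc(2)] by blast
  have "bounded ((\<lambda>(t, x). w t x) ` ({a..b} \<times> {- A1..B1}))"
    by (intro compact_imp_bounded compact_continuous_image continuous_on_subset[OF w_cont] compact_Times compact_Icc)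
       (use ab in auto)
  then obtain K where K: "\<And>t y. t \<in> {a..b} \<Longrightarrow> y \<in> {- A1..B1} \<Longrightarrow> \<bar>w t y\<bar> \<le> K"
    unfolding bounded_iff by fastforce
  have fb: "\<bar>f t y\<bar> \<le> K" for t y
    unfolding f_def
  proof (rule K[OF cl])
    show "X (cl t) y \<in> {- A1..B1}" using A1[OF cl, of t] B1[OF cl, of t] le[OF cl, of t] by (auto simp: X_def)
  qed
  obtain \<xi> where \<xi>: "\<xi> b = x" "\<And>t. t \<in> {a..b} \<Longrightarrow> (\<xi> has_real_derivative f t (\<xi> t)) (at t within {a..b})"
    using peano_backward[OF ab(2) fc fb] by blast
  define \<gamma> where "\<gamma> t = max (\<alpha> t) (min (\<beta> t) (\<xi> t))" for t
  have "curve a b \<gamma>"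
    unfolding curve_def
  proof
    fix t assume t: "t \<in> {a..b}"
    have fD: "f t (\<xi> t) = w t (\<gamma> t)" by (simp add: f_def cl_id[OF t] X_def \<gamma>_def)
    have m: "((\<lambda>t. min (\<beta> t) (\<xi> t)) has_real_derivative w t (\<gamma> t)) (at t within {a..b})"
      by (rule min_has_derivative[where F = "w t (\<beta> t)" and G = "f t (\<xi> t)"])
         (use c(2) t \<xi>(2)[OF t] fD le[OF t] in \<open>auto simp: curve_def \<gamma>_def\<close>)
    show "(\<gamma> has_real_derivative w t (\<gamma> t)) (at t within {a..b})"
      unfolding \<gamma>_def
      by (rule max_has_derivative[where F = "w t (\<alpha> t)" and G = "w t (\<gamma> t)"])
         (use c(1) t m in \<open>auto simp: curve_def \<gamma>_def\<close>)
  qed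
  moreover have "\<gamma> b = x" using \<xi>(1) x by (simp add: \<gamma>_def)
  moreover have "\<forall>t\<in>{a..b}. \<alpha> t \<le> \<gamma> t \<and> \<gamma> t \<le> \<beta> t" using le by (auto simp: \<gamma>_def)
  ultimately show ?thesis by blast
qed

text \<open>The curves are made monotone by taking running maxima; at time \<open>b\<close> this changes nothing.\<close>

lemma ordered_curves_ending_at:
  assumes ab: "0 \<le> a" "a \<le> b" "b \<le> T" and c: "curve a b \<alpha>" "curve a b \<beta>"
    and le: "\<And>t. t \<in> {a..b} \<Longrightarrow> \<alpha> t \<le> \<beta> t"
    and x: "\<And>j::nat. j \<le> m \<Longrightarrow> \<alpha> b \<le> x j \<and> x j \<le> \<beta> b" "\<And>i j. i \<le> j \<Longrightarrow> j \<le> m \<Longrightarrow> x i \<le> x j"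
  shows "\<exists>\<zeta>. \<forall>j\<le>m. curve a b (\<zeta> j) \<and> \<zeta> j b = x j \<and>
     (\<forall>t\<in>{a..b}. \<alpha> t \<le> \<zeta> j t \<and> \<zeta> j t \<le> \<beta> t \<and> (j < m \<longrightarrow> \<zeta> j t \<le> \<zeta> (Suc j) t))"
proof -
  have "\<forall>j\<in>{..m}. \<exists>\<xi>. curve a b \<xi> \<and> \<xi> b = x j \<and> (\<forall>t\<in>{a..b}. \<alpha> t \<le> \<xi> t \<and> \<xi> t \<le> \<beta> t)"
    using x(1) by (intro ballI curve_in_strip_ending_at[OF ab c le]) auto
  then obtain \<xi> where \<xi>: "\<And>j. j \<le> m \<Longrightarrow> curve a b (\<xi> j) \<and> \<xi> j b = x j \<and> (\<forall>t\<in>{a..b}. \<alpha> t \<le> \<xi> j t \<and> \<xi> j t \<le> \<beta> t)"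
    unfolding bchoice_iff by auto
  define \<zeta> where "\<zeta> = rec_nat (\<xi> 0) (\<lambda>j f t. max (f t) (\<xi> (Suc j) t))"
  have \<zeta>0: "\<zeta> 0 = \<xi> 0" and \<zeta>S: "\<zeta> (Suc j) = (\<lambda>t. max (\<zeta> j t) (\<xi> (Suc j) t))" for j
    by (simp_all add: \<zeta>_def)
  have "curve a b (\<zeta> j) \<and> \<zeta> j b = x j \<and> (\<forall>t\<in>{a..b}. \<alpha> t \<le> \<zeta> j t \<and> \<zeta> j t \<le> \<beta> t)" if "j \<le> m" for j
    using that
  proof (induction j)
    case 0
    then show ?case using \<xi>[of 0] by (simp add: \<zeta>0)
  next
    case (Suc j)
    have x: "x j \<le> x (Suc j)" using x(2)[of j "Suc j"] Suc.prems by simp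
    show ?case
    proof (intro conjI)
      show "curve a b (\<zeta> (Suc j))" unfolding \<zeta>S using Suc \<xi>[of "Suc j"] by (intro curve_max) auto
      show "\<zeta> (Suc j) b = x (Suc j)" unfolding \<zeta>S using Suc \<xi>[of "Suc j"] x by simp
      show "\<forall>t\<in>{a..b}. \<alpha> t \<le> \<zeta> (Suc j) t \<and> \<zeta> (Suc j) t \<le> \<beta> t"
        unfolding \<zeta>S using Suc \<xi>[of "Suc j"] by (auto simp: le_max_iff_disj)
    qed
  qed
  moreover have "\<zeta> j t \<le> \<zeta> (Suc j) t" for j t by (simp add: \<zeta>S)
  ultimately show ?thesis by (intro exI[of _ \<zeta>]) auto
qed

text \<open>The energy of the compressive part \<open>v\<^sup>-\<close> of the velocity gradient.\<close>

definition compression :: "real \<Rightarrow> real \<Rightarrow> real \<Rightarrow> real" where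
  "compression t x y = integral {x..y} (\<lambda>s. (max (- v t s) 0)\<^sup>2)"

lemma neg_v_integrable:
  assumes t: "t \<in> {0..T}"
  shows "(\<lambda>s. (max (- v t s) 0)\<^sup>2) integrable_on {x..y}"
    "set_integrable lborel {x..y} (\<lambda>s. (max (- v t s) 0)\<^sup>2)"
proof -
  have m: "(\<lambda>x::real. (max (- x) 0)\<^sup>2) \<in> borel_measurable borel" by measurable
  note cell = square_integrable_cell[OF locally_integrable_measurable[OF v_locally_integrable[OF t]] v_sq_Icc(1)[OF t] m _ order_refl order_refl]
  show "(\<lambda>s. (max (- v t s) 0)\<^sup>2) integrable_on {x..y}" by (rule cell(2)) (simp add: max_def)
  show "set_integrable lborel {x..y} (\<lambda>s. (max (- v t s) 0)\<^sup>2)" by (rule cell(1)) (simp add: max_def)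
qed

lemma compression_combine:
  assumes "t \<in> {0..T}" "x \<le> y" "y \<le> z"
  shows "compression t x y + compression t y z = compression t x z"
  unfolding compression_def
  by (rule Henstock_Kurzweil_Integration.integral_combine[OF assms(2,3) neg_v_integrable(1)[OF assms(1)]])

lemma compression_nonneg: "t \<in> {0..T} \<Longrightarrow> 0 \<le> compression t x y"
  unfolding compression_def by (intro Henstock_Kurzweil_Integration.integral_nonneg neg_v_integrable) auto

lemma compression_cell:
  assumes t: "t \<in> {0..T}" and "x \<le> y"
  shows "(max (- (w t y - w t x)) 0)\<^sup>2 / (y - x) \<le> compression t x y"
  unfolding w_increment[OF assms] compression_def
  by (rule neg_part_square_of_integral_le[OF assms(2) locally_integrableD(2)[OF v_locally_integrable[OF t]] neg_v_integrable(1)[OF t]])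

lemma compression_partition:
  assumes t: "t \<in> {0..T}" and x: "\<And>j::nat. j < m \<Longrightarrow> x j \<le> x (Suc j)"
  shows "(\<Sum>j<m. (max (- (w t (x (Suc j)) - w t (x j))) 0)\<^sup>2 / (x (Suc j) - x j)) \<le> compression t (x 0) (x m)"
  using x
proof (induction m)
  case 0
  then show ?case by (simp add: compression_def)
next
  case (Suc m)
  have "x 0 \<le> x m" using Suc.prems by (intro initial_le_of_chain) auto
  then show ?case
    using Suc compression_cell[OF t, of "x m" "x (Suc m)"] compression_combine[OF t, of "x 0" "x m" "x (Suc m)"] by simp
qed

text \<open>A bound on the error terms \<open>q\<^sup>-\<close> that is additive over adjacent intervals, so that their sum does not depend on the number
  of partition points.\<close>

lemma speed_gap_le:
  assumes t: "t \<in> {0..T}" and x: "x \<le> y"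
  shows "2 * max (- (w t y - w t x)) 0 \<le> (y - x) + integral {x..y} (\<lambda>s. (v t s)\<^sup>2)"
proof -
  have i: "(\<lambda>s. - 2 * v t s) integrable_on {x..y}"
    by (intro integrable_on_mult_right locally_integrableD v_locally_integrable t)
  have "2 * (- (w t y - w t x)) = integral {x..y} (\<lambda>s. - 2 * v t s)"
    unfolding w_increment[OF t x] by simp
  also have "\<dots> \<le> integral {x..y} (\<lambda>s. 1 + (v t s)\<^sup>2)"
  proof (rule Henstock_Kurzweil_Integration.integral_le[OF i])
    show "(\<lambda>s. 1 + (v t s)\<^sup>2) integrable_on {x..y}"
      by (intro Henstock_Kurzweil_Integration.integrable_add integrable_const_ivl v_sq_Icc t)
    show "- 2 * v t s \<le> 1 + (v t s)\<^sup>2" for s using zero_le_power2[of "v t s + 1"] by (simp add: power2_sum)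
  qed
  also have "\<dots> = (y - x) + integral {x..y} (\<lambda>s. (v t s)\<^sup>2)"
    using v_sq_Icc(2)[OF t] x by (simp add: Henstock_Kurzweil_Integration.integral_add integrable_const_ivl)
  finally show ?thesis using v_sq_Icc(3)[OF t, of x y] x by (simp add: max_def)
qed

lemma speed_gap_partition:
  assumes t: "t \<in> {0..T}" and x: "\<And>j::nat. j < m \<Longrightarrow> x j \<le> x (Suc j)"
  shows "(\<Sum>j<m. 2 * max (- (w t (x (Suc j)) - w t (x j))) 0) \<le> (x m - x 0) + integral {x 0..x m} (\<lambda>s. (v t s)\<^sup>2)"
  using x
proof (induction m)
  case (Suc m)
  have "x 0 \<le> x m" using Suc.prems by (intro initial_le_of_chain) auto
  then have "integral {x 0..x m} (\<lambda>s. (v t s)\<^sup>2) + integral {x m..x (Suc m)} (\<lambda>s. (v t s)\<^sup>2) = integral {x 0..x (Suc m)} (\<lambda>s. (v t s)\<^sup>2)"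
    using Suc.prems v_sq_Icc(2)[OF t] by (intro Henstock_Kurzweil_Integration.integral_combine) auto
  then show ?case using Suc speed_gap_le[OF t, of "x m" "x (Suc m)"] by simp
qed simp

text \<open>Take the dyadic partition at the final time \<open>b\<close>, trace it back along ordered curves, apply the inequality for
  each pair of neighbours, and refine. At time \<open>a\<close> the sum is at most the energy by the one-sided Cauchy-Schwarz inequality.\<close>

lemma compression_growth:
  assumes ab: "0 \<le> a" "a \<le> b" "b \<le> T" and c: "curve a b \<alpha>" "curve a b \<beta>"
    and le: "\<And>t. t \<in> {a..b} \<Longrightarrow> \<alpha> t \<le> \<beta> t" and L: "\<And>t. t \<in> {a..b} \<Longrightarrow> \<beta> t - \<alpha> t \<le> L"
  shows "compression b (\<alpha> b) (\<beta> b) \<le> compression a (\<alpha> a) (\<beta> a) + C * (L + B) * (b - a)"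
proof (cases "\<alpha> b < \<beta> b")
  case False
  then have "compression b (\<alpha> b) (\<beta> b) = 0" using le[of b] ab by (simp add: compression_def)
  moreover have "compression a (\<alpha> a) (\<beta> a) \<ge> 0" using ab by (intro compression_nonneg) auto
  moreover have "B \<ge> 0" using v_sq_Icc(3,4)[of a 0 0] ab by simp
  moreover have "L \<ge> 0" using L[of a] le[of a] ab by simp
  ultimately show ?thesis using C_nonneg ab by simp
next
  case True
  have a: "a \<in> {0..T}" and b: "b \<in> {0..T}" using ab by auto
  have bound: "(\<Sum>j<2 ^ n. (max (- slope (w b) (\<alpha> b) (\<beta> b) n j) 0)\<^sup>2 * ((\<beta> b - \<alpha> b) / 2 ^ n))
    \<le> compression a (\<alpha> a) (\<beta> a) + C * (L + B) * (b - a)" for n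
  proof -
    define m where "m = (2::nat) ^ n"
    define x where "x = node (\<alpha> b) (\<beta> b) n"
    have xle: "\<alpha> b \<le> x j \<and> x j \<le> \<beta> b" if "j \<le> m" for j using node_in[of "\<alpha> b" "\<beta> b" j n] True that by (simp add: m_def x_def)
    have xmono: "x i \<le> x j" if "i \<le> j" "j \<le> m" for i j using node_mono[of "\<alpha> b" "\<beta> b" i j n] True that by (simp add: x_def)
    obtain \<zeta> where H: "\<forall>j\<le>m. curve a b (\<zeta> j) \<and> \<zeta> j b = x j \<and>
        (\<forall>t\<in>{a..b}. \<alpha> t \<le> \<zeta> j t \<and> \<zeta> j t \<le> \<beta> t \<and> (j < m \<longrightarrow> \<zeta> j t \<le> \<zeta> (Suc j) t))"
      using ordered_curves_ending_at[OF ab c le, of m x] xle xmono by auto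
    have \<zeta>: "curve a b (\<zeta> j)" "\<zeta> j b = x j" "\<And>t. t \<in> {a..b} \<Longrightarrow> \<alpha> t \<le> \<zeta> j t \<and> \<zeta> j t \<le> \<beta> t" if "j \<le> m" for j
      using H that by blast+
    have \<zeta>_le: "\<zeta> j t \<le> \<zeta> (Suc j) t" if "j < m" "t \<in> {a..b}" for j t using H that by auto
    define p where "p j t = max (- (w t (\<zeta> (Suc j) t) - w t (\<zeta> j t))) 0" for j t
    define F where "F j t = (p j t)\<^sup>2 / (\<zeta> (Suc j) t - \<zeta> j t)" for j t
    have pc: "continuous_on {a..b} (p j)" if "j < m" for j
      unfolding p_def using that ab
      by (intro continuous_intros w_compose_continuous curve_continuous[OF \<zeta>(1)]) auto
    have "(\<Sum>j<2 ^ n. (max (- slope (w b) (\<alpha> b) (\<beta> b) n j) 0)\<^sup>2 * ((\<beta> b - \<alpha> b) / 2 ^ n)) = (\<Sum>j<m. F j b)"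
      unfolding m_def
    proof (intro sum.cong refl)
      fix j assume "j \<in> {..<(2::nat) ^ n}"
      then have j: "j < m" by (simp add: m_def)
      define h where "h = (\<beta> b - \<alpha> b) / 2 ^ n"
      have h: "h > 0" using True by (simp add: h_def)
      have hx: "x (Suc j) - x j = h" unfolding x_def h_def by (simp add: node_Suc)
      define d where "d = w b (x (Suc j)) - w b (x j)"
      have "slope (w b) (\<alpha> b) (\<beta> b) n j = d / h" by (simp add: slope_def d_def x_def h_def)
      moreover have "max (- (d / h)) 0 = max (- d) 0 / h" using h by (simp add: max_divide_distrib_right)
      moreover have "F j b = (max (- d) 0)\<^sup>2 / h" using j \<zeta>(2)[of j] \<zeta>(2)[of "Suc j"] by (simp add: F_def p_def d_def hx)
      ultimately show "(max (- slope (w b) (\<alpha> b) (\<beta> b) n j) 0)\<^sup>2 * ((\<beta> b - \<alpha> b) / 2 ^ n) = F j b"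
        using h by (simp add: h_def[symmetric] power2_eq_square)
    qed
    also have "\<dots> \<le> (\<Sum>j<m. F j a + integral {a..b} (\<lambda>t. 2 * C * p j t))"
    proof (rule sum_mono)
      fix j assume "j \<in> {..<m}"
      then show "F j b \<le> F j a + integral {a..b} (\<lambda>t. 2 * C * p j t)"
        unfolding F_def p_def by (intro compression_energy[OF ab \<zeta>(1) \<zeta>(1) \<zeta>_le]) auto
    qed
    also have "\<dots> = (\<Sum>j<m. F j a) + (\<Sum>j<m. integral {a..b} (\<lambda>t. 2 * C * p j t))" by (rule sum.distrib)
    also have "(\<Sum>j<m. F j a) \<le> compression a (\<alpha> a) (\<beta> a)"
    proof -
      have "(\<Sum>j<m. F j a) \<le> compression a (\<zeta> 0 a) (\<zeta> m a)"
        unfolding F_def p_def by (rule compression_partition[OF a, where x = "\<lambda>j. \<zeta> j a"]) (use \<zeta>_le ab in auto)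
      also have "\<dots> \<le> compression a (\<alpha> a) (\<beta> a)"
        unfolding compression_def
        by (intro integral_subset_le neg_v_integrable a) (use \<zeta>(3)[of 0 a] \<zeta>(3)[of m a] ab in auto)
      finally show ?thesis .
    qed
    also have "(\<Sum>j<m. integral {a..b} (\<lambda>t. 2 * C * p j t)) = integral {a..b} (\<lambda>t. \<Sum>j<m. 2 * C * p j t)"
      by (rule Henstock_Kurzweil_Integration.integral_sum[symmetric])
         (auto intro!: integrable_continuous_real continuous_intros pc)
    also have "\<dots> \<le> integral {a..b} (\<lambda>t. C * (L + B))"
    proof (rule Henstock_Kurzweil_Integration.integral_le)
      show "(\<lambda>t. \<Sum>j<m. 2 * C * p j t) integrable_on {a..b}"
        by (auto intro!: integrable_continuous_real continuous_intros pc)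
      fix t assume t: "t \<in> {a..b}"
      have t': "t \<in> {0..T}" using t ab by auto
      have "(\<Sum>j<m. 2 * p j t) \<le> (\<zeta> m t - \<zeta> 0 t) + integral {\<zeta> 0 t..\<zeta> m t} (\<lambda>s. (v t s)\<^sup>2)"
        unfolding p_def by (rule speed_gap_partition[OF t', where x = "\<lambda>j. \<zeta> j t"]) (use \<zeta>_le t in auto)
      also have "\<dots> \<le> L + B"
        using \<zeta>(3)[OF _ t, of 0] \<zeta>(3)[OF _ t, of m] L[OF t] v_sq_Icc(4)[OF t'] by (intro add_mono) auto
      finally have "C * (\<Sum>j<m. 2 * p j t) \<le> C * (L + B)" by (rule mult_left_mono[OF _ C_nonneg])
      moreover have "(\<Sum>j<m. 2 * C * p j t) = C * (\<Sum>j<m. 2 * p j t)"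
        unfolding sum_distrib_left by (intro sum.cong) auto
      ultimately show "(\<Sum>j<m. 2 * C * p j t) \<le> C * (L + B)" by simp
    qed (rule integrable_const_ivl)
    also have "\<dots> = C * (L + B) * (b - a)" using ab by simp
    finally show ?thesis by simp
  qed
  have "(\<lambda>n. \<Sum>j<2 ^ n. (max (- slope (w b) (\<alpha> b) (\<beta> b) n j) 0)\<^sup>2 * ((\<beta> b - \<alpha> b) / 2 ^ n)) \<longlonglongrightarrow> compression b (\<alpha> b) (\<beta> b)"
    unfolding compression_def
    by (rule neg_slope_energy_converges[OF True w_prim[OF b] v_sq_Icc(1)[OF b]])
  then show ?thesis by (rule LIMSEQ_le_const2) (use bound in blast)
qed

text \<open>A dyadic sum that is close to the energy at \<open>t0\<close> is continuous in time when the partition moves affinely with the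
  end points, and it bounds the energy from below at every time.\<close>

lemma compression_lower_semicontinuous:
  assumes t0: "t0 \<in> {0..T}" and S: "S \<subseteq> {0..T}" and \<alpha>: "(\<alpha> \<longlongrightarrow> \<alpha> t0) (at t0 within S)" and \<beta>: "(\<beta> \<longlongrightarrow> \<beta> t0) (at t0 within S)"
    and lt: "\<alpha> t0 < \<beta> t0" and e: "e < compression t0 (\<alpha> t0) (\<beta> t0)"
  shows "\<forall>\<^sub>F t in at t0 within S. e < compression t (\<alpha> t) (\<beta> t)"
proof -
  define E where "E n t = (\<Sum>j<2 ^ n. (max (- slope (w t) (\<alpha> t) (\<beta> t) n j) 0)\<^sup>2 * ((\<beta> t - \<alpha> t) / 2 ^ n))" for n t
  have "(\<lambda>n. E n t0) \<longlonglongrightarrow> compression t0 (\<alpha> t0) (\<beta> t0)"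
    unfolding compression_def E_def
    by (rule neg_slope_energy_converges[OF lt w_prim[OF t0] v_sq_Icc(1)[OF t0]])
  then obtain n where n: "e < E n t0"
    using order_tendstoD(1)[OF _ e] eventually_happens'[OF sequentially_bot] by blast
  have inS: "\<forall>\<^sub>F t in at t0 within S. t \<in> S" by (simp add: eventually_at_filter)
  have wlim: "((\<lambda>t. w t (c t)) \<longlongrightarrow> w t0 l) (at t0 within S)" if "(c \<longlongrightarrow> l) (at t0 within S)" for c l
  proof -
    have "((\<lambda>s. (s, c s)) \<longlongrightarrow> (t0, l)) (at t0 within S)" by (intro tendsto_intros that)
    then have "((\<lambda>s. (\<lambda>(t, x). w t x) (s, c s)) \<longlongrightarrow> (\<lambda>(t, x). w t x) (t0, l)) (at t0 within S)"
      by (rule continuous_on_tendsto_compose[OF w_cont]) (use t0 S in \<open>auto intro!: eventually_mono[OF inS]\<close>)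
    then show ?thesis by simp
  qed
  have nlim: "((\<lambda>t. node (\<alpha> t) (\<beta> t) n j) \<longlongrightarrow> node (\<alpha> t0) (\<beta> t0) n j) (at t0 within S)" for j
    unfolding node_def by (intro tendsto_intros \<alpha> \<beta>) auto
  have "((\<lambda>t. E n t) \<longlongrightarrow> E n t0) (at t0 within S)"
    unfolding E_def slope_def using lt by (intro tendsto_intros wlim nlim \<alpha> \<beta>) auto
  then have ev1: "\<forall>\<^sub>F t in at t0 within S. e < E n t" using n by (rule order_tendstoD)
  have "((\<lambda>t. \<beta> t - \<alpha> t) \<longlongrightarrow> \<beta> t0 - \<alpha> t0) (at t0 within S)" by (intro tendsto_intros \<alpha> \<beta>)
  then have ev2: "\<forall>\<^sub>F t in at t0 within S. 0 < \<beta> t - \<alpha> t" using lt by (intro order_tendstoD(1)) auto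
  show ?thesis using ev1 ev2 inS
  proof eventually_elim
    case (elim t)
    define h where "h = (\<beta> t - \<alpha> t) / 2 ^ n"
    define x where "x = node (\<alpha> t) (\<beta> t) n"
    have h: "h > 0" using elim by (simp add: h_def)
    have hx: "x (Suc j) - x j = h" for j unfolding x_def h_def by (simp add: node_Suc)
    have "E n t = (\<Sum>j<2 ^ n. (max (- (w t (x (Suc j)) - w t (x j))) 0)\<^sup>2 / (x (Suc j) - x j))"
      unfolding E_def hx h_def[symmetric]
    proof (intro sum.cong refl)
      fix j
      define d where "d = w t (x (Suc j)) - w t (x j)"
      have "slope (w t) (\<alpha> t) (\<beta> t) n j = d / h" by (simp add: slope_def d_def x_def h_def)
      moreover have "max (- (d / h)) 0 = max (- d) 0 / h" using h by (simp add: max_divide_distrib_right)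
      ultimately show "(max (- slope (w t) (\<alpha> t) (\<beta> t) n j) 0)\<^sup>2 * h = (max (- (w t (x (Suc j)) - w t (x j))) 0)\<^sup>2 / h"
        using h by (simp add: d_def[symmetric] power2_eq_square)
    qed
    also have "\<dots> \<le> compression t (x 0) (x (2 ^ n))"
    proof (rule compression_partition)
      show "t \<in> {0..T}" using S elim by blast
      show "x j \<le> x (Suc j)" for j using hx[of j] h by linarith
    qed
    finally show ?case using elim by (simp add: x_def node_0 node_top)
  qed
qed

end

section \<open>Functions of finite energy on the real line\<close>

lemma integrable_if_bounded_on_Icc:
  fixes \<phi> :: "real \<Rightarrow> real"
  assumes [measurable]: "\<phi> \<in> borel_measurable borel" and nn: "\<And>x. 0 \<le> \<phi> x"
    and int: "\<And>N::nat. set_integrable lborel {- real N..real N} \<phi>"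
    and le: "\<And>N::nat. integral {- real N..real N} \<phi> \<le> B"
  shows "integrable lborel \<phi>" "(LINT x|lborel. \<phi> x) \<le> B"
proof -
  have B: "B \<ge> 0" using le[of 0] by simp
  have "(\<integral>\<^sup>+x. ennreal (\<phi> x) \<partial>lborel) = (\<integral>\<^sup>+x. liminf (\<lambda>N. ennreal (indicator {- real N..real N} x *\<^sub>R \<phi> x)) \<partial>lborel)"
  proof (rule nn_integral_cong)
    fix x :: real
    obtain m :: nat where "\<bar>x\<bar> \<le> real m" using real_arch_simple by blast
    then have "\<forall>N\<ge>m. ennreal (indicator {- real N..real N} x *\<^sub>R \<phi> x) = ennreal (\<phi> x)"
      by (auto simp: indicator_def)
    then have "(\<lambda>N. ennreal (indicator {- real N..real N} x *\<^sub>R \<phi> x)) \<longlonglongrightarrow> ennreal (\<phi> x)"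
      by (intro tendsto_eventually) (auto simp: eventually_sequentially)
    from lim_imp_Liminf[OF sequentially_bot this]
    show "ennreal (\<phi> x) = liminf (\<lambda>N. ennreal (indicator {- real N..real N} x *\<^sub>R \<phi> x))" by (rule sym)
  qed
  also have "\<dots> \<le> liminf (\<lambda>N. \<integral>\<^sup>+x. ennreal (indicator {- real N..real N} x *\<^sub>R \<phi> x) \<partial>lborel)"
    by (rule nn_integral_liminf) measurable
  also have "\<dots> \<le> ennreal B"
  proof (rule Liminf_le[OF _ always_eventually], safe)
    fix N :: nat
    have "(\<integral>\<^sup>+x. ennreal (indicator {- real N..real N} x *\<^sub>R \<phi> x) \<partial>lborel) = ennreal (LINT x|lborel. indicator {- real N..real N} x *\<^sub>R \<phi> x)"
      using int[of N] nn unfolding set_integrable_def by (intro nn_integral_eq_integral) auto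
    also have "(LINT x|lborel. indicator {- real N..real N} x *\<^sub>R \<phi> x) = integral {- real N..real N} \<phi>"
      using set_borel_integral_eq_integral(2)[OF int[of N]] by (simp add: set_lebesgue_integral_def)
    finally show "(\<integral>\<^sup>+x. ennreal (indicator {- real N..real N} x *\<^sub>R \<phi> x) \<partial>lborel) \<le> ennreal B"
      using le[of N] by (simp add: ennreal_leI)
  qed simp
  finally have f: "(\<integral>\<^sup>+x. ennreal (\<phi> x) \<partial>lborel) \<le> ennreal B" .
  show i: "integrable lborel \<phi>"
    by (rule integrableI_bounded) (use f nn in \<open>auto simp: top_unique less_top[symmetric]\<close>)
  show "(LINT x|lborel. \<phi> x) \<le> B"
    using f nn_integral_eq_integral[OF i] nn B by simp
qed

lemma AE_eq_if_AE_eq_on_Icc: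
  fixes f g :: "real \<Rightarrow> 'a"
  assumes "\<And>N::nat. AE x in lborel. x \<in> {- real N..real N} \<longrightarrow> f x = g x"
  shows "AE x in lborel. f x = g x"
proof -
  have "AE x in lborel. \<forall>N::nat. x \<in> {- real N..real N} \<longrightarrow> f x = g x"
    unfolding AE_all_countable using assms by blast
  then show ?thesis
  proof eventually_elim
    case (elim x)
    obtain m :: nat where "\<bar>x\<bar> \<le> real m" using real_arch_simple by blast
    then show ?case using elim[rule_format, of m] by (auto simp: abs_le_iff)
  qed
qed

lemma is_primitive_unique:
  assumes "is_primitive f g" "is_primitive f g'"
  shows "AE x in lborel. g x = g' x"
proof (rule AE_eq_if_AE_eq_on_Icc)
  fix N :: nat
  show "AE x in lborel. x \<in> {- real N..real N} \<longrightarrow> g x = g' x"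
  proof (rule interval_integrals_determine_function)
    show "set_integrable lborel {- real N..real N} g" "set_integrable lborel {- real N..real N} g'"
      using assms by (simp_all add: is_primitive_def locally_integrable_def)
    show "integral {x..y} g = integral {x..y} g'" if "x \<le> y" for x y
      using assms that by (simp add: is_primitive_def)
  qed
qed

text \<open>The derivatives on growing intervals, provided by the criterion of Riesz, agree almost everywhere where they overlap and
  are glued together.\<close>

lemma finite_energy_imp_primitive:
  fixes f :: "real \<Rightarrow> real"
  assumes cont: "continuous_on UNIV f" and bound: "\<And>a b n. a < b \<Longrightarrow> dyadic_energy f a b n \<le> B"
  shows "\<exists>g. is_primitive f g \<and> integrable lborel (\<lambda>x. (g x)\<^sup>2) \<and> (LINT x|lborel. (g x)\<^sup>2) \<le> B"
proof -
  define P where "P N g \<longleftrightarrow> g \<in> borel_measurable borel \<and> set_integrable lborel {- real (Suc N)..real (Suc N)} g \<and>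
     set_integrable lborel {- real (Suc N)..real (Suc N)} (\<lambda>s. (g s)\<^sup>2) \<and>
     (\<forall>x y. - real (Suc N) \<le> x \<longrightarrow> x \<le> y \<longrightarrow> y \<le> real (Suc N) \<longrightarrow> f y - f x = integral {x..y} g) \<and>
     integral {- real (Suc N)..real (Suc N)} (\<lambda>s. (g s)\<^sup>2) \<le> B" for N and g :: "real \<Rightarrow> real"
  have "\<exists>g. P N g" for N
  proof -
    have ab: "- real (Suc N) < real (Suc N)" by simp
    show ?thesis
      using riesz_dyadic[OF ab continuous_on_subset[OF cont subset_UNIV] bound[OF ab]] unfolding P_def by blast
  qed
  then obtain G where G: "\<And>N. P N (G N)" using choice[of P] by blast
  have Gm[measurable]: "G N \<in> borel_measurable borel"
    and Gi: "set_integrable lborel {- real (Suc N)..real (Suc N)} (G N)"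
    and G2: "set_integrable lborel {- real (Suc N)..real (Suc N)} (\<lambda>s. (G N s)\<^sup>2)"
    and Gf: "\<And>x y. - real (Suc N) \<le> x \<Longrightarrow> x \<le> y \<Longrightarrow> y \<le> real (Suc N) \<Longrightarrow> f y - f x = integral {x..y} (G N)"
    and GB: "integral {- real (Suc N)..real (Suc N)} (\<lambda>s. (G N s)\<^sup>2) \<le> B" for N
    using G[of N] unfolding P_def by blast+
  have GG: "AE x in lborel. x \<in> {- real (Suc M)..real (Suc M)} \<longrightarrow> G M x = G N x" if "M \<le> N" for M N
  proof (rule interval_integrals_determine_function[OF Gi])
    show "set_integrable lborel {- real (Suc M)..real (Suc M)} (G N)"
      by (rule set_integrable_subset[OF Gi[of N]]) (use that in auto)
    show "integral {x..y} (G M) = integral {x..y} (G N)"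
      if "- real (Suc M) \<le> x" "x \<le> y" "y \<le> real (Suc M)" for x y
      using Gf[of M x y] Gf[of N x y] that \<open>M \<le> N\<close> by simp
  qed
  have "AE x in lborel. \<forall>M N. M \<le> N \<longrightarrow> x \<in> {- real (Suc M)..real (Suc M)} \<longrightarrow> G M x = G N x"
    unfolding AE_all_countable
  proof (intro allI)
    fix M N show "AE x in lborel. M \<le> N \<longrightarrow> x \<in> {- real (Suc M)..real (Suc M)} \<longrightarrow> G M x = G N x"
      using GG[of M N] by (cases "M \<le> N") auto
  qed
  \<comment> \<open>An index with \<open>\<bar>x\<bar> \<le> k x\<close> that is at most \<open>N\<close> on \<open>{- real N..real N}\<close>.\<close>
  moreover define k where "k x = nat \<lceil>\<bar>x\<bar>\<rceil>" for x :: real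
  define g where "g x = G (k x) x" for x
  ultimately have gG: "AE x in lborel. x \<in> {- real N..real N} \<longrightarrow> g x = G N x" for N
  proof eventually_elim
    case (elim x)
    show ?case
    proof -
      have x: "x \<in> {- real N..real N}" by (rule elim(2))
      then have "k x \<le> N" unfolding k_def by (simp add: nat_le_iff ceiling_le_iff abs_le_iff)
      moreover have "x \<in> {- real (Suc (k x))..real (Suc (k x))}"
      proof -
        have "\<bar>x\<bar> \<le> real (k x)" unfolding k_def by (simp add: real_nat_ceiling_ge)
        then show ?thesis by auto
      qed
      ultimately show "g x = G N x" using elim(1) by (simp add: g_def)
    qed
  qed
  have gm[measurable]: "g \<in> borel_measurable borel"
    unfolding g_def by (rule measurable_compose_countable[where f = G]) (simp_all add: k_def)
  have sub: "set_integrable lborel {- real N..real N} (\<lambda>s. \<Phi> (G N s))"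
    if "set_integrable lborel {- real (Suc N)..real (Suc N)} (\<lambda>s. \<Phi> (G N s))" for N and \<Phi> :: "real \<Rightarrow> real"
    by (rule set_integrable_subset[OF that]) auto
  have transfer: "set_integrable lborel A (\<lambda>s. \<Phi> (g s))" "(LINT s:A|lborel. \<Phi> (g s)) = (LINT s:A|lborel. \<Phi> (G N s))"
    if A: "A \<subseteq> {- real N..real N}" "A \<in> sets borel" and i: "set_integrable lborel {- real (Suc N)..real (Suc N)} (\<lambda>s. \<Phi> (G N s))"
      and [measurable]: "\<Phi> \<in> borel_measurable borel" for A N and \<Phi> :: "real \<Rightarrow> real"
  proof -
    note [measurable] = A(2)
    have iA: "set_integrable lborel A (\<lambda>s. \<Phi> (G N s))" by (rule set_integrable_subset[OF i]) (use A in auto)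
    have ae: "AE s in lborel. indicator A s *\<^sub>R \<Phi> (G N s) = indicator A s *\<^sub>R \<Phi> (g s)"
      using gG[of N] by eventually_elim (use A in \<open>auto simp: indicator_def\<close>)
    show "set_integrable lborel A (\<lambda>s. \<Phi> (g s))"
      using iA unfolding set_integrable_def by (rule integrable_cong_AE_imp) (use ae in auto)
    show "(LINT s:A|lborel. \<Phi> (g s)) = (LINT s:A|lborel. \<Phi> (G N s))"
      unfolding set_lebesgue_integral_def by (rule integral_cong_AE) (use ae in auto)
  qed
  have g1: "set_integrable lborel {x..y} g" "f y - f x = integral {x..y} g" if "x \<le> y" for x y
  proof -
    obtain N :: nat where N: "\<bar>x\<bar> + \<bar>y\<bar> \<le> real N" using real_arch_simple by blast
    have s: "{x..y} \<subseteq> {- real N..real N}" using N by auto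
    note tr = transfer[of "{x..y}" N "\<lambda>x. x", OF s _ Gi[of N]]
    show i: "set_integrable lborel {x..y} g" using tr by simp
    have "integral {x..y} g = integral {x..y} (G N)"
      using tr(2) set_borel_integral_eq_integral(2)[OF i] set_borel_integral_eq_integral(2)[OF set_integrable_subset[OF Gi[of N]], of "{x..y}"] s by auto
    then show "f y - f x = integral {x..y} g" using Gf[of N x y] that N by auto
  qed
  have "set_integrable lborel {a..b} g" for a b using g1(1)[of a b] by (cases "a \<le> b") (auto simp: set_integrable_def)
  then have "is_primitive f g" using g1(2) by (simp add: is_primitive_def locally_integrable_def)
  moreover have "integrable lborel (\<lambda>x. (g x)\<^sup>2)" "(LINT x|lborel. (g x)\<^sup>2) \<le> B"
  proof -
    have i: "set_integrable lborel {- real N..real N} (\<lambda>s. (g s)\<^sup>2)"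
      and eq: "(LINT s:{- real N..real N}|lborel. (g s)\<^sup>2) = (LINT s:{- real N..real N}|lborel. (G N s)\<^sup>2)" for N
      using transfer[of "{- real N..real N}" N "\<lambda>x. x\<^sup>2"] G2[of N] by auto
    have le: "integral {- real N..real N} (\<lambda>s. (g s)\<^sup>2) \<le> B" for N
    proof -
      have G2': "set_integrable lborel {- real N..real N} (\<lambda>s. (G N s)\<^sup>2)"
        by (rule set_integrable_subset[OF G2]) auto
      have "integral {- real N..real N} (\<lambda>s. (g s)\<^sup>2) = integral {- real N..real N} (\<lambda>s. (G N s)\<^sup>2)"
        using eq set_borel_integral_eq_integral(2)[OF i] set_borel_integral_eq_integral(2)[OF G2'] by simp
      also have "\<dots> \<le> integral {- real (Suc N)..real (Suc N)} (\<lambda>s. (G N s)\<^sup>2)"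
        using set_borel_integral_eq_integral(1)[OF G2'] set_borel_integral_eq_integral(1)[OF G2[of N]]
        by (intro integral_subset_le) auto
      also have "\<dots> \<le> B" by (rule GB)
      finally show ?thesis .
    qed
    show "integrable lborel (\<lambda>x. (g x)\<^sup>2)" "(LINT x|lborel. (g x)\<^sup>2) \<le> B"
      using integrable_if_bounded_on_Icc[of "\<lambda>x. (g x)\<^sup>2" B] i le by auto
  qed
  ultimately show ?thesis by blast
qed

lemma integrable_times_test_fun:
  assumes \<psi>: "test_fun U \<psi>" and g: "locally_integrable g"
  shows "integrable lborel (\<lambda>x. g x * \<psi> x)"
proof -
  obtain K where K: "compact K" "\<And>x. x \<notin> K \<Longrightarrow> \<psi> x = 0" using \<psi> by (auto simp: test_fun_def)
  obtain R where R: "\<And>x. x \<in> K \<Longrightarrow> \<bar>x\<bar> \<le> R" using compact_imp_bounded[OF K(1)] by (auto simp: bounded_iff)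
  have z: "\<psi> x = 0" if "x \<notin> {- R..R}" for x using that R[of x] by (intro K(2)) auto
  have l: "locally_integrable (\<lambda>x. \<psi> x * g x)"
    by (rule locally_integrable_mult_continuous[OF test_fun_deriv_real(3)[OF \<psi>] g])
  have "(\<lambda>x. indicator {- R..R} x *\<^sub>R (\<psi> x * g x)) = (\<lambda>x. g x * \<psi> x)"
  proof
    fix x show "indicator {- R..R} x *\<^sub>R (\<psi> x * g x) = g x * \<psi> x"
      by (cases "x \<in> {- R..R}") (simp_all add: z mult.commute)
  qed
  then show ?thesis using locally_integrableD(1)[OF l, of "- R" R] unfolding set_integrable_def by simp
qed

lemma test_fun_deriv_support:
  fixes \<psi> :: "real \<Rightarrow> real"
  assumes "test_fun U \<psi>"
  shows "\<exists>K. compact K \<and> K \<subseteq> U \<and> (\<forall>x. x \<notin> K \<longrightarrow> \<psi> x = 0 \<and> deriv \<psi> x = 0)"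
proof -
  obtain K where K: "compact K" "K \<subseteq> U" "\<And>x. x \<notin> K \<Longrightarrow> \<psi> x = 0" using assms by (auto simp: test_fun_def)
  have "deriv \<psi> x = 0" if "x \<notin> K" for x
  proof -
    have "\<forall>\<^sub>F y in nhds x. \<psi> y = 0"
    proof (rule eventually_mono[OF eventually_nhds_in_open])
      show "open (- K)" using K(1) by (simp add: compact_imp_closed open_Compl)
      show "x \<in> - K" using that by simp
    qed (use K(3) in blast)
    then have "(\<psi> has_real_derivative 0) (at x)" by (subst DERIV_cong_ev[OF refl _ refl, of _ "\<lambda>_. 0"]) auto
    then show ?thesis by (rule DERIV_imp_deriv)
  qed
  with K show ?thesis by blast
qed

text \<open>The kernel jumps by \<open>1\<close> at the origin and is otherwise Lipschitz with constant \<open>1/2\<close>.\<close>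

lemma CH_kernel_increment:
  fixes x y z :: real
  assumes "x < z"
  shows "indicator {x<..<z} y - (z - x) / 2
    \<le> 1/2 * sgn (z - y) * exp (- \<bar>z - y\<bar>) - 1/2 * sgn (x - y) * exp (- \<bar>x - y\<bar>)"
proof -
  have e: "exp (- p) \<ge> 1 - p" for p :: real using exp_ge_add_one_self[of "- p"] by simp
  have d: "exp (- p) - exp (- (p + h)) \<le> h" if "p \<ge> 0" "h \<ge> 0" for p h :: real
  proof -
    have "exp (- p) - exp (- (p + h)) = exp (- p) * (1 - exp (- h))" by (simp add: exp_add[symmetric] algebra_simps)
    also have "\<dots> \<le> 1 * h" using e[of h] that by (intro mult_mono) auto
    finally show ?thesis by simp
  qed
  consider "y < x" | "y = x" | "x < y" "y < z" | "y = z" | "y > z" by linarith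
  then show ?thesis
  proof cases
    case 1
    then show ?thesis using d[of "x - y" "z - x"] assms by (simp add: indicator_def field_simps)
  next
    case 2
    show ?thesis by (rule order_trans[of _ 0]) (use 2 assms in \<open>auto simp: indicator_def\<close>)
  next
    case 3
    then show ?thesis using e[of "z - y"] e[of "y - x"] assms by (simp add: indicator_def field_simps)
  next
    case 4
    show ?thesis by (rule order_trans[of _ 0]) (use 4 assms in \<open>auto simp: indicator_def\<close>)
  next
    case 5
    then show ?thesis using d[of "y - z" "z - x"] assms by (simp add: indicator_def field_simps)
  qed
qed

lemma CH_kernel_bounded: "\<bar>1/2 * sgn r * exp (- \<bar>r\<bar>)\<bar> \<le> 1/2" for r :: real
proof -
  have "\<bar>sgn r\<bar> * exp (- \<bar>r\<bar>) \<le> 1 * 1" by (intro mult_mono) (auto simp: sgn_if)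
  then show ?thesis by (simp add: abs_mult)
qed

section \<open>Energy and source of a weak solution\<close>

lemma AE_imp_dense_times:
  fixes t :: real
  assumes "AE s in lborel. P s"
  shows "\<exists>s::nat \<Rightarrow> real. (\<forall>n. t < s n \<and> P (s n)) \<and> s \<longlonglongrightarrow> t"
proof -
  have "\<exists>s. t < s \<and> s < t + 1 / real (Suc n) \<and> P s" for n
  proof (rule ccontr)
    assume H: "\<nexists>s. t < s \<and> s < t + 1 / real (Suc n) \<and> P s"
    have "AE s in lborel. s \<notin> {t<..<t + 1 / real (Suc n)}"
      using assms by eventually_elim (use H in auto)
    then have "{t<..<t + 1 / real (Suc n)} \<in> null_sets lborel" by (subst AE_iff_null_sets) auto
    then have "emeasure lborel {t<..<t + 1 / real (Suc n)} = 0" by auto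
    then show False by (simp add: emeasure_lborel_Ioo del: of_nat_Suc)
  qed
  then obtain s where s: "\<And>n. t < s n" "\<And>n. s n < t + 1 / real (Suc n)" "\<And>n. P (s n)" by metis
  have "(\<lambda>n. t + 1 / real (Suc n)) \<longlonglongrightarrow> t + 0" by (intro tendsto_intros LIMSEQ_Suc[OF lim_1_over_n])
  then have lim: "(\<lambda>n. t + 1 / real (Suc n)) \<longlonglongrightarrow> t" by simp
  have "\<forall>n. t \<le> s n" "\<forall>n. s n \<le> t + 1 / real (Suc n)" using s less_imp_le by blast+
  then have "s \<longlonglongrightarrow> t"
    by (intro tendsto_sandwich[OF always_eventually always_eventually tendsto_const lim])
  with s show ?thesis by blast
qed

lemma weak_solution_slice_continuous:
  assumes "weak_solution u0 u" "0 \<le> t" shows "continuous_on UNIV (u t)"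
proof -
  have "continuous_on UNIV (\<lambda>x. (\<lambda>(t, x). u t x) (t, x))"
    by (rule continuous_on_compose2[where t = "{0..} \<times> UNIV"])
       (use assms in \<open>auto simp: weak_solution_def intro: continuous_on_Pair continuous_on_const continuous_on_id\<close>)
  then show ?thesis by simp
qed

lemma has_weak_deriv_dx:
  assumes "continuous_on UNIV (u t)" "\<exists>g. has_weak_deriv (u t) g"
  shows "is_primitive (u t) (dx u t)"
proof (rule has_weak_deriv_imp_is_primitive[OF _ assms(1)])
  show "has_weak_deriv (u t) (dx u t)" unfolding dx_def using assms(2) by (rule someI_ex)
qed

definition finite_energy :: "(real \<Rightarrow> real \<Rightarrow> real) \<Rightarrow> real \<Rightarrow> real \<Rightarrow> bool" where
  "finite_energy u M t \<longleftrightarrow> is_primitive (u t) (dx u t) \<and>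
     integrable lborel (\<lambda>x. (u t x)\<^sup>2) \<and> (LINT x|lborel. (u t x)\<^sup>2) \<le> M \<and>
     integrable lborel (\<lambda>x. (dx u t x)\<^sup>2) \<and> (LINT x|lborel. (dx u t x)\<^sup>2) \<le> 2 * M"

lemma weak_solution_energy_ae:
  assumes u: "weak_solution u0 u"
  shows "\<exists>M\<ge>0. AE t in lborel. 0 \<le> t \<longrightarrow> finite_energy u M t"
proof -
  obtain M where M: "AE t in lborel. 0 \<le> t \<longrightarrow> (LINT x|lborel. energy_density u t x) \<le> M"
    using u by (auto simp: weak_solution_def)
  have good: "AE t in lborel. 0 \<le> t \<longrightarrow> (\<exists>g. has_weak_deriv (u t) g) \<and> integrable lborel (energy_density u t)"
    using u by (auto simp: weak_solution_def)
  have "AE t in lborel. 0 \<le> t \<longrightarrow> finite_energy u \<bar>M\<bar> t"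
    using M good
  proof eventually_elim
    case (elim t)
    show ?case
    proof (intro impI)
      assume t: "0 \<le> t"
      have c: "continuous_on UNIV (u t)" by (rule weak_solution_slice_continuous[OF u t])
      have p: "is_primitive (u t) (dx u t)" using has_weak_deriv_dx[where u = u and t = t, OF c] elim t by blast
      have i: "integrable lborel (energy_density u t)" "(LINT x|lborel. energy_density u t x) \<le> \<bar>M\<bar>" using elim t by auto
      have [measurable]: "u t \<in> borel_measurable borel" "dx u t \<in> borel_measurable borel"
        using c p by (auto intro: borel_measurable_continuous_onI locally_integrable_measurable simp: is_primitive_def)
      have i1: "integrable lborel (\<lambda>x. (u t x)\<^sup>2)"
        by (rule Bochner_Integration.integrable_bound[OF i(1)]) (auto simp: energy_density_def)
      have i2: "integrable lborel (\<lambda>x. (dx u t x)\<^sup>2)"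
        by (rule Bochner_Integration.integrable_bound[OF integrable_mult_right[OF i(1), of 2]]) (auto simp: energy_density_def)
      have "(LINT x|lborel. (u t x)\<^sup>2) \<le> (LINT x|lborel. energy_density u t x)"
        by (rule integral_mono[OF i1 i(1)]) (simp add: energy_density_def)
      moreover have "(LINT x|lborel. (dx u t x)\<^sup>2) \<le> (LINT x|lborel. 2 * energy_density u t x)"
        by (rule integral_mono[OF i2 integrable_mult_right[OF i(1)]]) (simp add: energy_density_def)
      ultimately show "finite_energy u \<bar>M\<bar> t"
        using p i1 i2 i(2) unfolding finite_energy_def by auto
    qed
  qed
  then show ?thesis by (intro exI[of _ "\<bar>M\<bar>"]) auto
qed

text \<open>The bounds hold at almost every time, hence at times \<open>s n\<close> that tend to a given \<open>t\<close>. Since \<open>u\<close> is continuous, bounds on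
  the energies of difference quotients and on the integrals of \<open>u\<^sup>2\<close> over bounded intervals pass to the limit, and they imply
  that \<open>u t\<close> has a square-integrable derivative. In particular \<open>dx u t\<close> is a derivative of \<open>u t\<close> at all times.\<close>

lemma weak_solution_energy:
  assumes u: "weak_solution u0 u"
  shows "\<exists>M\<ge>0. \<forall>t\<ge>0. finite_energy u M t"
proof -
  obtain M where M: "M \<ge> 0" and ae: "AE t in lborel. 0 \<le> t \<longrightarrow> finite_energy u M t"
    using weak_solution_energy_ae[OF u] by blast
  have uc: "continuous_on ({0..} \<times> UNIV) (\<lambda>(t, x). u t x)" using u by (simp add: weak_solution_def)
  have "finite_energy u M t" if t: "0 \<le> t" for t
  proof -
    obtain s :: "nat \<Rightarrow> real" where st: "\<And>n. t < s n" "s \<longlonglongrightarrow> t"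
      and s: "\<And>n. is_primitive (u (s n)) (dx u (s n))" "\<And>n. integrable lborel (\<lambda>x. (u (s n) x)\<^sup>2)" "\<And>n. (LINT x|lborel. (u (s n) x)\<^sup>2) \<le> M"
       "\<And>n. integrable lborel (\<lambda>x. (dx u (s n) x)\<^sup>2)" "\<And>n. (LINT x|lborel. (dx u (s n) x)\<^sup>2) \<le> 2 * M"
    proof -
      obtain s :: "nat \<Rightarrow> real" where s: "\<And>n. t < s n" "s \<longlonglongrightarrow> t" and P: "\<And>n. 0 \<le> s n \<longrightarrow> finite_energy u M (s n)"
        using AE_imp_dense_times[OF ae, of t] by blast
      have "0 \<le> s n" for n using s(1)[of n] t by simp
      then show thesis using that s P unfolding finite_energy_def by blast
    qed
    have c: "continuous_on UNIV (u t)" by (rule weak_solution_slice_continuous[OF u t])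
    have [measurable]: "u t \<in> borel_measurable borel" using c by (rule borel_measurable_continuous_onI)
    have ptw: "(\<lambda>n. u (s n) x) \<longlonglongrightarrow> u t x" for x
    proof -
      have "(\<lambda>n. (s n, x)) \<longlonglongrightarrow> (t, x)" by (intro tendsto_intros st)
      then have "(\<lambda>n. (\<lambda>(t, x). u t x) (s n, x)) \<longlonglongrightarrow> (\<lambda>(t, x). u t x) (t, x)"
        by (rule continuous_on_tendsto_compose[OF uc]) (use st(1) t in \<open>auto intro!: always_eventually intro: less_imp_le order_trans\<close>)
      then show ?thesis by simp
    qed
    have E: "dyadic_energy (u t) a b n \<le> 2 * M" if ab: "a < b" for a b n
    proof (rule LIMSEQ_le_const2)
      show "(\<lambda>k. dyadic_energy (u (s k)) a b n) \<longlonglongrightarrow> dyadic_energy (u t) a b n"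
        unfolding dyadic_energy_def slope_def using ab by (intro tendsto_intros ptw) auto
      have "dyadic_energy (u (s k)) a b n \<le> 2 * M" for k
      proof -
        have i: "set_integrable lborel {a..b} (\<lambda>x. (dx u (s k) x)\<^sup>2)"
          unfolding set_integrable_def by (rule integrable_mult_indicator[OF _ s(4)]) simp
        have "dyadic_energy (u (s k)) a b n \<le> integral {a..b} (\<lambda>x. (dx u (s k) x)\<^sup>2)"
          by (rule dyadic_energy_le[OF ab s(1) i])
        also have "\<dots> = (LINT x:{a..b}|lborel. (dx u (s k) x)\<^sup>2)" by (rule set_borel_integral_eq_integral(2)[OF i, symmetric])
        also have "\<dots> \<le> (LINT x|lborel. (dx u (s k) x)\<^sup>2)"
          unfolding set_lebesgue_integral_def
          by (rule integral_mono[OF i[unfolded set_integrable_def] s(4)]) (simp add: indicator_def)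
        finally show ?thesis using s(5)[of k] by simp
      qed
      then show "\<exists>N. \<forall>k\<ge>N. dyadic_energy (u (s k)) a b n \<le> 2 * M" by blast
    qed
    obtain g where g: "is_primitive (u t) g" "integrable lborel (\<lambda>x. (g x)\<^sup>2)" "(LINT x|lborel. (g x)\<^sup>2) \<le> 2 * M"
      using finite_energy_imp_primitive[OF c E] by blast
    have p: "is_primitive (u t) (dx u t)"
      using has_weak_deriv_dx[where u = u and t = t, OF c] is_primitive_imp_has_weak_deriv[OF g(1)] by blast
    have [measurable]: "g \<in> borel_measurable borel" "dx u t \<in> borel_measurable borel"
      using g(1) p by (auto intro: locally_integrable_measurable simp: is_primitive_def)
    have ae: "AE x in lborel. (g x)\<^sup>2 = (dx u t x)\<^sup>2"
      using is_primitive_unique[OF g(1) p] by eventually_elim simp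
    have i2: "integrable lborel (\<lambda>x. (dx u t x)\<^sup>2)"
      by (rule integrable_cong_AE_imp[OF g(2)]) (use ae in auto)
    have "(LINT x|lborel. (dx u t x)\<^sup>2) = (LINT x|lborel. (g x)\<^sup>2)"
      by (rule integral_cong_AE) (use ae in auto)
    then have l2: "(LINT x|lborel. (dx u t x)\<^sup>2) \<le> 2 * M" using g(3) by simp
    have i1: "integrable lborel (\<lambda>x. (u t x)\<^sup>2)" "(LINT x|lborel. (u t x)\<^sup>2) \<le> M"
    proof -
      have si: "set_integrable lborel {- real N..real N} (\<lambda>x. (u r x)\<^sup>2)" if "0 \<le> r" for r N
        by (intro borel_integrable_atLeastAtMost' continuous_intros continuous_on_subset[OF weak_solution_slice_continuous[OF u that]]) auto
      have le: "integral {- real N..real N} (\<lambda>x. (u t x)\<^sup>2) \<le> M" for N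
      proof (rule LIMSEQ_le_const2)
        have "continuous_on {0..} (\<lambda>r. integral (cbox (- real N) (real N)) (\<lambda>x. (u r x)\<^sup>2))"
          by (rule integral_continuous_on_param)
             (use continuous_on_power[OF continuous_on_subset[OF uc, of "{0..} \<times> {- real N..real N}"], of 2] in \<open>auto simp: case_prod_beta\<close>)
        then show "(\<lambda>k. integral {- real N..real N} (\<lambda>x. (u (s k) x)\<^sup>2)) \<longlonglongrightarrow> integral {- real N..real N} (\<lambda>x. (u t x)\<^sup>2)"
          using continuous_on_tendsto_compose[OF _ st(2), of "{0..}" "\<lambda>r. integral {- real N..real N} (\<lambda>x. (u r x)\<^sup>2)"] st(1) t
          by (auto intro!: always_eventually intro: less_imp_le order_trans)
        have "integral {- real N..real N} (\<lambda>x. (u (s k) x)\<^sup>2) \<le> M" for k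
        proof -
          have sk: "0 \<le> s k" using st(1)[of k] t by simp
          have "(LINT x:{- real N..real N}|lborel. (u (s k) x)\<^sup>2) \<le> (LINT x|lborel. (u (s k) x)\<^sup>2)"
            unfolding set_lebesgue_integral_def
            by (rule integral_mono[OF si[OF sk, unfolded set_integrable_def] s(2)]) (simp add: indicator_def)
          then show ?thesis using s(3)[of k] set_borel_integral_eq_integral(2)[OF si[OF sk]] by simp
        qed
        then show "\<exists>K. \<forall>k\<ge>K. integral {- real N..real N} (\<lambda>x. (u (s k) x)\<^sup>2) \<le> M" by blast
      qed
      show "integrable lborel (\<lambda>x. (u t x)\<^sup>2)" "(LINT x|lborel. (u t x)\<^sup>2) \<le> M"
        using integrable_if_bounded_on_Icc[of "\<lambda>x. (u t x)\<^sup>2" M] si[OF t] le by auto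
    qed
    show ?thesis using p i1 i2 l2 unfolding finite_energy_def by blast
  qed
  with M show ?thesis by blast
qed

text \<open>A weak solution together with the bounds that it satisfies at all times; the constant is fixed to avoid repeating its choice.\<close>

locale CH_solution =
  fixes u0 :: "real \<Rightarrow> real" and u :: "real \<Rightarrow> real \<Rightarrow> real" and M :: real
  assumes weak: "weak_solution u0 u" and M_nonneg: "M \<ge> 0"
    and finite_energy: "\<And>t. 0 \<le> t \<Longrightarrow> finite_energy u M t"
begin

lemma prim: "0 \<le> t \<Longrightarrow> is_primitive (u t) (dx u t)"
  and u_sq: "0 \<le> t \<Longrightarrow> integrable lborel (\<lambda>x. (u t x)\<^sup>2)" "0 \<le> t \<Longrightarrow> (LINT x|lborel. (u t x)\<^sup>2) \<le> M"
  and dx_sq: "0 \<le> t \<Longrightarrow> integrable lborel (\<lambda>x. (dx u t x)\<^sup>2)" "0 \<le> t \<Longrightarrow> (LINT x|lborel. (dx u t x)\<^sup>2) \<le> 2 * M"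
  using finite_energy by (simp_all add: finite_energy_def)

lemma u_slice: "0 \<le> t \<Longrightarrow> continuous_on S (u t)"
  by (rule continuous_on_subset[OF weak_solution_slice_continuous[OF weak]]) auto

lemma dx_locally_integrable: "0 \<le> t \<Longrightarrow> locally_integrable (dx u t)"
  using prim by (simp add: is_primitive_def)

lemma energy_density_integrable:
  assumes "0 \<le> t"
  shows "integrable lborel (energy_density u t)" "(LINT x|lborel. energy_density u t x) \<le> 2 * M"
proof -
  show "integrable lborel (energy_density u t)"
    unfolding energy_density_def[abs_def]
    by (intro Bochner_Integration.integrable_add integrable_mult_right u_sq dx_sq assms)
  have "(LINT x|lborel. energy_density u t x) = (LINT x|lborel. (u t x)\<^sup>2) + 1/2 * (LINT x|lborel. (dx u t x)\<^sup>2)"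
    unfolding energy_density_def by (subst Bochner_Integration.integral_add[OF u_sq(1)[OF assms] integrable_mult_right[OF dx_sq(1)[OF assms]]]) simp
  then show "(LINT x|lborel. energy_density u t x) \<le> 2 * M" using u_sq(2)[OF assms] dx_sq(2)[OF assms] by simp
qed

lemma energy_density_nonneg: "0 \<le> energy_density u t x"
  by (simp add: energy_density_def)

lemma source_integrable:
  assumes t: "0 \<le> t"
  shows "integrable lborel (\<lambda>y. 1/2 * sgn (x - y) * exp (- \<bar>x - y\<bar>) * energy_density u t y)"
proof (rule Bochner_Integration.integrable_bound[OF energy_density_integrable(1)[OF t]])
  have [measurable]: "energy_density u t \<in> borel_measurable borel"
    using borel_measurable_integrable[OF energy_density_integrable(1)[OF t]] by simp
  show "(\<lambda>y. 1/2 * sgn (x - y) * exp (- \<bar>x - y\<bar>) * energy_density u t y) \<in> borel_measurable lborel" by measurable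
  have "\<bar>1/2 * sgn (x - y) * exp (- \<bar>x - y\<bar>)\<bar> * energy_density u t y \<le> 1 * energy_density u t y" for y
    by (intro mult_right_mono energy_density_nonneg order_trans[OF CH_kernel_bounded]) simp
  then show "AE y in lborel. norm (1/2 * sgn (x - y) * exp (- \<bar>x - y\<bar>) * energy_density u t y) \<le> norm (energy_density u t y)"
    using energy_density_nonneg by (simp add: abs_mult)
qed

lemma source_bounded:
  assumes t: "0 \<le> t" shows "\<bar>CH_source u t x\<bar> \<le> M"
proof -
  have "norm (CH_source u t x) \<le> (LINT y|lborel. 1/2 * energy_density u t y)"
    unfolding CH_source_def
  proof (rule Bochner_Integration.integral_norm_bound_integral[OF source_integrable[OF t]])
    show "integrable lborel (\<lambda>y. 1/2 * energy_density u t y)" by (intro integrable_mult_right energy_density_integrable t)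
    have "\<bar>1/2 * sgn (x - y) * exp (- \<bar>x - y\<bar>)\<bar> * energy_density u t y \<le> 1/2 * energy_density u t y" for y
      by (intro mult_right_mono energy_density_nonneg CH_kernel_bounded)
    then show "norm (1/2 * sgn (x - y) * exp (- \<bar>x - y\<bar>) * energy_density u t y) \<le> 1/2 * energy_density u t y" for y
      using energy_density_nonneg by (simp add: abs_mult)
  qed
  also have "\<dots> \<le> M" using energy_density_integrable(2)[OF t] by simp
  finally show ?thesis by simp
qed

text \<open>The lower bound on the increment of the source that drives the Riccati inequality: the jump of the kernel
  collects the energy in \<open>{x..z}\<close>, and its Lipschitz part costs \<open>M\<close> times the length.\<close>

lemma source_increment:
  assumes t: "0 \<le> t" and xz: "x < z"
  shows "1/2 * integral {x..z} (\<lambda>y. (dx u t y)\<^sup>2) - M * (z - x) \<le> CH_source u t z - CH_source u t x"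
proof -
  let ?e = "energy_density u t"
  let ?k = "\<lambda>x y. 1/2 * sgn (x - y) * exp (- \<bar>x - y\<bar>) :: real"
  note i = energy_density_integrable(1)[OF t]
  have i1: "integrable lborel (\<lambda>y. indicator {x<..<z} y * ?e y)"
    using integrable_mult_indicator[OF _ i, of "{x<..<z}"] by simp
  have i2: "set_integrable lborel {x..z} (\<lambda>y. (dx u t y)\<^sup>2)"
    unfolding set_integrable_def by (rule integrable_mult_indicator[OF _ dx_sq(1)[OF t]]) simp
  have i3: "integrable lborel (\<lambda>y. 1/2 * (indicator {x..z} y *\<^sub>R (dx u t y)\<^sup>2))"
    using i2 unfolding set_integrable_def by (rule integrable_mult_right)
  have "1/2 * integral {x..z} (\<lambda>y. (dx u t y)\<^sup>2) = (LINT y|lborel. 1/2 * (indicator {x..z} y *\<^sub>R (dx u t y)\<^sup>2))"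
    using set_borel_integral_eq_integral(2)[OF i2] by (simp add: set_lebesgue_integral_def)
  also have "\<dots> \<le> (LINT y|lborel. indicator {x<..<z} y * ?e y)"
  proof (rule integral_mono_AE[OF i3 i1])
    show "AE y in lborel. 1/2 * (indicator {x..z} y *\<^sub>R (dx u t y)\<^sup>2) \<le> indicator {x<..<z} y * ?e y"
      using AE_lborel_singleton[of x] AE_lborel_singleton[of z]
      by eventually_elim (auto simp: indicator_def energy_density_def)
  qed
  finally have 1: "1/2 * integral {x..z} (\<lambda>y. (dx u t y)\<^sup>2) \<le> (LINT y|lborel. indicator {x<..<z} y * ?e y)" .
  have "(z - x) / 2 * (LINT y|lborel. ?e y) \<le> (z - x) / 2 * (2 * M)"
    using xz energy_density_integrable(2)[OF t] by (intro mult_left_mono) auto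
  also have "\<dots> = M * (z - x)" by simp
  finally have 2: "(z - x) / 2 * (LINT y|lborel. ?e y) \<le> M * (z - x)" .
  have "1/2 * integral {x..z} (\<lambda>y. (dx u t y)\<^sup>2) - M * (z - x) \<le> (LINT y|lborel. indicator {x<..<z} y * ?e y) - (z - x) / 2 * (LINT y|lborel. ?e y)"
    by (rule diff_mono[OF 1 2])
  also have "\<dots> = (LINT y|lborel. indicator {x<..<z} y * ?e y - (z - x) / 2 * ?e y)"
    using i1 i by simp
  also have "\<dots> \<le> (LINT y|lborel. ?k z y * ?e y - ?k x y * ?e y)"
  proof (rule integral_mono)
    show "integrable lborel (\<lambda>y. indicator {x<..<z} y * ?e y - (z - x) / 2 * ?e y)"
      by (intro Bochner_Integration.integrable_diff i1 integrable_mult_right i)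
    show "integrable lborel (\<lambda>y. ?k z y * ?e y - ?k x y * ?e y)"
      by (intro Bochner_Integration.integrable_diff source_integrable t)
    show "indicator {x<..<z} y * ?e y - (z - x) / 2 * ?e y \<le> ?k z y * ?e y - ?k x y * ?e y" for y
      using mult_right_mono[OF CH_kernel_increment[OF xz, of y] energy_density_nonneg[of t y]] by (simp add: left_diff_distrib)
  qed
  also have "\<dots> = CH_source u t z - CH_source u t x"
    unfolding CH_source_def by (rule Bochner_Integration.integral_diff[OF source_integrable[OF t] source_integrable[OF t]])
  finally show ?thesis .
qed

end

section \<open>The balance law on fixed intervals\<close>

lemma test_fun_deriv:
  fixes \<psi> :: "real \<Rightarrow> real"
  assumes "test_fun U \<psi>" shows "test_fun U (deriv \<psi>)"
  unfolding test_fun_def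
proof (intro conjI allI)
  show "C_diff k (deriv \<psi>)" for k
    by (rule C_diff_deriv_real(2)) (use assms in \<open>simp only: test_fun_def\<close>)
  show "\<exists>K. compact K \<and> K \<subseteq> U \<and> (\<forall>x. x \<notin> K \<longrightarrow> deriv \<psi> x = 0)"
    using test_fun_deriv_support[OF assms] by blast
qed

lemma test_fun_integral_Icc:
  fixes \<psi> :: "real \<Rightarrow> real"
  assumes \<psi>: "test_fun U \<psi>"
  shows "\<exists>R. \<forall>g. continuous_on UNIV g \<longrightarrow> (LINT x|lborel. g x * \<psi> x) = integral {- R..R} (\<lambda>x. g x * \<psi> x)"
proof -
  obtain K where K: "compact K" "\<And>x. x \<notin> K \<Longrightarrow> \<psi> x = 0" using \<psi> by (auto simp: test_fun_def)
  obtain R where R: "\<And>x. x \<in> K \<Longrightarrow> \<bar>x\<bar> \<le> R" using compact_imp_bounded[OF K(1)] by (auto simp: bounded_iff)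
  have z: "\<psi> x = 0" if "x \<notin> {- R..R}" for x using that R[of x] by (intro K(2)) auto
  have "(LINT x|lborel. g x * \<psi> x) = integral {- R..R} (\<lambda>x. g x * \<psi> x)" if g: "continuous_on UNIV g" for g
  proof (rule integrable_continuous_compact_support(2))
    show "continuous_on {- R..R} (\<lambda>x. g x * \<psi> x)"
      by (intro continuous_on_mult continuous_on_subset[OF g] continuous_on_subset[OF test_fun_deriv_real(3)[OF \<psi>]]) auto
    show "g x * \<psi> x = 0" if "x \<notin> {- R..R}" for x using z[OF that] by simp
  qed
  then show ?thesis by blast
qed

context CH_solution
begin

text \<open>The solution at negative times is set to its initial value, which makes it continuous on the whole plane.\<close>

definition ext :: "real \<Rightarrow> real \<Rightarrow> real" where "ext t x = u (max t 0) x"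

definition source :: "real \<Rightarrow> real \<Rightarrow> real" where "source t x = CH_source u (max t 0) x"

lemma ext_continuous: "continuous_on UNIV (\<lambda>p. ext (fst p) (snd p))"
proof -
  have uc: "continuous_on ({0..} \<times> UNIV) (\<lambda>(t, x). u t x)" using weak by (simp add: weak_solution_def)
  have "continuous_on UNIV (\<lambda>p. (\<lambda>(t, x). u t x) (max (fst p) 0, snd p))"
    by (rule continuous_on_compose2[OF uc]) (auto intro!: continuous_intros)
  then show ?thesis by (simp add: ext_def)
qed

lemma ext_compose:
  assumes "continuous_on S f" "continuous_on S g" shows "continuous_on S (\<lambda>p. ext (f p) (g p))"
proof -
  have "continuous_on S (\<lambda>p. ext (fst (f p, g p)) (snd (f p, g p)))"
    by (rule continuous_on_compose2[OF ext_continuous continuous_on_Pair[OF assms]]) simp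
  then show ?thesis by simp
qed

lemma ext_slice: "continuous_on S (ext t)"
  using ext_compose[of S "\<lambda>_. t" "\<lambda>x. x"] by (simp add: continuous_on_id)

lemma ext_measurable [measurable (raw)]:
  assumes f: "f \<in> borel_measurable N" and g: "g \<in> borel_measurable N"
  shows "(\<lambda>p. ext (f p) (g p)) \<in> borel_measurable N"
proof -
  have "(\<lambda>p. ext (fst p) (snd p)) \<in> borel_measurable borel"
    by (rule borel_measurable_continuous_onI[OF ext_continuous])
  from measurable_compose[OF borel_measurable_Pair[OF f g] this] show ?thesis by (simp only: fst_conv snd_conv)
qed

text \<open>The weak form of the equation contains time integrals of the source, whose measurability in time has to be proved, because \<open>dx u t\<close>
  is chosen separately for each \<open>t\<close>. The squares of the dyadic difference quotients are jointly measurable, and integrated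
  against the kernel they converge to the source.\<close>

lemma source_measurable: "(\<lambda>p. source (fst p) (snd p)) \<in> borel_measurable borel"
proof -
  define k where "k x y = 1/2 * sgn (x - y) * exp (- \<bar>x - y\<bar>)" for x y :: real
  have [measurable]: "(fst :: real \<times> real \<Rightarrow> real) \<in> borel_measurable borel"
    "(snd :: real \<times> real \<Rightarrow> real) \<in> borel_measurable borel"
    unfolding borel_prod[symmetric] by simp_all
  have km[measurable]: "(\<lambda>q. k (f q) (g q)) \<in> borel_measurable L"
    if [measurable]: "f \<in> borel_measurable L" "g \<in> borel_measurable L" for L :: "'z measure" and f g
    unfolding k_def by measurable
  define I :: "nat \<Rightarrow> real \<Rightarrow> real" where "I N y = indicator {- real (Suc N)..real (Suc N)} y" for N y
  have Im[measurable]: "I N \<in> borel_measurable borel" for N unfolding I_def[abs_def] by measurable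
  define D where "D N n t y = dyadic_slope (ext t) (- real (Suc N)) (real (Suc N)) n y" for N n t y
  have Dm[measurable]: "(\<lambda>q. D N n (f q) (g q)) \<in> borel_measurable L"
    if [measurable]: "f \<in> borel_measurable L" "g \<in> borel_measurable L" for L :: "'z measure" and f g N n
    unfolding D_def dyadic_slope_def slope_def node_def by measurable
  define F1 where "F1 N p = (LINT y|lborel. I N y * (k (snd p) y * (ext (fst p) y)\<^sup>2))" for N p
  define F2 where "F2 N n p = (LINT y|lborel. I N y * (k (snd p) y * (D N n (fst p) y)\<^sup>2))" for N n p
  define F3 where "F3 N p = (LINT y|lborel. I N y * (k (snd p) y * (dx u (max (fst p) 0) y)\<^sup>2))" for N p
  have F1m[measurable]: "F1 N \<in> borel_measurable borel" for N
    unfolding F1_def[abs_def] by (intro lborel.borel_measurable_lebesgue_integral) measurable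
  have F2m[measurable]: "F2 N n \<in> borel_measurable borel" for N n
    unfolding F2_def[abs_def] by (intro lborel.borel_measurable_lebesgue_integral) measurable
  have F3m[measurable]: "F3 N \<in> borel_measurable borel" for N
  proof (rule borel_measurable_LIMSEQ_real[OF _ F2m[of N]])
    fix p :: "real \<times> real"
    define t where "t = max (fst p) 0"
    define x where "x = snd p"
    have t: "0 \<le> t" by (simp add: t_def)
    define a where "a = - real (Suc N)"
    define b where "b = real (Suc N)"
    have ab: "a < b" by (simp add: a_def b_def)
    define L where "L = restrict_space lborel {a..b}"
    have intL: "integrable L \<phi> \<longleftrightarrow> set_integrable lborel {a..b} \<phi>" for \<phi> :: "real \<Rightarrow> real"
      by (simp add: L_def integrable_restrict_space set_integrable_def)
    have lintL: "(LINT s|L. \<phi> s) = (LINT s|lborel. I N s * \<phi> s)" for \<phi> :: "real \<Rightarrow> real"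
      by (simp add: L_def integral_restrict_space I_def a_def b_def)
    have mL: "\<phi> \<in> borel_measurable L" if "\<phi> \<in> borel_measurable borel" for \<phi> :: "real \<Rightarrow> real"
      unfolding L_def using that by (intro measurable_restrict_space1) simp
    have et: "ext (fst p) = u t" by (simp add: ext_def t_def fun_eq_iff)
    have Deq: "D N n (fst p) = dyadic_slope (u t) a b n" for n
      by (simp add: D_def et a_def b_def fun_eq_iff)
    have sq: "set_integrable lborel {a..b} (\<lambda>s. (dx u t s)\<^sup>2)"
      unfolding set_integrable_def by (rule integrable_mult_indicator[OF _ dx_sq(1)[OF t]]) simp
    have Dsq: "set_integrable lborel {a..b} (\<lambda>s. (dyadic_slope (u t) a b n s)\<^sup>2)" for n
    proof -
      obtain K where K: "\<And>y. y \<in> {a..b} \<Longrightarrow> \<bar>dyadic_slope (u t) a b n y\<bar> \<le> K"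
        using dyadic_slope_bounded[OF ab, of "u t" n] by metis
      show ?thesis
      proof (rule set_integrable_bounded[where K = "K\<^sup>2"])
        show "\<bar>(dyadic_slope (u t) a b n y)\<^sup>2\<bar> \<le> K\<^sup>2" if "y \<in> {a..b}" for y
          using power_mono[OF K[OF that] abs_ge_zero, of 2] by simp
      qed measurable
    qed
    have "(\<lambda>n. LINT s|L. k x s * (dyadic_slope (u t) a b n s)\<^sup>2) \<longlonglongrightarrow> (LINT s|L. k x s * (dx u t s)\<^sup>2)"
    proof (rule tendsto_weighted_square_integral[where K = "1/2"])
      show "dyadic_slope (u t) a b n \<in> borel_measurable L" for n by (intro mL) measurable
      show "dx u t \<in> borel_measurable L" by (intro mL locally_integrable_measurable dx_locally_integrable t)
      show "(\<lambda>s. k x s) \<in> borel_measurable L" by (intro mL) measurable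
      show "integrable L (\<lambda>s. (dyadic_slope (u t) a b n s)\<^sup>2)" for n unfolding intL by (rule Dsq)
      show "integrable L (\<lambda>s. (dx u t s)\<^sup>2)" unfolding intL by (rule sq)
      have "(LINT s|L. (dyadic_slope (u t) a b n s - dx u t s)\<^sup>2) = (LINT s:{a..b}|lborel. (dyadic_slope (u t) a b n s - dx u t s)\<^sup>2)" for n
        unfolding lintL by (simp add: set_lebesgue_integral_def I_def a_def b_def)
      then show "(\<lambda>n. LINT s|L. (dyadic_slope (u t) a b n s - dx u t s)\<^sup>2) \<longlonglongrightarrow> 0"
        using dyadic_slope_converges[OF ab prim[OF t] sq] by simp
      show "\<bar>k x s\<bar> \<le> 1/2" for s unfolding k_def by (rule CH_kernel_bounded)
    qed
    then show "(\<lambda>n. F2 N n p) \<longlonglongrightarrow> F3 N p"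
      unfolding lintL F2_def F3_def Deq t_def[symmetric] x_def .
  qed
  show ?thesis
  proof (rule borel_measurable_LIMSEQ_real)
    show "(\<lambda>p. F1 N p + 1/2 * F3 N p) \<in> borel_measurable borel" for N by measurable
    fix p :: "real \<times> real"
    define t where "t = max (fst p) 0"
    define x where "x = snd p"
    have t: "0 \<le> t" by (simp add: t_def)
    have [measurable]: "dx u t \<in> borel_measurable borel"
      by (intro locally_integrable_measurable dx_locally_integrable t)
    have [measurable]: "u t \<in> borel_measurable borel" by (intro borel_measurable_continuous_onI u_slice t)
    have [measurable]: "(\<lambda>y. k x y) \<in> borel_measurable borel" by measurable
    have bnd: "integrable lborel (\<lambda>y. I N y * (k x y * (f y)\<^sup>2))"
      if f: "integrable lborel (\<lambda>y. (f y)\<^sup>2)" and [measurable]: "f \<in> borel_measurable borel" for f :: "real \<Rightarrow> real" and N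
    proof (rule Bochner_Integration.integrable_bound[OF f])
      have "\<bar>I N y\<bar> * (\<bar>k x y\<bar> * (f y)\<^sup>2) \<le> 1 * (1 * (f y)\<^sup>2)" for y
        by (intro mult_mono order_trans[OF CH_kernel_bounded[of "x - y", folded k_def]] mult_nonneg_nonneg) (auto simp: I_def indicator_def)
      then show "AE y in lborel. norm (I N y * (k x y * (f y)\<^sup>2)) \<le> norm ((f y)\<^sup>2)" by (simp add: abs_mult)
    qed measurable
    have eq: "F1 N p + 1/2 * F3 N p = (LINT y|lborel. I N y * (k x y * energy_density u t y))" for N
    proof -
      have "F1 N p = (LINT y|lborel. I N y * (k x y * (u t y)\<^sup>2))" unfolding F1_def by (simp add: ext_def t_def x_def)
      moreover have "F3 N p = (LINT y|lborel. I N y * (k x y * (dx u t y)\<^sup>2))" unfolding F3_def by (simp add: t_def x_def)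
      moreover have "I N y * (k x y * energy_density u t y) = I N y * (k x y * (u t y)\<^sup>2) + 1/2 * (I N y * (k x y * (dx u t y)\<^sup>2))" for y
        by (simp add: energy_density_def algebra_simps)
      ultimately show ?thesis
        using bnd[OF u_sq(1)[OF t]] bnd[OF dx_sq(1)[OF t]] by simp
    qed
    have "(\<lambda>N. LINT y|lborel. I N y * (k x y * energy_density u t y)) \<longlonglongrightarrow> (LINT y|lborel. k x y * energy_density u t y)"
    proof (rule integral_dominated_convergence[where w = "energy_density u t"])
      have [measurable]: "energy_density u t \<in> borel_measurable borel" unfolding energy_density_def[abs_def] by measurable
      show "(\<lambda>y. k x y * energy_density u t y) \<in> borel_measurable lborel" by measurable
      show "(\<lambda>y. I N y * (k x y * energy_density u t y)) \<in> borel_measurable lborel" for N by measurable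
      show "integrable lborel (energy_density u t)" by (rule energy_density_integrable[OF t])
      have "\<bar>I N y\<bar> * (\<bar>k x y\<bar> * energy_density u t y) \<le> 1 * (1 * energy_density u t y)" for N y
        by (intro mult_mono order_trans[OF CH_kernel_bounded[of "x - y", folded k_def]] mult_nonneg_nonneg energy_density_nonneg) (auto simp: I_def indicator_def)
      then show "AE y in lborel. norm (I N y * (k x y * energy_density u t y)) \<le> energy_density u t y" for N
        using energy_density_nonneg by (simp add: abs_mult)
      have "(\<lambda>N. I N y * (k x y * energy_density u t y)) \<longlonglongrightarrow> k x y * energy_density u t y" for y
      proof (rule tendsto_eventually)
        obtain m :: nat where m: "\<bar>y\<bar> \<le> real m" using real_arch_simple by blast
        have "I N y = 1" if "N \<ge> m" for N using m that by (auto simp: I_def indicator_def)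
        then show "\<forall>\<^sub>F N in sequentially. I N y * (k x y * energy_density u t y) = k x y * energy_density u t y"
          unfolding eventually_sequentially by (intro exI[of _ m]) auto
      qed
      then show "AE y in lborel. (\<lambda>N. I N y * (k x y * energy_density u t y)) \<longlonglongrightarrow> k x y * energy_density u t y" by simp
    qed
    also have "(LINT y|lborel. k x y * energy_density u t y) = source (fst p) (snd p)"
      by (simp add: source_def CH_source_def k_def t_def x_def)
    finally show "(\<lambda>N. F1 N p + 1/2 * F3 N p) \<longlonglongrightarrow> source (fst p) (snd p)" unfolding eq .
  qed
qed

lemma source_measurable' [measurable (raw)]:
  assumes f: "f \<in> borel_measurable N" and g: "g \<in> borel_measurable N"
  shows "(\<lambda>p. source (f p) (g p)) \<in> borel_measurable N"
  using measurable_compose[OF borel_measurable_Pair[OF f g] source_measurable] by (simp only: fst_conv snd_conv)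

lemma source_abs_le: "\<bar>source t x\<bar> \<le> M"
  unfolding source_def by (rule source_bounded) simp

lemma source_locally_integrable: "locally_integrable (source t)"
  unfolding locally_integrable_def
proof (intro allI set_integrable_bounded[where K = M] source_abs_le)
  show "source t \<in> borel_measurable borel" by (rule source_measurable') (rule borel_measurable_const, rule measurable_ident_sets, rule refl)
qed

lemma paired_continuous:
  fixes \<psi> :: "real \<Rightarrow> real" and f :: "real \<Rightarrow> real \<Rightarrow> real"
  assumes \<psi>: "test_fun U \<psi>" and f: "continuous_on UNIV (\<lambda>p. f (fst p) (snd p))"
  shows "continuous_on UNIV (\<lambda>t. LINT x|lborel. f t x * \<psi> x)"
proof -
  obtain R where R: "\<And>g. continuous_on UNIV g \<Longrightarrow> (LINT x|lborel. g x * \<psi> x) = integral {- R..R} (\<lambda>x. g x * \<psi> x)"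
    using test_fun_integral_Icc[OF \<psi>] by blast
  have fs: "continuous_on UNIV (f t)" for t
  proof -
    have "continuous_on UNIV (\<lambda>x. f (fst (t, x)) (snd (t, x)))"
      by (rule continuous_on_compose2[OF f continuous_on_Pair[OF continuous_on_const continuous_on_id]]) simp
    then show ?thesis by (simp only: fst_conv snd_conv)
  qed
  have "continuous_on UNIV (\<lambda>t. integral (cbox (- R) R) (\<lambda>x. f t x * \<psi> x))"
  proof (rule integral_continuous_on_param)
    have "continuous_on (UNIV \<times> cbox (- R) R) (\<lambda>p. f (fst p) (snd p) * \<psi> (snd p))"
      by (rule continuous_on_mult[OF continuous_on_subset[OF f subset_UNIV]
            continuous_on_compose2[OF test_fun_deriv_real(3)[OF \<psi>] continuous_on_snd[OF continuous_on_id] subset_UNIV]])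
    then show "continuous_on (UNIV \<times> cbox (- R) R) (\<lambda>(t, x). f t x * \<psi> x)" by (simp add: case_prod_beta)
  qed
  then show ?thesis unfolding R[OF fs] cbox_interval .
qed

lemma source_paired_locally_integrable:
  assumes \<psi>: "test_fun U \<psi>"
  shows "locally_integrable (\<lambda>t. LINT x|lborel. source t x * \<psi> x)"
  unfolding locally_integrable_def
proof (intro allI set_integrable_bounded[where K = "M * (LINT x|lborel. \<bar>\<psi> x\<bar>)"])
  have [measurable]: "\<psi> \<in> borel_measurable borel"
    using test_fun_deriv_real(3)[OF \<psi>] by (rule borel_measurable_continuous_onI)
  have "integrable lborel (\<lambda>x. 1 * \<psi> x)"
    by (rule integrable_times_test_fun[OF \<psi> locally_integrable_continuous]) (rule continuous_on_const)
  then have i: "integrable lborel (\<lambda>x. \<bar>\<psi> x\<bar>)" by simp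
  show "(\<lambda>t. LINT x|lborel. source t x * \<psi> x) \<in> borel_measurable borel"
    by (intro lborel.borel_measurable_lebesgue_integral) measurable
  show "\<bar>LINT x|lborel. source t x * \<psi> x\<bar> \<le> M * (LINT x|lborel. \<bar>\<psi> x\<bar>)" for t
  proof -
    have "norm (LINT x|lborel. source t x * \<psi> x) \<le> (LINT x|lborel. M * \<bar>\<psi> x\<bar>)"
    proof (rule Bochner_Integration.integral_norm_bound_integral)
      show "integrable lborel (\<lambda>x. source t x * \<psi> x)" by (rule integrable_times_test_fun[OF \<psi> source_locally_integrable])
      show "integrable lborel (\<lambda>x. M * \<bar>\<psi> x\<bar>)" using i by (rule integrable_mult_right)
      show "norm (source t x * \<psi> x) \<le> M * \<bar>\<psi> x\<bar>" for x
        by (simp add: abs_mult mult_right_mono source_abs_le)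
    qed
    then show ?thesis by simp
  qed
qed

lemma paired_rate_locally_integrable:
  assumes \<psi>: "test_fun U \<psi>"
  shows "locally_integrable (\<lambda>t. (LINT x|lborel. source t x * \<psi> x) + 1/2 * (LINT x|lborel. (ext t x)\<^sup>2 * deriv \<psi> x))"
  by (intro locally_integrable_add source_paired_locally_integrable[OF \<psi>] locally_integrable_continuous
      continuous_on_mult continuous_on_const paired_continuous[OF test_fun_deriv[OF \<psi>]] continuous_on_power ext_continuous)

text \<open>The weak form for the product of \<open>\<theta>\<close> in time and \<open>\<psi>\<close> in space. The term \<open>u u\<^sub>x\<close> is integrated by parts in space, after which
  all pairings with \<open>\<psi>\<close> except that of the source are continuous in time.\<close>

lemma weak_form:
  assumes \<theta>: "test_fun {0<..} \<theta>" and \<psi>: "test_fun UNIV \<psi>"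
  shows "(LINT t|lborel. (LINT x|lborel. ext t x * \<psi> x) * deriv \<theta> t)
    = - (LINT t|lborel. ((LINT x|lborel. source t x * \<psi> x) + 1/2 * (LINT x|lborel. (ext t x)\<^sup>2 * deriv \<psi> x)) * \<theta> t)"
proof -
  define A where "A t = (LINT x|lborel. ext t x * \<psi> x)" for t
  define S where "S t = (LINT x|lborel. source t x * \<psi> x)" for t
  define Q where "Q t = (LINT x|lborel. (ext t x)\<^sup>2 * deriv \<psi> x)" for t
  define \<phi> where "\<phi> p = \<theta> (fst p) * \<psi> (snd p)" for p
  have "test_fun ({0<..} \<times> UNIV) \<phi>" unfolding \<phi>_def[abs_def] by (rule test_fun_product[OF \<theta> \<psi>])
  then have weak_eq: "(LINT t:{0<..}|lborel. LINT x|lborel. - u t x * deriv (\<lambda>s. \<phi> (s, x)) t + u t x * dx u t x * \<phi> (t, x))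
        = (LINT t:{0<..}|lborel. LINT x|lborel. CH_source u t x * \<phi> (t, x))"
    using weak by (simp add: weak_solution_def)
  have d\<phi>: "deriv (\<lambda>s. \<phi> (s, x)) t = deriv \<theta> t * \<psi> x" for x t
  proof (rule DERIV_imp_deriv)
    show "((\<lambda>s. \<phi> (s, x)) has_real_derivative deriv \<theta> t * \<psi> x) (at t)"
      unfolding \<phi>_def fst_conv snd_conv by (rule DERIV_cmult_right[OF test_fun_deriv_real(1)[OF \<theta>]])
  qed
  have out: "\<theta> t = 0 \<and> deriv \<theta> t = 0" if "t \<le> 0" for t
    using test_fun_deriv_support[OF \<theta>] that by force
  have left: "(LINT x|lborel. - u t x * deriv (\<lambda>s. \<phi> (s, x)) t + u t x * dx u t x * \<phi> (t, x))
      = - (A t * deriv \<theta> t) - 1/2 * Q t * \<theta> t" if t: "0 < t" for t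
  proof -
    have t0: "0 \<le> t" using t by simp
    have e: "ext t = u t" using t by (simp add: ext_def fun_eq_iff)
    have li: "locally_integrable (\<lambda>x. u t x * dx u t x)"
      by (rule locally_integrable_mult_continuous[OF u_slice[OF t0] dx_locally_integrable[OF t0]])
    have i1: "integrable lborel (\<lambda>x. u t x * \<psi> x)"
      by (rule integrable_times_test_fun[OF \<psi> locally_integrable_continuous[OF u_slice[OF t0]]])
    have i2: "integrable lborel (\<lambda>x. (u t x * dx u t x) * \<psi> x)" by (rule integrable_times_test_fun[OF \<psi> li])
    have "has_weak_deriv (\<lambda>x. u t x * u t x) (\<lambda>x. u t x * dx u t x + u t x * dx u t x)"
      by (rule is_primitive_imp_has_weak_deriv[OF is_primitive_mult[OF prim[OF t0] prim[OF t0]]])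
    then have "(LINT x|lborel. u t x * u t x * deriv \<psi> x) = - (LINT x|lborel. (u t x * dx u t x + u t x * dx u t x) * \<psi> x)"
      using \<psi> by (simp add: has_weak_deriv_def)
    also have "(LINT x|lborel. (u t x * dx u t x + u t x * dx u t x) * \<psi> x) = (LINT x|lborel. 2 * ((u t x * dx u t x) * \<psi> x))"
      by (intro Bochner_Integration.integral_cong) auto
    finally have q: "Q t = - 2 * (LINT x|lborel. (u t x * dx u t x) * \<psi> x)"
      by (simp add: Q_def e power2_eq_square)
    have "(LINT x|lborel. - u t x * deriv (\<lambda>s. \<phi> (s, x)) t + u t x * dx u t x * \<phi> (t, x))
        = (LINT x|lborel. (- deriv \<theta> t) * (u t x * \<psi> x) + \<theta> t * ((u t x * dx u t x) * \<psi> x))"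
      unfolding d\<phi> by (intro Bochner_Integration.integral_cong) (auto simp: \<phi>_def)
    also have "\<dots> = (- deriv \<theta> t) * A t + \<theta> t * (LINT x|lborel. (u t x * dx u t x) * \<psi> x)"
      by (subst Bochner_Integration.integral_add[OF integrable_mult_right[OF i1] integrable_mult_right[OF i2]]) (simp add: A_def e)
    also have "\<dots> = - (A t * deriv \<theta> t) - 1/2 * Q t * \<theta> t" unfolding q by simp
    finally show ?thesis .
  qed
  have right: "(LINT x|lborel. CH_source u t x * \<phi> (t, x)) = S t * \<theta> t" if t: "0 < t" for t
  proof -
    have "(LINT x|lborel. CH_source u t x * \<phi> (t, x)) = (LINT x|lborel. (source t x * \<psi> x) * \<theta> t)"
      using t by (intro Bochner_Integration.integral_cong) (auto simp: \<phi>_def source_def max_def)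
    then show ?thesis by (simp add: S_def)
  qed
  have "(LINT t:{0<..}|lborel. LINT x|lborel. - u t x * deriv (\<lambda>s. \<phi> (s, x)) t + u t x * dx u t x * \<phi> (t, x))
      = (LINT t|lborel. - (A t * deriv \<theta> t) - 1/2 * (Q t * \<theta> t))"
    unfolding set_lebesgue_integral_def
  proof (rule Bochner_Integration.integral_cong[OF refl])
    fix t show "indicator {0<..} t *\<^sub>R (LINT x|lborel. - u t x * deriv (\<lambda>s. \<phi> (s, x)) t + u t x * dx u t x * \<phi> (t, x))
       = - (A t * deriv \<theta> t) - 1/2 * (Q t * \<theta> t)"
      using left[of t] out[of t] by (cases "0 < t") simp_all
  qed
  moreover have "(LINT t:{0<..}|lborel. LINT x|lborel. CH_source u t x * \<phi> (t, x)) = (LINT t|lborel. S t * \<theta> t)"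
    unfolding set_lebesgue_integral_def
  proof (rule Bochner_Integration.integral_cong[OF refl])
    fix t show "indicator {0<..} t *\<^sub>R (LINT x|lborel. CH_source u t x * \<phi> (t, x)) = S t * \<theta> t"
      using right[of t] out[of t] by (cases "0 < t") simp_all
  qed
  ultimately have eq: "(LINT t|lborel. - (A t * deriv \<theta> t) - 1/2 * (Q t * \<theta> t)) = (LINT t|lborel. S t * \<theta> t)"
    using weak_eq by simp
  have Ac: "continuous_on UNIV A" unfolding A_def by (rule paired_continuous[OF \<psi> ext_continuous])
  have Qc: "continuous_on UNIV Q" unfolding Q_def
    by (rule paired_continuous[OF test_fun_deriv[OF \<psi>]]) (intro continuous_intros ext_continuous)
  have iA: "integrable lborel (\<lambda>t. A t * deriv \<theta> t)"
    by (rule integrable_times_test_fun[OF test_fun_deriv[OF \<theta>] locally_integrable_continuous[OF Ac]])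
  have iQ: "integrable lborel (\<lambda>t. Q t * \<theta> t)"
    by (rule integrable_times_test_fun[OF \<theta> locally_integrable_continuous[OF Qc]])
  have iS: "integrable lborel (\<lambda>t. S t * \<theta> t)"
    by (rule integrable_times_test_fun[OF \<theta> source_paired_locally_integrable[OF \<psi>, folded S_def]])
  have "- (LINT t|lborel. A t * deriv \<theta> t) - 1/2 * (LINT t|lborel. Q t * \<theta> t) = (LINT t|lborel. S t * \<theta> t)"
    using eq iA iQ by simp
  moreover have "(LINT t|lborel. (S t + 1/2 * Q t) * \<theta> t) = (LINT t|lborel. S t * \<theta> t) + 1/2 * (LINT t|lborel. Q t * \<theta> t)"
    using iS iQ by (simp add: distrib_right)
  ultimately show ?thesis unfolding A_def S_def Q_def by linarith
qed

lemma paired_increment: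
  assumes \<psi>: "test_fun UNIV \<psi>" and st: "0 < \<sigma>" "\<sigma> \<le> \<tau>"
  shows "(LINT x|lborel. ext \<tau> x * \<psi> x) - (LINT x|lborel. ext \<sigma> x * \<psi> x)
    = integral {\<sigma>..\<tau>} (\<lambda>t. (LINT x|lborel. source t x * \<psi> x) + 1/2 * (LINT x|lborel. (ext t x)\<^sup>2 * deriv \<psi> x))"
proof (rule weak_deriv_imp_increment[OF _ _ st(2), where U = "{0<..}"])
  show "continuous_on UNIV (\<lambda>t. LINT x|lborel. ext t x * \<psi> x)" by (rule paired_continuous[OF \<psi> ext_continuous])
  show "locally_integrable (\<lambda>t. (LINT x|lborel. source t x * \<psi> x) + 1/2 * (LINT x|lborel. (ext t x)\<^sup>2 * deriv \<psi> x))"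
    by (rule paired_rate_locally_integrable[OF \<psi>])
  show "{\<sigma>..\<tau> + 1} \<subseteq> {0<..}" using st by auto
qed (rule weak_form[OF _ \<psi>])

text \<open>The balance law for the integral of \<open>u\<close> over \<open>{x..y}\<close>, from the cutoffs of \<open>{x<..y}\<close> in space.\<close>

lemma interval_increment:
  assumes xy: "x \<le> y" and st: "0 < \<sigma>" "\<sigma> \<le> \<tau>"
  shows "(\<lambda>t. integral {x..y} (source t) + 1/2 * ((ext t x)\<^sup>2 - (ext t y)\<^sup>2)) integrable_on {\<sigma>..\<tau>}"
    "integral {x..y} (ext \<tau>) - integral {x..y} (ext \<sigma>)
      = integral {\<sigma>..\<tau>} (\<lambda>t. integral {x..y} (source t) + 1/2 * ((ext t x)\<^sup>2 - (ext t y)\<^sup>2))"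
proof -
  obtain \<psi> :: "nat \<Rightarrow> real \<Rightarrow> real" where H: "(\<forall>n. test_fun UNIV (\<psi> n)) \<and> (\<forall>n s. \<bar>\<psi> n s\<bar> \<le> 1) \<and>
     (\<forall>n s. s \<notin> {x..y + 1} \<longrightarrow> \<psi> n s = 0) \<and>
     (\<forall>s. (\<lambda>n. \<psi> n s) \<longlonglongrightarrow> indicator {x<..y} s) \<and>
     (\<forall>A. continuous_on UNIV A \<longrightarrow> (\<lambda>n. LINT s|lborel. A s * deriv (\<psi> n) s) \<longlonglongrightarrow> A x - A y) \<and>
     (\<forall>A K n. continuous_on UNIV A \<longrightarrow> (\<forall>s\<in>{x..y + 1}. \<bar>A s\<bar> \<le> K) \<longrightarrow>
        \<bar>LINT s|lborel. A s * deriv (\<psi> n) s\<bar> \<le> 2 * K)"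
    using exists_cutoffs[OF xy subset_UNIV] by (elim exE)
  have \<psi>: "test_fun UNIV (\<psi> n)" "\<bar>\<psi> n s\<bar> \<le> 1" "s \<notin> {x..y + 1} \<Longrightarrow> \<psi> n s = 0"
      "(\<lambda>n. \<psi> n s) \<longlonglongrightarrow> indicator {x<..y} s" for n s
    using H by simp_all
  have lim: "(\<lambda>n. LINT s|lborel. A s * deriv (\<psi> n) s) \<longlonglongrightarrow> A x - A y"
    and bnd: "(\<forall>s\<in>{x..y + 1}. \<bar>A s\<bar> \<le> K) \<Longrightarrow> \<bar>LINT s|lborel. A s * deriv (\<psi> n) s\<bar> \<le> 2 * K"
    if "continuous_on UNIV A" for A K n
    using H that by simp_all
  have \<psi>m: "\<psi> n \<in> borel_measurable borel" for n
    using test_fun_deriv_real(3)[OF \<psi>(1)] by (rule borel_measurable_continuous_onI)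
  have limB: "(\<lambda>n. LINT s|lborel. B s * \<psi> n s) \<longlonglongrightarrow> integral {x..y} B" if "locally_integrable B" for B
    by (rule cutoff_integral_limit[OF locally_integrableD(1)[OF that] xy \<psi>m]) (use \<psi> in auto)
  define f where "f n t = (LINT s|lborel. source t s * \<psi> n s) + 1/2 * (LINT s|lborel. (ext t s)\<^sup>2 * deriv (\<psi> n) s)" for n t
  define g where "g t = integral {x..y} (source t) + 1/2 * ((ext t x)\<^sup>2 - (ext t y)\<^sup>2)" for t
  have ext2: "continuous_on UNIV (\<lambda>s. (ext t s)\<^sup>2)" for t by (intro continuous_intros ext_slice)
  have "bounded ((\<lambda>p. (ext (fst p) (snd p))\<^sup>2) ` ({\<sigma>..\<tau>} \<times> {x..y + 1}))"
    by (intro compact_imp_bounded compact_continuous_image continuous_on_power continuous_on_subset[OF ext_continuous] compact_Times compact_Icc) auto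
  then obtain K where K: "\<And>t s. t \<in> {\<sigma>..\<tau>} \<Longrightarrow> s \<in> {x..y + 1} \<Longrightarrow> \<bar>(ext t s)\<^sup>2\<bar> \<le> K"
    unfolding bounded_iff by fastforce
  have src: "\<bar>LINT s|lborel. source t s * \<psi> n s\<bar> \<le> M * (y + 1 - x)" for t n
  proof -
    have "norm (LINT s|lborel. source t s * \<psi> n s) \<le> (LINT s|lborel. indicator {x..y + 1} s * M)"
    proof (rule Bochner_Integration.integral_norm_bound_integral)
      show "integrable lborel (\<lambda>s. source t s * \<psi> n s)" by (rule integrable_times_test_fun[OF \<psi>(1) source_locally_integrable])
      show "integrable lborel (\<lambda>s. indicator {x..y + 1} s * M)"
        by (intro integrable_mult_left integrable_real_indicator) (auto simp: emeasure_lborel_Icc_eq)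
      fix s
      have "\<bar>source t s\<bar> * \<bar>\<psi> n s\<bar> \<le> M * 1" by (intro mult_mono source_abs_le \<psi> M_nonneg) auto
      then show "norm (source t s * \<psi> n s) \<le> indicator {x..y + 1} s * M"
        using \<psi>(3)[of s n] by (cases "s \<in> {x..y + 1}") (auto simp: abs_mult)
    qed
    also have "\<dots> = M * (y + 1 - x)" using xy by simp
    finally show ?thesis by simp
  qed
  have fi: "f n integrable_on {\<sigma>..\<tau>}" for n
    unfolding f_def by (rule locally_integrableD(2)[OF paired_rate_locally_integrable[OF \<psi>(1)]])
  have le: "norm (f n t) \<le> M * (y + 1 - x) + K" if "t \<in> {\<sigma>..\<tau>}" for n t
  proof -
    have "\<bar>LINT s|lborel. (ext t s)\<^sup>2 * deriv (\<psi> n) s\<bar> \<le> 2 * K"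
      by (rule bnd[OF ext2]) (use K[OF that] in blast)
    then show ?thesis using src[of t n] unfolding f_def real_norm_def by linarith
  qed
  have ptw: "(\<lambda>n. f n t) \<longlonglongrightarrow> g t" for t
    unfolding f_def g_def by (intro tendsto_intros limB source_locally_integrable lim[OF ext2])
  have dc: "g integrable_on {\<sigma>..\<tau>}" "(\<lambda>n. integral {\<sigma>..\<tau>} (f n)) \<longlonglongrightarrow> integral {\<sigma>..\<tau>} g"
    using dominated_convergence[of f "{\<sigma>..\<tau>}" "\<lambda>_. M * (y + 1 - x) + K" g] fi le ptw integrable_const_ivl by blast+
  show "(\<lambda>t. integral {x..y} (source t) + 1/2 * ((ext t x)\<^sup>2 - (ext t y)\<^sup>2)) integrable_on {\<sigma>..\<tau>}"
    using dc(1) unfolding g_def .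
  have "(\<lambda>n. (LINT s|lborel. ext \<tau> s * \<psi> n s) - (LINT s|lborel. ext \<sigma> s * \<psi> n s)) \<longlonglongrightarrow> integral {x..y} (ext \<tau>) - integral {x..y} (ext \<sigma>)"
    by (intro tendsto_diff limB locally_integrable_continuous ext_slice)
  then have "(\<lambda>n. integral {\<sigma>..\<tau>} (f n)) \<longlonglongrightarrow> integral {x..y} (ext \<tau>) - integral {x..y} (ext \<sigma>)"
    unfolding paired_increment[OF \<psi>(1) st] f_def .
  from LIMSEQ_unique[OF this dc(2)] show "integral {x..y} (ext \<tau>) - integral {x..y} (ext \<sigma>)
      = integral {\<sigma>..\<tau>} (\<lambda>t. integral {x..y} (source t) + 1/2 * ((ext t x)\<^sup>2 - (ext t y)\<^sup>2))"
    unfolding g_def .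
qed

end

section \<open>Weak solutions as flows and time reversal\<close>

context CH_solution
begin

lemma increment_square_le:
  assumes t: "0 \<le> t" and xz: "x < z"
  shows "(u t z - u t x)\<^sup>2 / (2 * (z - x)) - M * (z - x) \<le> CH_source u t z - CH_source u t x"
proof -
  have i: "set_integrable lborel {x..z} (\<lambda>y. (dx u t y)\<^sup>2)"
    unfolding set_integrable_def by (rule integrable_mult_indicator[OF _ dx_sq(1)[OF t]]) simp
  have "u t z - u t x = integral {x..z} (dx u t)" using prim[OF t] xz by (simp add: is_primitive_def)
  then have "(u t z - u t x)\<^sup>2 \<le> (z - x) * integral {x..z} (\<lambda>y. (dx u t y)\<^sup>2)"
    using square_of_integral_le[OF less_imp_le[OF xz] locally_integrableD(2)[OF dx_locally_integrable[OF t]] set_borel_integral_eq_integral(1)[OF i]]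
    by simp
  then have "(u t z - u t x)\<^sup>2 / (2 * (z - x)) \<le> ((z - x) * integral {x..z} (\<lambda>y. (dx u t y)\<^sup>2)) / (2 * (z - x))"
    by (rule divide_right_mono) (use xz in simp)
  also have "\<dots> = 1/2 * integral {x..z} (\<lambda>y. (dx u t y)\<^sup>2)" using xz by (simp add: field_simps)
  finally show ?thesis using source_increment[OF t xz] by linarith
qed

lemma ext_nonneg: "0 \<le> t \<Longrightarrow> ext t = u t"
  by (simp add: ext_def fun_eq_iff)

lemma window_rate_ext_continuous:
  assumes xz: "x < z"
  shows "continuous_on UNIV (\<lambda>t. window_rate M \<epsilon> (ext t) x z)"
proof -
  have "continuous_on (UNIV \<times> cbox 0 \<epsilon>) (\<lambda>p. (ext (fst p) (z + snd p) - ext (fst p) (x + snd p))\<^sup>2 / (2 * (z - x)) - M * (z - x))"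
    by (intro continuous_intros ext_compose) (use xz in auto)
  then have "continuous_on UNIV (\<lambda>t. integral (cbox 0 \<epsilon>) (\<lambda>r. (ext t (z + r) - ext t (x + r))\<^sup>2 / (2 * (z - x)) - M * (z - x)))"
    by (intro integral_continuous_on_param) (simp add: case_prod_beta)
  then show ?thesis unfolding cbox_interval window_rate_def
    by (intro continuous_on_add continuous_on_diff continuous_on_divide continuous_on_power continuous_on_const ext_compose continuous_on_id) auto
qed

text \<open>The balance law on two windows, in which the difference of the sources at distance \<open>z - x\<close> is estimated from below.\<close>

lemma window_growth_pos:
  assumes st: "0 < \<sigma>" "\<sigma> \<le> \<tau>" and xz: "x < z" and \<epsilon>: "0 < \<epsilon>"
  shows "integral {\<sigma>..\<tau>} (\<lambda>t. window_rate M \<epsilon> (ext t) x z)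
      \<le> window_gap \<epsilon> (ext \<tau>) x z - window_gap \<epsilon> (ext \<sigma>) x z"
    (is "integral _ ?G \<le> _")
proof -
  define P where "P y t = integral {y..y + \<epsilon>} (source t) + 1/2 * ((ext t y)\<^sup>2 - (ext t (y + \<epsilon>))\<^sup>2)" for y t
  have P: "P y integrable_on {\<sigma>..\<tau>}" "integral {y..y + \<epsilon>} (ext \<tau>) - integral {y..y + \<epsilon>} (ext \<sigma>) = integral {\<sigma>..\<tau>} (P y)" for y
    unfolding P_def using interval_increment[of y "y + \<epsilon>" \<sigma> \<tau>] st \<epsilon> by auto
  have "integral {\<sigma>..\<tau>} ?G \<le> integral {\<sigma>..\<tau>} (\<lambda>t. P z t - P x t)"
  proof (rule Henstock_Kurzweil_Integration.integral_le)
    show "?G integrable_on {\<sigma>..\<tau>}"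
      by (rule integrable_continuous_real[OF continuous_on_subset[OF window_rate_ext_continuous[OF xz] subset_UNIV]])
    show "(\<lambda>t. P z t - P x t) integrable_on {\<sigma>..\<tau>}" by (intro Henstock_Kurzweil_Integration.integrable_diff P)
    fix t
    have shift: "(\<lambda>r. source t (y + r)) integrable_on {0..\<epsilon>}"
      "integral {y..y + \<epsilon>} (source t) = integral {0..\<epsilon>} (\<lambda>r. source t (y + r))" for y
    proof -
      have m: "(\<lambda>r. source t (y + r)) \<in> borel_measurable borel" by measurable
      show "(\<lambda>r. source t (y + r)) integrable_on {0..\<epsilon>}"
        by (rule set_borel_integral_eq_integral(1)[OF set_integrable_bounded[OF m source_abs_le]])
      show "integral {y..y + \<epsilon>} (source t) = integral {0..\<epsilon>} (\<lambda>r. source t (y + r))"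
        using integral_shift_Icc_real[of 0 \<epsilon> "source t" y] by (simp add: o_def add.commute)
    qed
    have "integral {0..\<epsilon>} (\<lambda>r. (ext t (z + r) - ext t (x + r))\<^sup>2 / (2 * (z - x)) - M * (z - x))
        \<le> integral {0..\<epsilon>} (\<lambda>r. source t (z + r) - source t (x + r))"
    proof (rule Henstock_Kurzweil_Integration.integral_le)
      show "(\<lambda>r. (ext t (z + r) - ext t (x + r))\<^sup>2 / (2 * (z - x)) - M * (z - x)) integrable_on {0..\<epsilon>}"
        by (intro integrable_continuous_real continuous_intros ext_compose) (use xz in auto)
      show "(\<lambda>r. source t (z + r) - source t (x + r)) integrable_on {0..\<epsilon>}"
        by (intro Henstock_Kurzweil_Integration.integrable_diff shift)
      show "(ext t (z + r) - ext t (x + r))\<^sup>2 / (2 * (z - x)) - M * (z - x) \<le> source t (z + r) - source t (x + r)" for r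
        using increment_square_le[of "max t 0" "x + r" "z + r"] xz by (simp add: ext_def source_def)
    qed
    also have "\<dots> = integral {0..\<epsilon>} (\<lambda>r. source t (z + r)) - integral {0..\<epsilon>} (\<lambda>r. source t (x + r))"
      by (rule Henstock_Kurzweil_Integration.integral_diff[OF shift(1) shift(1)])
    finally show "?G t \<le> P z t - P x t" unfolding P_def shift(2) window_rate_def by (simp add: field_simps)
  qed
  also have "\<dots> = integral {\<sigma>..\<tau>} (P z) - integral {\<sigma>..\<tau>} (P x)"
    by (rule Henstock_Kurzweil_Integration.integral_diff[OF P(1) P(1)])
  finally show ?thesis using P(2)[of z] P(2)[of x] unfolding window_gap_def by linarith
qed

text \<open>The initial time is a limit of positive times.\<close>

lemma window_growth:
  assumes st: "0 \<le> \<sigma>" "\<sigma> \<le> \<tau>" and xz: "x < z" and \<epsilon>: "0 < \<epsilon>"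
  shows "integral {\<sigma>..\<tau>} (\<lambda>t. window_rate M \<epsilon> (ext t) x z)
      \<le> window_gap \<epsilon> (ext \<tau>) x z - window_gap \<epsilon> (ext \<sigma>) x z"
    (is "integral _ ?G \<le> ?J \<tau> - ?J \<sigma>")
proof (cases "0 < \<sigma> \<or> \<sigma> = \<tau>")
  case True
  then show ?thesis using window_growth_pos[OF _ st(2) xz \<epsilon>] by auto
next
  case False
  then have \<sigma>: "\<sigma> = 0" and \<tau>: "0 < \<tau>" using st by auto
  have Gi: "?G integrable_on {a..b}" for a b
    by (rule integrable_continuous_real[OF continuous_on_subset[OF window_rate_ext_continuous[OF xz] subset_UNIV]])
  \<comment> \<open>Positive times that decrease to the initial time.\<close>
  define s where "s n = \<tau> * (1 / real (Suc n))" for n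
  have s: "0 < s n" "s n \<le> \<tau>" for n using \<tau> by (auto simp: s_def field_simps)
  have s': "0 \<le> s n" for n using s(1)[of n] by simp
  have "s \<longlonglongrightarrow> \<tau> * 0" unfolding s_def by (intro tendsto_intros LIMSEQ_Suc[OF lim_1_over_n])
  then have s0: "s \<longlonglongrightarrow> 0" by simp
  have "continuous_on {0..\<tau>} (\<lambda>a. integral {0..a} ?G)" by (rule indefinite_integral_continuous_1[OF Gi])
  then have "(\<lambda>n. integral {0..s n} ?G) \<longlonglongrightarrow> integral {0..0} ?G"
    by (rule continuous_on_tendsto_compose[OF _ s0]) (use s s' \<tau> in auto)
  then have l1: "(\<lambda>n. integral {0..\<tau>} ?G - integral {0..s n} ?G) \<longlonglongrightarrow> integral {0..\<tau>} ?G - 0"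
    by (intro tendsto_intros) simp
  have Wc: "continuous_on UNIV (\<lambda>t. integral (cbox y (y + \<epsilon>)) (ext t))" for y
    by (rule integral_continuous_on_param) (use continuous_on_subset[OF ext_continuous] in \<open>simp add: case_prod_beta\<close>)
  have Wl: "(\<lambda>n. integral {y..y + \<epsilon>} (ext (s n))) \<longlonglongrightarrow> integral {y..y + \<epsilon>} (ext 0)" for y
    using continuous_on_tendsto_compose[OF Wc s0] by simp
  have l2: "(\<lambda>n. ?J \<tau> - ?J (s n)) \<longlonglongrightarrow> ?J \<tau> - ?J 0" unfolding window_gap_def by (intro tendsto_intros Wl)
  have "integral {0..\<tau>} ?G - integral {0..s n} ?G \<le> ?J \<tau> - ?J (s n)" for n
    using window_growth_pos[OF s(1) s(2) xz \<epsilon>, of n]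
      Henstock_Kurzweil_Integration.integral_combine[OF less_imp_le[OF s(1)[of n]] s(2)[of n] Gi] by linarith
  with LIMSEQ_le[OF l1 l2] show ?thesis unfolding \<sigma> by auto
qed

lemma solution_is_CH_flow: "CH_flow T M (2 * M) u (dx u)"
proof
  show "continuous_on ({0..T} \<times> UNIV) (\<lambda>(t, x). u t x)"
    by (rule continuous_on_subset[of "{0..} \<times> UNIV"]) (use weak in \<open>auto simp: weak_solution_def\<close>)
  show "is_primitive (u t) (dx u t)" "integrable lborel (\<lambda>x. (dx u t x)\<^sup>2)" "(LINT x|lborel. (dx u t x)\<^sup>2) \<le> 2 * M"
    if "t \<in> {0..T}" for t using that prim dx_sq by auto
  show "0 \<le> M" by (rule M_nonneg)
  fix \<sigma> \<tau> x z \<epsilon> :: real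
  assume A: "0 \<le> \<sigma>" "\<sigma> \<le> \<tau>" "\<tau> \<le> T" "x < z" "0 < \<epsilon>"
  have "integral {\<sigma>..\<tau>} (\<lambda>t. window_rate M \<epsilon> (u t) x z) = integral {\<sigma>..\<tau>} (\<lambda>t. window_rate M \<epsilon> (ext t) x z)"
    by (rule Henstock_Kurzweil_Integration.integral_cong) (use A in \<open>simp add: ext_nonneg\<close>)
  also have "\<dots> \<le> window_gap \<epsilon> (ext \<tau>) x z - window_gap \<epsilon> (ext \<sigma>) x z"
    by (rule window_growth[OF A(1,2,4,5)])
  finally show "integral {\<sigma>..\<tau>} (\<lambda>t. window_rate M \<epsilon> (u t) x z) \<le> window_gap \<epsilon> (u \<tau>) x z - window_gap \<epsilon> (u \<sigma>) x z"
    using A by (simp add: ext_nonneg)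
qed

end

lemma integral_reversed:
  fixes f :: "real \<Rightarrow> real"
  shows "integral {a..b} (\<lambda>t. f (c - t)) = integral {c - b..c - a} f"
proof -
  have "integral {a..b} (\<lambda>t. f (c - t)) = integral {- (- a)..- (- b)} (\<lambda>t. (f \<circ> (+) c) (- t))" by (simp add: o_def)
  also have "\<dots> = integral {- b..- a} (f \<circ> (+) c)" by (rule Henstock_Kurzweil_Integration.integral_reflect_real)
  also have "\<dots> = integral {- b + c..- a + c} f" by (rule integral_shift_Icc_real)
  finally show ?thesis by (simp add: add.commute)
qed

lemma is_primitive_minus: "is_primitive f g \<Longrightarrow> is_primitive (\<lambda>x. - f x) (\<lambda>x. - g x)"
proof -
  assume p: "is_primitive f g"
  have "locally_integrable (\<lambda>x. (- 1) * g x)"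
    by (rule locally_integrable_mult_continuous[OF continuous_on_const]) (use p in \<open>simp add: is_primitive_def\<close>)
  moreover have "- f y - - f x = integral {x..y} (\<lambda>x. - g x)" if "x \<le> y" for x y
  proof -
    have "f y - f x = integral {x..y} g" using p that by (simp add: is_primitive_def)
    then show ?thesis by simp
  qed
  ultimately show ?thesis by (simp add: is_primitive_def)
qed

text \<open>Time reversal changes the sign of \<open>w\<close> and exchanges the end points in time; the rate is even in \<open>w\<close>.\<close>

lemma CH_flow_reversed:
  assumes "CH_flow T C B w v"
  shows "CH_flow T C B (\<lambda>t x. - w (T - t) x) (\<lambda>t x. - v (T - t) x)"
proof -
  interpret CH_flow T C B w v by fact
  show ?thesis
  proof
    show "continuous_on ({0..T} \<times> UNIV) (\<lambda>(t, x). - w (T - t) x)"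
      unfolding case_prod_beta by (intro continuous_on_minus w_compose_continuous continuous_intros) auto
    fix t assume "t \<in> {0..T}"
    then have t: "T - t \<in> {0..T}" by auto
    show "is_primitive (\<lambda>x. - w (T - t) x) (\<lambda>x. - v (T - t) x)" by (rule is_primitive_minus[OF w_prim[OF t]])
    show "integrable lborel (\<lambda>x. (- v (T - t) x)\<^sup>2)" using v_sq[OF t] by simp
    show "(LINT x|lborel. (- v (T - t) x)\<^sup>2) \<le> B" using v_energy[OF t] by simp
  next
    show "0 \<le> C" by (rule C_nonneg)
  next
    fix \<sigma> \<tau> x z \<epsilon> :: real
    assume A: "0 \<le> \<sigma>" "\<sigma> \<le> \<tau>" "\<tau> \<le> T" "x < z" "0 < \<epsilon>"
    have sq: "(- a - - b)\<^sup>2 = (a - b)\<^sup>2" for a b :: real by (simp add: power2_eq_square algebra_simps)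
    have even: "window_rate C \<epsilon> (\<lambda>x. - p x) x z = window_rate C \<epsilon> p x z" for p
      unfolding window_rate_def sq by simp
    have odd: "window_gap \<epsilon> (\<lambda>x. - p x) x z = - window_gap \<epsilon> p x z" for p
      by (simp add: window_gap_def)
    have "integral {\<sigma>..\<tau>} (\<lambda>t. window_rate C \<epsilon> (w (T - t)) x z) = integral {T - \<tau>..T - \<sigma>} (\<lambda>t. window_rate C \<epsilon> (w t) x z)"
      by (rule integral_reversed)
    also have "\<dots> \<le> window_gap \<epsilon> (w (T - \<sigma>)) x z - window_gap \<epsilon> (w (T - \<tau>)) x z"
      by (rule windows) (use A in auto)
    finally show "integral {\<sigma>..\<tau>} (\<lambda>t. window_rate C \<epsilon> (\<lambda>x. - w (T - t) x) x z)
        \<le> window_gap \<epsilon> (\<lambda>x. - w (T - \<tau>) x) x z - window_gap \<epsilon> (\<lambda>x. - w (T - \<sigma>) x) x z"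
      unfolding even odd by simp
  qed
qed

context CH_flow
begin

lemma compression_of_max: "compression t x (max x y) = compression t x y"
  by (cases "x \<le> y") (auto simp: compression_def max_def)

text \<open>Two curves may cross. The energy over the empty interval is \<open>0\<close>, so \<open>\<beta>\<close> may be replaced by the maximum of the
  two curves.\<close>

lemma compression_growth_any_order:
  assumes st: "0 \<le> s" "s \<le> t" "t \<le> T" and c: "curve 0 T \<alpha>" "curve 0 T \<beta>"
    and L: "\<And>r. r \<in> {0..T} \<Longrightarrow> \<bar>\<beta> r - \<alpha> r\<bar> \<le> L"
  shows "compression t (\<alpha> t) (\<beta> t) \<le> compression s (\<alpha> s) (\<beta> s) + C * (L + B) * (t - s)"
proof -
  have "compression t (\<alpha> t) (max (\<alpha> t) (\<beta> t)) \<le> compression s (\<alpha> s) (max (\<alpha> s) (\<beta> s)) + C * (L + B) * (t - s)"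
  proof (rule compression_growth[OF st])
    show "curve s t \<alpha>" "curve s t (\<lambda>r. max (\<alpha> r) (\<beta> r))"
      using st c by (auto intro!: curve_max intro: curve_subinterval)
    show "max (\<alpha> r) (\<beta> r) - \<alpha> r \<le> L" if "r \<in> {s..t}" for r
      using L[of r] that st by (auto simp: max_def)
  qed auto
  then show ?thesis by (simp only: compression_of_max)
qed

end

lemma almost_decreasing_bounded_variation:
  fixes f :: "real \<Rightarrow> real"
  assumes f: "\<And>s t. a \<le> s \<Longrightarrow> s \<le> t \<Longrightarrow> t \<le> b \<Longrightarrow> f t \<le> f s + K * (t - s)" and K: "0 \<le> K"
  shows "bounded_variation_on {a..b} f"
  unfolding bounded_variation_on_def
proof (intro exI allI impI)
  fix n and p :: "nat \<Rightarrow> real"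
  assume p: "mono_on {..n} p \<and> p ` {..n} \<subseteq> {a..b}"
  have pin: "p i \<in> {a..b}" if "i \<le> n" for i using p that by auto
  have pm: "p i \<le> p (Suc i)" if "i < n" for i using p that by (auto simp: mono_on_def)
  have "(\<Sum>i<n. \<bar>f (p (Suc i)) - f (p i)\<bar>) \<le> (\<Sum>i<n. (2 * K * p (Suc i) - f (p (Suc i))) - (2 * K * p i - f (p i)))"
  proof (rule sum_mono)
    fix i assume "i \<in> {..<n}"
    then have i: "i < n" by simp
    have 1: "f (p (Suc i)) \<le> f (p i) + K * (p (Suc i) - p i)"
      using pin[of i] pin[of "Suc i"] pm[OF i] i by (intro f) auto
    have 2: "0 \<le> K * (p (Suc i) - p i)" using K pm[OF i] by simp
    have "2 * K * p (Suc i) - 2 * K * p i = 2 * (K * (p (Suc i) - p i))" by (simp add: algebra_simps)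
    then show "\<bar>f (p (Suc i)) - f (p i)\<bar> \<le> (2 * K * p (Suc i) - f (p (Suc i))) - (2 * K * p i - f (p i))"
      using 1 2 by linarith
  qed
  also have "\<dots> = (2 * K * p n - f (p n)) - (2 * K * p 0 - f (p 0))"
    by (rule sum_lessThan_telescope)
  also have "\<dots> \<le> 4 * K * (b - a) + f a - f b"
  proof -
    have a: "f (p 0) \<le> f a + K * (p 0 - a)" and b: "f b \<le> f (p n) + K * (b - p n)"
      using pin[of 0] pin[of n] by (auto intro!: f)
    have "K * (p 0 - a) \<le> K * (b - a)" "K * (b - p n) \<le> K * (b - a)" "K * (p n - p 0) \<le> K * (b - a)"
      using pin[of 0] pin[of n] K by (auto intro!: mult_left_mono)
    moreover have "2 * K * p n - 2 * K * p 0 = 2 * (K * (p n - p 0))" "4 * K * (b - a) = 4 * (K * (b - a))"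
      by (simp_all add: algebra_simps)
    ultimately show ?thesis using a b by linarith
  qed
  finally show "(\<Sum>i<n. \<bar>f (p (Suc i)) - f (p i)\<bar>) \<le> 4 * K * (b - a) + f a - f b" .
qed

lemma bounded_variation_on_uminus:
  "bounded_variation_on S (\<lambda>t. - f t) \<Longrightarrow> bounded_variation_on S f"
  unfolding bounded_variation_on_def by (simp add: abs_minus_commute)

lemma increasing_right_limit:
  fixes h :: "real \<Rightarrow> real"
  assumes T: "t0 < T" and mono: "\<And>s t. t0 < s \<Longrightarrow> s \<le> t \<Longrightarrow> t \<le> T \<Longrightarrow> h s \<le> h t"
    and bnd: "\<And>s. t0 < s \<Longrightarrow> s \<le> T \<Longrightarrow> m \<le> h s"
  shows "\<exists>l. (h \<longlongrightarrow> l) (at_right t0)"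
proof (intro exI order_tendstoI)
  have bdd: "bdd_below (h ` {t0<..T})" using bnd by (intro bdd_belowI[of _ m]) auto
  fix a
  { assume a: "a < Inf (h ` {t0<..T})"
    show "\<forall>\<^sub>F s in at_right t0. a < h s"
      using eventually_at_right_real[OF T]
      by eventually_elim (rule less_le_trans[OF a cInf_lower[OF _ bdd]], auto) }
  { assume "Inf (h ` {t0<..T}) < a"
    then obtain s0 where s0: "t0 < s0" "s0 \<le> T" "h s0 < a"
      using cInf_lessD[of "h ` {t0<..T}" a] T by auto
    show "\<forall>\<^sub>F s in at_right t0. h s < a"
      using eventually_at_right_real[OF s0(1)]
      by eventually_elim (rule le_less_trans[OF mono s0(3)], use s0 in auto) }
qed

lemma almost_increasing_right_limit:
  fixes f :: "real \<Rightarrow> real"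
  assumes T: "t0 < T" and f: "\<And>s t. t0 < s \<Longrightarrow> s \<le> t \<Longrightarrow> t \<le> T \<Longrightarrow> f s \<le> f t + K * (t - s)"
    and nn: "\<And>s. t0 < s \<Longrightarrow> s \<le> T \<Longrightarrow> 0 \<le> f s"
  shows "\<exists>l\<ge>0. (f \<longlongrightarrow> l) (at_right t0)"
proof -
  have "\<exists>l. ((\<lambda>t. f t + K * t) \<longlongrightarrow> l) (at_right t0)"
  proof (rule increasing_right_limit[OF T])
    show "f s + K * s \<le> f t + K * t" if "t0 < s" "s \<le> t" "t \<le> T" for s t
      using f[OF that] by (simp add: algebra_simps)
    show "- (\<bar>K\<bar> * (\<bar>t0\<bar> + \<bar>T\<bar>)) \<le> f s + K * s" if "t0 < s" "s \<le> T" for s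
    proof -
      have "\<bar>K * s\<bar> \<le> \<bar>K\<bar> * (\<bar>t0\<bar> + \<bar>T\<bar>)" unfolding abs_mult using that by (intro mult_left_mono) auto
      then show ?thesis using nn[OF that] by linarith
    qed
  qed
  then obtain l where l: "((\<lambda>t. f t + K * t) \<longlongrightarrow> l) (at_right t0)" by blast
  have "((\<lambda>t. (f t + K * t) - K * t) \<longlongrightarrow> l - K * t0) (at_right t0)" by (intro tendsto_intros l)
  then have lim: "(f \<longlongrightarrow> l - K * t0) (at_right t0)" by simp
  moreover have "0 \<le> l - K * t0"
  proof (rule tendsto_lowerbound[OF lim])
    show "\<forall>\<^sub>F s in at_right t0. 0 \<le> f s"
      using eventually_at_right_real[OF T] by eventually_elim (auto intro: nn)
  qed auto
  ultimately show ?thesis by blast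
qed

section \<open>The energies between two characteristics\<close>

context CH_solution
begin

lemma characteristic_curve:
  assumes "characteristic u \<zeta>" "T \<ge> 0"
  shows "CH_flow.curve u 0 T \<zeta>"
proof -
  interpret CH_flow T M "2 * M" u "dx u" by (rule solution_is_CH_flow)
  show ?thesis
    unfolding curve_def
  proof
    fix t assume t: "t \<in> {0..T}"
    then have "(\<zeta> has_real_derivative u t (\<zeta> t)) (at t within {0..})"
      using assms(1) by (simp add: characteristic_def)
    then show "(\<zeta> has_real_derivative u t (\<zeta> t)) (at t within {0..T})"
      by (rule DERIV_subset) auto
  qed
qed

lemma neg_energy_eq:
  assumes "t \<ge> 0" shows "neg_energy u t a b = integral {a..b} (\<lambda>x. (max (- dx u t x) 0)\<^sup>2)"
proof -
  interpret CH_flow t M "2 * M" u "dx u" by (rule solution_is_CH_flow)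
  have "set_integrable lborel {a..b} (\<lambda>x. (max (- dx u t x) 0)\<^sup>2)"
    by (rule neg_v_integrable(2)) (use assms in simp)
  then show ?thesis unfolding neg_energy_def by (rule set_borel_integral_eq_integral)
qed

lemma pos_energy_eq:
  assumes "t \<ge> 0" shows "pos_energy u t a b = integral {a..b} (\<lambda>x. (max (- (- dx u t x)) 0)\<^sup>2)"
proof -
  interpret CH_flow t M "2 * M" "\<lambda>s x. - u (t - s) x" "\<lambda>s x. - dx u (t - s) x"
    by (rule CH_flow_reversed[OF solution_is_CH_flow])
  have "set_integrable lborel {a..b} (\<lambda>x. (max (- (- dx u (t - 0) x)) 0)\<^sup>2)"
    by (rule neg_v_integrable(2)) (use assms in simp)
  then have i: "set_integrable lborel {a..b} (\<lambda>x. (max (- (- dx u t x)) 0)\<^sup>2)" by simp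
  show ?thesis
    using set_borel_integral_eq_integral(2)[OF i] unfolding pos_energy_def by simp
qed

text \<open>The inequality for \<open>pos_energy\<close> is that for the reversed flow, whose compression energy it is.\<close>

lemma energy_growth:
  assumes c: "characteristic u \<alpha>" "characteristic u \<beta>" and T: "T \<ge> 0"
  shows "\<exists>K\<ge>0. \<forall>s t. 0 \<le> s \<longrightarrow> s \<le> t \<longrightarrow> t \<le> T \<longrightarrow>
     neg_energy u t (\<alpha> t) (\<beta> t) \<le> neg_energy u s (\<alpha> s) (\<beta> s) + K * (t - s) \<and>
     pos_energy u s (\<alpha> s) (\<beta> s) \<le> pos_energy u t (\<alpha> t) (\<beta> t) + K * (t - s)"
proof -
  interpret F: CH_flow T M "2 * M" u "dx u" by (rule solution_is_CH_flow)
  interpret R: CH_flow T M "2 * M" "\<lambda>s x. - u (T - s) x" "\<lambda>s x. - dx u (T - s) x"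
    by (rule CH_flow_reversed[OF solution_is_CH_flow])
  have cF: "F.curve 0 T \<alpha>" "F.curve 0 T \<beta>" using characteristic_curve[OF _ T] c by auto
  have cR: "R.curve 0 T (\<lambda>t. \<zeta> (T - t))" if "F.curve 0 T \<zeta>" for \<zeta>
    unfolding R.curve_def
  proof
    fix t assume t: "t \<in> {0..T}"
    have "((\<zeta> \<circ> (\<lambda>t. T - t)) has_real_derivative u (T - t) (\<zeta> (T - t)) * (- 1)) (at t within {0..T})"
    proof (rule DERIV_image_chain)
      have "(\<zeta> has_real_derivative u (T - t) (\<zeta> (T - t))) (at (T - t) within {0..T})"
        using that t by (simp add: F.curve_def)
      then show "(\<zeta> has_real_derivative u (T - t) (\<zeta> (T - t))) (at (T - t) within (\<lambda>t. T - t) ` {0..T})"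
        by (rule DERIV_subset) auto
      show "((\<lambda>t. T - t) has_real_derivative - 1) (at t within {0..T})"
        by (auto intro!: derivative_eq_intros)
    qed
    then show "((\<lambda>t. \<zeta> (T - t)) has_real_derivative - u (T - t) (\<zeta> (T - t))) (at t within {0..T})"
      by (simp add: o_def)
  qed
  have "continuous_on {0..T} (\<lambda>r. \<beta> r - \<alpha> r)"
    by (intro continuous_on_diff F.curve_continuous cF)
  then obtain L where L: "L \<ge> 0" "\<And>r. r \<in> {0..T} \<Longrightarrow> \<bar>\<beta> r - \<alpha> r\<bar> \<le> L"
    using continuous_bounded_on_Icc by blast
  define K where "K = M * (L + 2 * M)"
  have K: "K \<ge> 0" using L(1) M_nonneg by (simp add: K_def)
  have "neg_energy u t (\<alpha> t) (\<beta> t) \<le> neg_energy u s (\<alpha> s) (\<beta> s) + K * (t - s)"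
    if "0 \<le> s" "s \<le> t" "t \<le> T" for s t
    using F.compression_growth_any_order[OF that cF L(2)] that
    by (simp add: F.compression_def neg_energy_eq K_def)
  moreover have "pos_energy u s (\<alpha> s) (\<beta> s) \<le> pos_energy u t (\<alpha> t) (\<beta> t) + K * (t - s)"
    if st: "0 \<le> s" "s \<le> t" "t \<le> T" for s t
  proof -
    have "R.compression (T - s) (\<alpha> (T - (T - s))) (\<beta> (T - (T - s)))
        \<le> R.compression (T - t) (\<alpha> (T - (T - t))) (\<beta> (T - (T - t))) + M * (L + 2 * M) * ((T - s) - (T - t))"
      by (rule R.compression_growth_any_order[where \<alpha> = "\<lambda>r. \<alpha> (T - r)" and \<beta> = "\<lambda>r. \<beta> (T - r)"])
         (use st cR cF L(2) in auto)
    then show ?thesis using st by (simp add: R.compression_def pos_energy_eq K_def)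
  qed
  ultimately show ?thesis using K by blast
qed

lemma neg_energy_right_lower_semicontinuous:
  assumes c: "characteristic u \<alpha>" "characteristic u \<beta>" and t0: "0 \<le> t0" and lt: "\<alpha> t0 < \<beta> t0"
    and e: "e < neg_energy u t0 (\<alpha> t0) (\<beta> t0)"
  shows "\<forall>\<^sub>F t in at_right t0. e < neg_energy u t (\<alpha> t) (\<beta> t)"
proof -
  define T where "T = t0 + 1"
  interpret F: CH_flow T M "2 * M" u "dx u" by (rule solution_is_CH_flow)
  have lim: "(\<zeta> \<longlongrightarrow> \<zeta> t0) (at t0 within {t0..T})" if "characteristic u \<zeta>" for \<zeta>
  proof -
    have "continuous_on {0..T} \<zeta>"
      using F.curve_continuous[OF characteristic_curve[OF that, of T]] t0 by (simp add: T_def)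
    then have "continuous_on {t0..T} \<zeta>" by (rule continuous_on_subset) (use t0 in auto)
    then show ?thesis by (simp add: continuous_on_def T_def)
  qed
  have e': "e < F.compression t0 (\<alpha> t0) (\<beta> t0)" using e by (simp add: F.compression_def neg_energy_eq t0)
  have "\<forall>\<^sub>F t in at t0 within {t0..T}. e < F.compression t (\<alpha> t) (\<beta> t)"
    by (rule F.compression_lower_semicontinuous[OF _ _ lim[OF c(1)] lim[OF c(2)] lt e'])
       (use t0 in \<open>auto simp: T_def\<close>)
  then have "\<forall>\<^sub>F t in at_right t0. e < F.compression t (\<alpha> t) (\<beta> t)"
    by (simp add: at_within_Icc_at_right T_def)
  then show ?thesis using eventually_at_right_less[of t0]
    by eventually_elim (use t0 in \<open>simp add: F.compression_def neg_energy_eq\<close>)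
qed

lemma pos_energy_left_lower_semicontinuous:
  assumes c: "characteristic u \<alpha>" "characteristic u \<beta>" and t0: "0 < t0" and lt: "\<alpha> t0 < \<beta> t0"
    and e: "e < pos_energy u t0 (\<alpha> t0) (\<beta> t0)"
  shows "\<forall>\<^sub>F t in at_left t0. e < pos_energy u t (\<alpha> t) (\<beta> t)"
proof -
  interpret F: CH_flow t0 M "2 * M" u "dx u" by (rule solution_is_CH_flow)
  interpret R: CH_flow t0 M "2 * M" "\<lambda>s x. - u (t0 - s) x" "\<lambda>s x. - dx u (t0 - s) x"
    by (rule CH_flow_reversed[OF solution_is_CH_flow])
  have lim: "((\<lambda>r. \<zeta> (t0 - r)) \<longlongrightarrow> \<zeta> (t0 - 0)) (at 0 within {0..t0})" if "characteristic u \<zeta>" for \<zeta>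
  proof -
    have "continuous_on {0..t0} \<zeta>"
      using F.curve_continuous[OF characteristic_curve[OF that, of t0]] t0 by simp
    then have "continuous_on {0..t0} (\<lambda>r. \<zeta> (t0 - r))"
      by (rule continuous_on_compose2) (auto intro!: continuous_intros)
    then show ?thesis using t0 unfolding continuous_on_def by (metis atLeastAtMost_iff less_imp_le order_refl)
  qed
  have e': "e < R.compression 0 (\<alpha> (t0 - 0)) (\<beta> (t0 - 0))"
    using e t0 by (simp add: R.compression_def pos_energy_eq)
  have "\<forall>\<^sub>F r in at 0 within {0..t0}. e < R.compression r (\<alpha> (t0 - r)) (\<beta> (t0 - r))"
    by (rule R.compression_lower_semicontinuous[where \<alpha> = "\<lambda>r. \<alpha> (t0 - r)" and \<beta> = "\<lambda>r. \<beta> (t0 - r)", OF _ _ lim[OF c(1)] lim[OF c(2)] _ e'])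
       (use t0 lt in auto)
  then have "\<forall>\<^sub>F r in at_right 0. e < R.compression r (\<alpha> (t0 - r)) (\<beta> (t0 - r))"
    using t0 by (simp add: at_within_Icc_at_right)
  then obtain d where d: "d > 0" "\<And>r. 0 < r \<Longrightarrow> r < d \<Longrightarrow> e < R.compression r (\<alpha> (t0 - r)) (\<beta> (t0 - r))"
    unfolding eventually_at_right_field by auto
  show ?thesis
    unfolding eventually_at_left_field
  proof (intro exI[of _ "max 0 (t0 - d)"] conjI allI impI)
    show "max 0 (t0 - d) < t0" using t0 d(1) by simp
    fix t assume t: "max 0 (t0 - d) < t" "t < t0"
    have "e < R.compression (t0 - t) (\<alpha> (t0 - (t0 - t))) (\<beta> (t0 - (t0 - t)))" by (rule d(2)) (use t in auto)
    then show "e < pos_energy u t (\<alpha> t) (\<beta> t)" using t by (simp add: R.compression_def pos_energy_eq)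
  qed
qed

lemma neg_energy_nonneg: "0 \<le> neg_energy u t a b" and pos_energy_nonneg: "0 \<le> pos_energy u t a b"
  unfolding neg_energy_def pos_energy_def set_lebesgue_integral_def by (auto intro!: integral_nonneg_AE)

end

theorem theorem2p8:
  fixes u0 :: "real \<Rightarrow> real" and u :: "real \<Rightarrow> real \<Rightarrow> real"
    and \<alpha> \<beta> :: "real \<Rightarrow> real" and t0 :: real
  assumes "weak_solution u0 u"
    and "0 \<le> t0"
    and "characteristic u \<alpha>" and "characteristic u \<beta>"
    and "\<alpha> t0 < \<beta> t0"
  shows
    "((\<lambda>t. neg_energy u t (\<alpha> t) (\<beta> t)) \<longlongrightarrow> neg_energy u t0 (\<alpha> t0) (\<beta> t0)) (at_right t0)
     \<and> (0 < t0 \<longrightarrow>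
         ((\<lambda>t. pos_energy u t (\<alpha> t) (\<beta> t)) \<longlongrightarrow> pos_energy u t0 (\<alpha> t0) (\<beta> t0)) (at_left t0))
     \<and> locally_bounded_variation_on {0..} (\<lambda>t. pos_energy u t (\<alpha> t) (\<beta> t))
     \<and> locally_bounded_variation_on {0..} (\<lambda>t. neg_energy u t (\<alpha> t) (\<beta> t))
     \<and> (\<exists>\<Lambda>p\<ge>0. ((\<lambda>t. pos_energy u t (\<alpha> t) (\<beta> t)) \<longlongrightarrow> \<Lambda>p) (at_right t0))
     \<and> (0 < t0 \<longrightarrow>
         (\<exists>\<Lambda>m\<ge>0. ((\<lambda>t. neg_energy u t (\<alpha> t) (\<beta> t)) \<longlongrightarrow> \<Lambda>m) (at_left t0)))"
proof -
  obtain M where M: "M \<ge> 0" "\<forall>t\<ge>0. finite_energy u M t"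
    using weak_solution_energy[OF assms(1)] by blast
  interpret CH_solution u0 u M
    by unfold_locales (use assms(1) M in auto)
  define N where "N t = neg_energy u t (\<alpha> t) (\<beta> t)" for t
  define P where "P t = pos_energy u t (\<alpha> t) (\<beta> t)" for t
  have growth: "\<exists>K\<ge>0. \<forall>s t. 0 \<le> s \<longrightarrow> s \<le> t \<longrightarrow> t \<le> T \<longrightarrow> N t \<le> N s + K * (t - s) \<and> P s \<le> P t + K * (t - s)"
    if "T \<ge> 0" for T
    unfolding N_def P_def by (rule energy_growth[OF assms(3,4) that])
  have N0: "0 \<le> N t" and P0: "0 \<le> P t" for t
    unfolding N_def P_def by (rule neg_energy_nonneg pos_energy_nonneg)+
  define T where "T = t0 + 1"
  have T: "T \<ge> 0" "t0 < T" using assms(2) by (auto simp: T_def)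
  obtain K where K: "K \<ge> 0" and Ng: "\<And>s t. 0 \<le> s \<Longrightarrow> s \<le> t \<Longrightarrow> t \<le> T \<Longrightarrow> N t \<le> N s + K * (t - s)"
    and Pg: "\<And>s t. 0 \<le> s \<Longrightarrow> s \<le> t \<Longrightarrow> t \<le> T \<Longrightarrow> P s \<le> P t + K * (t - s)"
    using growth[OF T(1)] by blast
  have A1: "(N \<longlongrightarrow> N t0) (at_right t0)"
  proof (rule order_tendstoI)
    show "\<forall>\<^sub>F t in at_right t0. e < N t" if "e < N t0" for e
      unfolding N_def by (rule neg_energy_right_lower_semicontinuous[OF assms(3,4,2,5)]) (use that in \<open>simp add: N_def\<close>)
    show "\<forall>\<^sub>F t in at_right t0. N t < e" if "N t0 < e" for e
    proof -
      have "((\<lambda>t. N t0 + K * (t - t0)) \<longlongrightarrow> N t0 + K * (t0 - t0)) (at_right t0)" by (intro tendsto_intros)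
      then have "\<forall>\<^sub>F t in at_right t0. N t0 + K * (t - t0) < e" by (rule order_tendstoD(2)) (use that in simp)
      then show ?thesis using eventually_at_right_real[OF T(2)]
      proof eventually_elim
        case (elim t)
        then show ?case using Ng[of t0 t] assms(2) by simp
      qed
    qed
  qed
  have A2: "(P \<longlongrightarrow> P t0) (at_left t0)" if t0: "0 < t0"
  proof (rule order_tendstoI)
    show "\<forall>\<^sub>F t in at_left t0. e < P t" if "e < P t0" for e
      unfolding P_def by (rule pos_energy_left_lower_semicontinuous[OF assms(3,4) t0 assms(5)]) (use that in \<open>simp add: P_def\<close>)
    show "\<forall>\<^sub>F t in at_left t0. P t < e" if "P t0 < e" for e
    proof -
      have "((\<lambda>t. P t0 + K * (t0 - t)) \<longlongrightarrow> P t0 + K * (t0 - t0)) (at_left t0)" by (intro tendsto_intros)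
      then have "\<forall>\<^sub>F t in at_left t0. P t0 + K * (t0 - t) < e" by (rule order_tendstoD(2)) (use that in simp)
      then show ?thesis using eventually_at_left_real[OF t0]
      proof eventually_elim
        case (elim t)
        then show ?case using Pg[of t t0] T by simp
      qed
    qed
  qed
  have BV: "bounded_variation_on {a..b} P \<and> bounded_variation_on {a..b} N" if ab: "{a..b} \<subseteq> {0..}" for a b
  proof (cases "a \<le> b")
    case False
    have "\<not> p ` {..n} \<subseteq> {a..b}" for p :: "nat \<Rightarrow> real" and n using False by auto
    then show ?thesis unfolding bounded_variation_on_def by blast
  next
    case True
    with ab have a: "0 \<le> a" by auto
    obtain K where K: "K \<ge> 0" and Ng: "\<And>s t. 0 \<le> s \<Longrightarrow> s \<le> t \<Longrightarrow> t \<le> b \<Longrightarrow> N t \<le> N s + K * (t - s)"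
      and Pg: "\<And>s t. 0 \<le> s \<Longrightarrow> s \<le> t \<Longrightarrow> t \<le> b \<Longrightarrow> P s \<le> P t + K * (t - s)"
      using growth[of b] a True by (metis order_trans)
    have "bounded_variation_on {a..b} N"
      by (rule almost_decreasing_bounded_variation[OF _ K]) (use Ng a in auto)
    moreover have "bounded_variation_on {a..b} (\<lambda>t. - P t)"
    proof (rule almost_decreasing_bounded_variation[OF _ K])
      show "- P t \<le> - P s + K * (t - s)" if "a \<le> s" "s \<le> t" "t \<le> b" for s t
        using Pg[of s t] that a by linarith
    qed
    ultimately show ?thesis using bounded_variation_on_uminus by blast
  qed
  have A5: "\<exists>l\<ge>0. (P \<longlongrightarrow> l) (at_right t0)"
    by (rule almost_increasing_right_limit[OF T(2), of P K]) (use Pg P0 assms(2) in auto)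
  have A6: "\<exists>l\<ge>0. (N \<longlongrightarrow> l) (at_left t0)" if t0: "0 < t0"
  proof -
    have "\<exists>l\<ge>0. ((\<lambda>s. N (- s)) \<longlongrightarrow> l) (at_right (- t0))"
    proof (rule almost_increasing_right_limit[where T = 0])
      show "N (- s) \<le> N (- t) + K * (t - s)" if "- t0 < s" "s \<le> t" "t \<le> 0" for s t
        using Ng[of "- t" "- s"] that T by simp
    qed (use t0 N0 in auto)
    then show ?thesis by (simp add: filterlim_at_left_to_right)
  qed
  show ?thesis
    using A1 A2 A5 A6 BV unfolding N_def[abs_def] P_def[abs_def] locally_bounded_variation_on_def by blast
qed

end
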